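(* Fix integers $N\ge 1$, $n\ge 1$ and a real number $\alpha>0$, and let all objects be as in the context. For every $\mathbf m\in\mathcal M_N$ the map $U^{\mathbf m}_{(+)}$ sends $W^{\mathbf m}_{(+)}$ into $B^{\mathbf m}$, and $U^{\mathbf m}_{(+)}:W^{\mathbf m}_{(+)}\to B^{\mathbf m}$ is an isomorphism of $Y(\mathfrak{gl}_n)$-modules; that is, it is a linear bijection and $U^{\mathbf m}_{(+)}\,T^{W,+}_{a,b}(u)\,w=T^{(+)}_{a,b}(u)\,U^{\mathbf m}_{(+)}\,w$ for all $w\in W^{\mathbf m}_{(+)}$ and all $a,b=1,\dots,n$ (coefficientwise in $u^{-1}$).
   Context: Let $\mathcal H=\mathbb C[z_1^{\pm1},\dots,z_N^{\pm1}]\otimes(\mathbb C^n)^{\otimes N}$ with a fixed basis $v_1,\dots,v_n$ of $\mathbb C^n$. For $\sigma\in\mathfrak S_N$ define operators on $\mathcal H$ by $K_\sigma\, z_1^{m_1}\cdots z_N^{m_N}\otimes v_{\epsilon_1}\otimes\cdots\otimes v_{\epsilon_N}=z_1^{m_{\sigma(1)}}\cdots z_N^{m_{\sigma(N)}}\otimes v_{\epsilon_1}\otimes\cdots\otimes v_{\epsilon_N}$ and $P_\sigma\, z_1^{m_1}\cdots z_N^{m_N}\otimes v_{\epsilon_1}\otimes\cdots\otimes v_{\epsilon_N}=z_1^{m_1}\cdots z_N^{m_N}\otimes v_{\epsilon_{\sigma(1)}}\otimes\cdots\otimes v_{\epsilon_{\sigma(N)}}$; write $K_{i,j},P_{i,j}$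 for transpositions $(i,j)$. Let $\mathcal H^{(+)}=\bigcap_{i=1}^{N-1}\mathrm{Ker}(K_{i,i+1}P_{i,i+1}-1)$. The Dunkl operators (acting on the polynomial factor) are $d_i=\alpha z_i\frac{\partial}{\partial z_i}-i+\sum_{j>i}\frac{z_j}{z_j-z_i}(K_{i,j}-1)-\sum_{j<i}\frac{z_i}{z_i-z_j}(K_{i,j}-1)$, $i=1,\dots,N$. Define $\hat T_0(u)=\left(1+\frac{P_{0,1}}{u-d_1}\right)\cdots\left(1+\frac{P_{0,N}}{u-d_N}\right)\in \mathrm{End}(\mathbb C^n)\otimes\mathrm{End}(\mathcal H)[[u^{-1}]]$, where the extra copy $\mathbb C^n$ is labeled $0$ and $P_{0,i}$ permutes tensor factors $0$ and $i$; write $\hat T_0(u)=\sum_{a,b}E_{a,b}\otimes\hat T_{a,b}(u)$ with $E_{a,b}$ matrix units. The coefficients of $\hat T_{a,b}(u)$ preserve $\mathcal H^{(+)}$; $T^{(+)}_{a,b}(u)$ denotes their restriction to $\mathcal H^{(+)}$ (they satisfy the relations of the Yangian $Y(\mathfrak{gl}_n)$). Let $\mathcal M_N=\{\mathbf m\in\mathbb Z^N: m_1\ge\cdots\ge m_N\}$. For $\mathbf m\in\mathcal M_N$ let $S^{\mathbf m}\subset\mathfrak S_N$ be the set of $\sigma$ with $\sigma(i)=\#\{j\le i: m_{\sigma(j)}\ge m_{\sigma(i)}\}+\#\{j>i: m_{\sigma(j)}>m_{\sigma(i)}\}$ for all $i$. Put $\xi^{\mathbf m}_i(\sigma)=\alpha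 m_{\sigma(i)}-\sigma(i)$, $\xi^{\mathbf m}_i=\alpha m_i-i$. For $\sigma\in S^{\mathbf m}$, $\Phi^{\mathbf m}_\sigma(z)$ is the unique Laurent polynomial which is a simultaneous eigenvector of $d_1,\dots,d_N$ with $d_i\Phi^{\mathbf m}_\sigma=\xi^{\mathbf m}_i(\sigma)\Phi^{\mathbf m}_\sigma$ and in which $z_1^{m_{\sigma(1)}}\cdots z_N^{m_{\sigma(N)}}$ has coefficient $1$; these form a basis of $\mathbb C[z^{\pm1}]$. Let $E^{\mathbf m}=\bigoplus_{\sigma\in S^{\mathbf m}}\mathbb C\Phi^{\mathbf m}_\sigma$ and $B^{\mathbf m}=(E^{\mathbf m}\otimes(\mathbb C^n)^{\otimes N})\cap\mathcal H^{(+)}$, which is invariant under $T^{(+)}_{a,b}(u)$. Let $\check R_{i,i+1}(u)=u^{-1}+P_{i,i+1}$. Define $\check{\mathbb R}^{(+)}(\sigma)$, $\sigma\in S^{\mathbf m}$, by $\check{\mathbb R}^{(+)}(\mathrm{id})=1$ and $\check{\mathbb R}^{(+)}(\sigma\circ(i,i+1))=\check R_{i,i+1}\big(-\xi^{\mathbf m}_i(\sigma)+\xi^{\mathbf m}_{i+1}(\sigma)\big)\check{\mathbb R}^{(+)}(\sigma)$ whenever $\sigma\in S^{\mathbf m}$ and $m_{\sigma(i)}>m_{\sigma(i+1)}$ (this recursion defines $\check{\mathbb R}^{(+)}$ unambiguously on $S^{\mathbf m}$). Define $U^{\mathbf m}_{(+)}v=\sum_{\sigma\in S^{\mathbf m}}\Phi^{\mathbf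 m}_\sigma(z)\otimes\check{\mathbb R}^{(+)}(\sigma)v$ for $v\in(\mathbb C^n)^{\otimes N}$. Let $W^{\mathbf m}_{(+)}=\bigcap_{i:\,m_i=m_{i+1}}\mathrm{Ker}(P_{i,i+1}-1)$, a $Y(\mathfrak{gl}_n)$-module via $T^{W,+}_0(u)=\sum_{a,b}E_{a,b}\otimes T^{W,+}_{a,b}(u):=\left(1+\frac{P_{0,1}}{u-\xi^{\mathbf m}_1}\right)\cdots\left(1+\frac{P_{0,N}}{u-\xi^{\mathbf m}_N}\right)$. *)

theory Defs
  imports Complex_Main "HOL-Combinatorics.Permutations" "HOL-Library.Function_Algebras"
begin

text \<open>
  Variables z_1..z_N and tensor positions 1..N are indexed by naturals 1..N;
  position 0 is the auxiliary space labelled 0.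
  A Laurent monomial z_1^{m_1}...z_N^{m_N} is an exponent function  nat => int
  vanishing outside 1..N.  A Laurent polynomial is its coefficient function
  (exponent => complex) with finite support.  A basis vector v_{e_1} x ... x v_{e_N}
  of the tensor power is a label function e : nat => nat with e 0 = 0,
  e i in 1..n for 1 <= i <= N and e i = 0 for i > N (when the auxiliary space 0 is
  present, e 0 in 1..n).  An element of the tensor power is a coefficient function
  (label => complex); an element of H is a function label => Laurent polynomial,
  i.e. sum over e of p_e (x) v_e.
\<close>

type_synonym expo = "nat \<Rightarrow> int"
type_synonym lpoly = "expo \<Rightarrow> complex"
type_synonym label = "nat \<Rightarrow> nat"
type_synonym tvec = "label \<Rightarrow> complex"
type_synonym hvec = "label \<Rightarrow> lpoly"

definition valid_expo :: "nat \<Rightarrow> expo \<Rightarrow> bool" where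
  "valid_expo N m \<longleftrightarrow> (\<forall>i. i \<notin> {1..N} \<longrightarrow> m i = 0)"

definition valid_lpoly :: "nat \<Rightarrow> lpoly \<Rightarrow> bool" where
  "valid_lpoly N p \<longleftrightarrow> finite {m. p m \<noteq> 0} \<and> (\<forall>m. p m \<noteq> 0 \<longrightarrow> valid_expo N m)"

definition valid_label :: "nat \<Rightarrow> nat \<Rightarrow> label \<Rightarrow> bool" where
  "valid_label N n e \<longleftrightarrow> e 0 = 0 \<and> (\<forall>i\<in>{1..N}. e i \<in> {1..n}) \<and> (\<forall>i>N. e i = 0)"

definition valid_tvec :: "nat \<Rightarrow> nat \<Rightarrow> tvec \<Rightarrow> bool" where
  "valid_tvec N n v \<longleftrightarrow> (\<forall>e. v e \<noteq> 0 \<longrightarrow> valid_label N n e)"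

definition valid_hvec :: "nat \<Rightarrow> nat \<Rightarrow> hvec \<Rightarrow> bool" where
  "valid_hvec N n h \<longleftrightarrow> (\<forall>e. h e \<noteq> 0 \<longrightarrow> valid_label N n e) \<and> (\<forall>e. valid_lpoly N (h e))"

definition Kop :: "nat \<Rightarrow> nat \<Rightarrow> lpoly \<Rightarrow> lpoly" where
  "Kop i j p = (\<lambda>m. p (m \<circ> transpose i j))"

definition Pop :: "nat \<Rightarrow> nat \<Rightarrow> (label \<Rightarrow> 'p) \<Rightarrow> (label \<Rightarrow> 'p)" where
  "Pop i j x = (\<lambda>e. x (e \<circ> transpose i j))"

text \<open>Coefficient of z^{m'} in  z_j/(z_j - z_i) (K_{i,j} - 1) z^m  (i ~= j):
  with a = m_i, b = m_j, it equals
  sgn(a-b) * sum_{0<=k<|a-b|} z^{m with m_i := min a b + k, m_j := max a b - k}.\<close>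

definition dd_coeff :: "nat \<Rightarrow> nat \<Rightarrow> expo \<Rightarrow> expo \<Rightarrow> complex" where
  "dd_coeff i j m m' =
     (let a = m i; b = m j; lo = min a b; hi = max a b in
      of_int (sgn (a - b)) *
      (if \<exists>k::int. 0 \<le> k \<and> k < hi - lo \<and> m' = m(i := lo + k, j := hi - k) then 1 else 0))"

definition dd :: "nat \<Rightarrow> nat \<Rightarrow> lpoly \<Rightarrow> lpoly" where
  "dd i j p = (\<lambda>m'. \<Sum>m\<in>{m. p m \<noteq> 0}. p m * dd_coeff i j m m')"

text \<open>d_i = alpha z_i d/dz_i - i + sum_{j>i} z_j/(z_j-z_i)(K_{ij}-1) - sum_{j<i} z_i/(z_i-z_j)(K_{ij}-1).\<close>

definition dunkl :: "nat \<Rightarrow> real \<Rightarrow> nat \<Rightarrow> lpoly \<Rightarrow> lpoly" where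
  "dunkl N \<alpha> i p = (\<lambda>m'. complex_of_real \<alpha> * of_int (m' i) * p m' - of_nat i * p m'
      + (\<Sum>j\<in>{i<..N}. dd i j p m') - (\<Sum>j\<in>{1..<i}. dd j i p m'))"

text \<open>A formal series in u^{-1} with operator coefficients is  nat => (x => x),
  coefficient r of u^{-r}.  Product of series (operator composition).\<close>

definition sprod :: "(nat \<Rightarrow> ('x \<Rightarrow> 'x)) \<Rightarrow> (nat \<Rightarrow> ('x \<Rightarrow> 'x)) \<Rightarrow> nat \<Rightarrow> 'x \<Rightarrow> ('x::comm_monoid_add)" where
  "sprod A B r x = (\<Sum>j\<le>r. A j (B (r - j) x))"

definition sone :: "nat \<Rightarrow> 'x \<Rightarrow> ('x::comm_monoid_add)" where
  "sone r x = (if r = 0 then x else 0)"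

text \<open>Factor 1 + P_{0,i}/(u - D_i) = 1 + sum_{k>=0} P_{0,i} D_i^k u^{-k-1},
  where D_i acts on the non-spin part (commuting with P_{0,i}).\<close>

definition sfactor :: "(nat \<Rightarrow> 'p \<Rightarrow> 'p) \<Rightarrow> nat \<Rightarrow> nat \<Rightarrow> (label \<Rightarrow> 'p) \<Rightarrow> (label \<Rightarrow> 'p)" where
  "sfactor D i r x = (if r = 0 then x else Pop 0 i (\<lambda>e. (D i ^^ (r - 1)) (x e)))"

definition Tser :: "(nat \<Rightarrow> 'p \<Rightarrow> 'p) \<Rightarrow> nat \<Rightarrow> nat \<Rightarrow> (label \<Rightarrow> 'p) \<Rightarrow> (label \<Rightarrow> ('p::comm_monoid_add))" where
  "Tser D N = foldr (\<lambda>i acc. sprod (sfactor D i) acc) [1..<Suc N] sone"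

text \<open>Matrix entry (a,b): coefficient of u^{-r} of T_{a,b}(u), acting on vectors
  without auxiliary space:  T_{a,b} x = <e_a| T_0 (e_b (x) x).\<close>

definition Tab :: "(nat \<Rightarrow> 'p \<Rightarrow> 'p) \<Rightarrow> nat \<Rightarrow> nat \<Rightarrow> nat \<Rightarrow> nat \<Rightarrow> (label \<Rightarrow> 'p) \<Rightarrow> (label \<Rightarrow> ('p::comm_monoid_add))" where
  "Tab D N a b r x =
     (\<lambda>e. if e 0 = 0 then
            Tser D N r (\<lambda>e'. if e' 0 = b then x (e'(0 := 0)) else 0) (e(0 := a))
          else 0)"

definition TH :: "nat \<Rightarrow> real \<Rightarrow> nat \<Rightarrow> nat \<Rightarrow> nat \<Rightarrow> hvec \<Rightarrow> hvec" where
  "TH N \<alpha> a b r = Tab (dunkl N \<alpha>) N a b r"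

definition MN :: "nat \<Rightarrow> expo set" where
  "MN N = {m. valid_expo N m \<and> (\<forall>i\<in>{1..<N}. m i \<ge> m (Suc i))}"

definition Sm :: "nat \<Rightarrow> expo \<Rightarrow> (nat \<Rightarrow> nat) set" where
  "Sm N m = {\<sigma>. \<sigma> permutes {1..N} \<and>
      (\<forall>i\<in>{1..N}. \<sigma> i = card {j\<in>{1..i}. m (\<sigma> j) \<ge> m (\<sigma> i)}
                          + card {j\<in>{i<..N}. m (\<sigma> j) > m (\<sigma> i)})}"

definition xi_sig :: "real \<Rightarrow> expo \<Rightarrow> (nat \<Rightarrow> nat) \<Rightarrow> nat \<Rightarrow> complex" where
  "xi_sig \<alpha> m \<sigma> i = complex_of_real (\<alpha> * of_int (m (\<sigma> i)) - of_nat (\<sigma> i))"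

definition xi :: "real \<Rightarrow> expo \<Rightarrow> nat \<Rightarrow> complex" where
  "xi \<alpha> m i = complex_of_real (\<alpha> * of_int (m i) - of_nat i)"

definition Phi :: "nat \<Rightarrow> real \<Rightarrow> expo \<Rightarrow> (nat \<Rightarrow> nat) \<Rightarrow> lpoly" where
  "Phi N \<alpha> m \<sigma> = (THE p. valid_lpoly N p \<and> p (m \<circ> \<sigma>) = 1 \<and>
      (\<forall>i\<in>{1..N}. dunkl N \<alpha> i p = (\<lambda>m'. xi_sig \<alpha> m \<sigma> i * p m')))"

definition Em :: "nat \<Rightarrow> real \<Rightarrow> expo \<Rightarrow> lpoly set" where
  "Em N \<alpha> m = {p. \<exists>c. p = (\<lambda>m'. \<Sum>\<sigma>\<in>Sm N m. c \<sigma> * Phi N \<alpha> m \<sigma> m')}"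

definition Hplus :: "nat \<Rightarrow> nat \<Rightarrow> hvec set" where
  "Hplus N n = {h. valid_hvec N n h \<and>
      (\<forall>i\<in>{1..<N}. (\<lambda>e. Kop i (Suc i) (Pop i (Suc i) h e)) = h)}"

definition Bm :: "nat \<Rightarrow> nat \<Rightarrow> real \<Rightarrow> expo \<Rightarrow> hvec set" where
  "Bm N n \<alpha> m = {h. h \<in> Hplus N n \<and> (\<forall>e. h e \<in> Em N \<alpha> m)}"

definition Rchk :: "nat \<Rightarrow> complex \<Rightarrow> tvec \<Rightarrow> tvec" where
  "Rchk i u v = (\<lambda>e. inverse u * v e + Pop i (Suc i) v e)"

inductive Rrel :: "nat \<Rightarrow> real \<Rightarrow> expo \<Rightarrow> (nat \<Rightarrow> nat) \<Rightarrow> (tvec \<Rightarrow> tvec) \<Rightarrow> bool"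
  for N \<alpha> m where
  Rrel_id: "Rrel N \<alpha> m id (\<lambda>v. v)"
| Rrel_step: "Rrel N \<alpha> m \<sigma> M \<Longrightarrow> \<sigma> \<in> Sm N m \<Longrightarrow> i \<in> {1..<N} \<Longrightarrow>
     m (\<sigma> i) > m (\<sigma> (Suc i)) \<Longrightarrow>
     Rrel N \<alpha> m (\<sigma> \<circ> transpose i (Suc i))
       (Rchk i (- xi_sig \<alpha> m \<sigma> i + xi_sig \<alpha> m \<sigma> (Suc i)) \<circ> M)"

definition Rcal :: "nat \<Rightarrow> real \<Rightarrow> expo \<Rightarrow> (nat \<Rightarrow> nat) \<Rightarrow> tvec \<Rightarrow> tvec" where
  "Rcal N \<alpha> m \<sigma> = (THE M. Rrel N \<alpha> m \<sigma> M)"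

definition Um :: "nat \<Rightarrow> real \<Rightarrow> expo \<Rightarrow> tvec \<Rightarrow> hvec" where
  "Um N \<alpha> m v = (\<lambda>e m'. \<Sum>\<sigma>\<in>Sm N m. Rcal N \<alpha> m \<sigma> v e * Phi N \<alpha> m \<sigma> m')"

definition Wm :: "nat \<Rightarrow> nat \<Rightarrow> expo \<Rightarrow> tvec set" where
  "Wm N n m = {v. valid_tvec N n v \<and>
      (\<forall>i\<in>{1..<N}. m i = m (Suc i) \<longrightarrow> Pop i (Suc i) v = v)}"

definition TW :: "nat \<Rightarrow> real \<Rightarrow> expo \<Rightarrow> nat \<Rightarrow> nat \<Rightarrow> nat \<Rightarrow> tvec \<Rightarrow> tvec" where
  "TW N \<alpha> m a b r = Tab (\<lambda>i c. xi \<alpha> m i * c) N a b r"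

end

theory Submission
  imports Defs
begin

text \<open>
  The Dunkl operators are triangular on monomials with jointly simple spectrum, and
  \<open>K d\<^sub>i = d\<^sub>i\<^sub>+\<^sub>1 K + 1\<close> for the adjacent transposition \<open>K\<close> of \<open>i\<close> and \<open>i + 1\<close>. Hence \<open>K\<close> acts on the pair
  \<open>\<Phi>\<^sub>\<sigma>\<close>, \<open>\<Phi>\<^sub>\<sigma>\<^sub>s\<close> by an explicit two by two matrix with entries in \<open>a = 1 / (\<xi>\<^sub>i(\<sigma>) - \<xi>\<^sub>i\<^sub>+\<^sub>1(\<sigma>))\<close>, and fixes
  \<open>\<Phi>\<^sub>\<sigma>\<close> if the two exponents agree. Therefore \<open>\<Sum> \<Phi>\<^sub>\<sigma> \<otimes> V\<^sub>\<sigma>\<close> is invariant under all \<open>K P\<close> iff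
  \<open>V\<^sub>\<sigma>\<^sub>s = (P - a) V\<^sub>\<sigma>\<close> whenever the larger exponent is on the left and \<open>P V\<^sub>\<sigma> = V\<^sub>\<sigma>\<close> at equal exponents.
  The first condition is the recursion for the R-matrices, so the family is determined by the vector at the
  identity; the second one then reduces to membership of that vector in \<open>W\<close> by the Yang-Baxter
  equation. The Yangian action on \<open>\<Phi>\<^sub>\<sigma> \<otimes> V\<close> has the Dunkl operators replaced by their eigenvalues, and the
  Yang-Baxter equation with the auxiliary space moves it through the R-matrices.
\<close>

section \<open>Eigenvalues and triangularity of divided differences\<close>

text \<open>Both \<open>Phi\<close> and \<open>Rcal\<close> are definite descriptions, so existence
  and uniqueness of the eigenvectors and of the R-matrix products must be established before
  anything can be computed with them. Eigenvalues are attached to arbitrary exponents instead of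
  permutations, because a member \<open>\<sigma>\<close> of \<open>Sm\<close> is the rank function
  of the exponent \<open>m \<circ> \<sigma>\<close>. For \<alpha> > 0 the two parts of an
  eigenvalue, \<alpha> times the exponent and minus the rank, vary in the same direction. This keeps
  eigenvalues at different positions apart, lets them recover the exponent, and makes the gap d at
  unequal neighbours exceed 1 in absolute value, so that the intertwiner \<open>K - 1 / d\<close>
  cannot annihilate an eigenvector there. At equal neighbours the gap is exactly 1; this one
  degenerate case yields both the symmetry of \<open>Phi\<close> and the factor \<open>P - 1\<close>
  behind the space \<open>Wm\<close>. That the recursion for the R-matrices is unambiguous is a
  confluence argument: commuting squares and Yang-Baxter hexagons.\<close>

definition before :: "expo \<Rightarrow> nat \<Rightarrow> nat \<Rightarrow> bool" where
  "before \<mu> j i \<longleftrightarrow> \<mu> j > \<mu> i \<or> (\<mu> j = \<mu> i \<and> j \<le> i)"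

text \<open>For \<open>\<mu> = m \<circ> \<sigma>\<close> this count is the right-hand side in the
  definition of \<open>Sm\<close>, ties being broken by position.\<close>

definition rank :: "nat \<Rightarrow> expo \<Rightarrow> nat \<Rightarrow> nat" where
  "rank N \<mu> i = card {j\<in>{1..N}. before \<mu> j i}"

definition eigval :: "nat \<Rightarrow> real \<Rightarrow> expo \<Rightarrow> nat \<Rightarrow> real" where
  "eigval N \<alpha> \<mu> i = \<alpha> * of_int (\<mu> i) - of_nat (rank N \<mu> i)"

lemma before_total: "\<not> before \<mu> j i \<Longrightarrow> before \<mu> i j"
  by (auto simp: before_def)

lemma before_trans: "before \<mu> i j \<Longrightarrow> before \<mu> j k \<Longrightarrow> before \<mu> i k"
  by (auto simp: before_def)

lemma rank_mono: "before \<mu> i j \<Longrightarrow> rank N \<mu> i \<le> rank N \<mu> j"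
  unfolding rank_def by (rule card_mono) (auto intro: before_trans)

lemma rank_strict_mono:
  assumes "before \<mu> i j" "i \<noteq> j" "j \<in> {1..N}"
  shows "rank N \<mu> i < rank N \<mu> j"
  unfolding rank_def
proof (rule psubset_card_mono)
  have "\<not> before \<mu> j i" "before \<mu> j j"
    using assms by (auto simp: before_def)
  then show "{k\<in>{1..N}. before \<mu> k i} \<subset> {k\<in>{1..N}. before \<mu> k j}"
    using assms by (auto intro: before_trans)
qed simp

lemma rank_alt:
  assumes "i \<in> {1..N}"
  shows "rank N \<mu> i = card {j\<in>{1..i}. \<mu> j \<ge> \<mu> i} + card {j\<in>{i<..N}. \<mu> j > \<mu> i}"
proof -
  have "{j\<in>{1..N}. before \<mu> j i} = {j\<in>{1..i}. \<mu> j \<ge> \<mu> i} \<union> {j\<in>{i<..N}. \<mu> j > \<mu> i}"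
    using assms by (auto simp: before_def)
  then show ?thesis
    unfolding rank_def by (simp add: card_Un_disjoint disjoint_iff)
qed

text \<open>An earlier position has at least as large an exponent and at most as large a rank, so
  for \<alpha> > 0 the two contributions never compete; distinct positions differ strictly through
  the rank.\<close>

lemma eigval_le_iff:
  assumes "\<alpha> > 0" "i \<in> {1..N}" "j \<in> {1..N}"
  shows "eigval N \<alpha> \<mu> i \<le> eigval N \<alpha> \<mu> j \<longleftrightarrow> before \<mu> j i"
proof
  assume le: "eigval N \<alpha> \<mu> i \<le> eigval N \<alpha> \<mu> j"
  show "before \<mu> j i"
  proof (rule ccontr)
    assume n: "\<not> before \<mu> j i"
    then have b: "before \<mu> i j" "i \<noteq> j"
      using before_total by (auto simp: before_def)
    then have "rank N \<mu> i < rank N \<mu> j"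
      using assms rank_strict_mono by blast
    moreover have "\<alpha> * of_int (\<mu> j) \<le> \<alpha> * of_int (\<mu> i)"
      using b assms by (auto simp: before_def)
    ultimately show False
      using le by (simp add: eigval_def)
  qed
next
  assume b: "before \<mu> j i"
  then have "rank N \<mu> j \<le> rank N \<mu> i"
    by (rule rank_mono)
  moreover have "\<alpha> * of_int (\<mu> i) \<le> \<alpha> * of_int (\<mu> j)"
    using b assms by (auto simp: before_def)
  ultimately show "eigval N \<alpha> \<mu> i \<le> eigval N \<alpha> \<mu> j"
    by (simp add: eigval_def)
qed

lemma rank_eigval:
  assumes "\<alpha> > 0" "i \<in> {1..N}"
  shows "rank N \<mu> i = card {j\<in>{1..N}. eigval N \<alpha> \<mu> i \<le> eigval N \<alpha> \<mu> j}"
  unfolding rank_def using assms eigval_le_iff[of \<alpha> i N _ \<mu>] by (metis (no_types, lifting))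

text \<open>Ranks can be counted by comparing eigenvalues, so they are carried along by
  \<open>\<pi>\<close>; removing them leaves \<alpha> times the exponents. The identity gives
  simplicity of the joint spectrum; an adjacent transposition serves the case of equal
  neighbours.\<close>

lemma eigval_determines_expo:
  assumes "\<alpha> > 0" "valid_expo N \<mu>" "valid_expo N \<nu>" "\<pi> permutes {1..N}"
    and eq: "\<And>i. i \<in> {1..N} \<Longrightarrow> eigval N \<alpha> \<nu> i = eigval N \<alpha> \<mu> (\<pi> i)"
  shows "\<nu> = \<mu> \<circ> \<pi>"
proof
  fix i
  show "\<nu> i = (\<mu> \<circ> \<pi>) i"
  proof (cases "i \<in> {1..N}")
    case True
    have pi: "\<pi> i \<in> {1..N}"
      using True assms(4) permutes_in_image by metis
    have inj: "inj \<pi>"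
      using assms(4) permutes_inj by blast
    have "rank N \<nu> i = card {j\<in>{1..N}. eigval N \<alpha> \<mu> (\<pi> i) \<le> eigval N \<alpha> \<mu> (\<pi> j)}"
      unfolding rank_eigval[OF assms(1) True] using eq True by (intro arg_cong[where f=card]) auto
    also have "\<dots> = card (\<pi> ` {j\<in>{1..N}. eigval N \<alpha> \<mu> (\<pi> i) \<le> eigval N \<alpha> \<mu> (\<pi> j)})"
      by (rule card_image[symmetric]) (meson inj inj_on_subset subset_UNIV)
    also have "\<pi> ` {j\<in>{1..N}. eigval N \<alpha> \<mu> (\<pi> i) \<le> eigval N \<alpha> \<mu> (\<pi> j)}
        = {j\<in>\<pi> ` {1..N}. eigval N \<alpha> \<mu> (\<pi> i) \<le> eigval N \<alpha> \<mu> j}"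
      by auto
    also have "\<pi> ` {1..N} = {1..N}"
      using assms(4) permutes_image by blast
    also have "card {j\<in>{1..N}. eigval N \<alpha> \<mu> (\<pi> i) \<le> eigval N \<alpha> \<mu> j} = rank N \<mu> (\<pi> i)"
      using rank_eigval[OF assms(1) pi] by simp
    finally have "\<alpha> * of_int (\<nu> i) = \<alpha> * of_int (\<mu> (\<pi> i))"
      using eq[OF True] by (simp add: eigval_def)
    then show ?thesis
      using assms(1) by simp
  next
    case False
    then have "\<pi> i = i"
      using assms(4) by (auto simp: permutes_def)
    then show ?thesis
      using False assms by (simp add: valid_expo_def)
  qed
qed

lemma eigval_inj:
  assumes "\<alpha> > 0" "valid_expo N \<mu>" "valid_expo N \<nu>"
    and "\<And>i. i \<in> {1..N} \<Longrightarrow> eigval N \<alpha> \<nu> i = eigval N \<alpha> \<mu> i"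
  shows "\<nu> = \<mu>"
  using eigval_determines_expo[OF assms(1-3) permutes_id] assms(4) by simp

section \<open>Ranks and eigenvalues under adjacent transpositions\<close>

lemma transpose_Suc_permutes: "i \<in> {1..<N} \<Longrightarrow> transpose i (Suc i) permutes {1..N}"
  by (rule permutes_swap_id) auto

lemma transpose_Suc_in_iff:
  "i \<in> {1..<N} \<Longrightarrow> transpose i (Suc i) j \<in> {1..N} \<longleftrightarrow> j \<in> {1..N}"
  using transpose_Suc_permutes permutes_in_image by metis

lemma comp_transpose_twice [simp]: "f \<circ> transpose i j \<circ> transpose i j = f"
  by (simp add: comp_assoc)

text \<open>Between the two swapped positions the unequal exponents decide the order; in a tie the
  positions would decide, and these do not move along.\<close>

lemma before_transpose:
  assumes "\<mu> i \<noteq> \<mu> (Suc i)"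
  shows "before (\<mu> \<circ> transpose i (Suc i)) j k \<longleftrightarrow>
    before \<mu> (transpose i (Suc i) j) (transpose i (Suc i) k)"
  using assms by (auto simp: before_def transpose_def)

lemma rank_transpose:
  assumes "i \<in> {1..<N}" "\<mu> i \<noteq> \<mu> (Suc i)"
  shows "rank N (\<mu> \<circ> transpose i (Suc i)) k = rank N \<mu> (transpose i (Suc i) k)"
proof -
  let ?s = "transpose i (Suc i)"
  have "card {j\<in>{1..N}. before \<mu> (?s j) (?s k)} = card (?s ` {j\<in>{1..N}. before \<mu> (?s j) (?s k)})"
    by (rule card_image[symmetric]) (meson inj_on_subset inj_transpose subset_UNIV)
  also have "?s ` {j\<in>{1..N}. before \<mu> (?s j) (?s k)} = {j\<in>{1..N}. before \<mu> j (?s k)}"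
    using transpose_Suc_in_iff[OF assms(1)] by (force simp del: atLeastAtMost_iff)
  finally show ?thesis
    unfolding rank_def before_transpose[OF assms(2)] .
qed

lemma eigval_transpose:
  assumes "i \<in> {1..<N}" "\<mu> i \<noteq> \<mu> (Suc i)"
  shows "eigval N \<alpha> (\<mu> \<circ> transpose i (Suc i)) k = eigval N \<alpha> \<mu> (transpose i (Suc i) k)"
  using rank_transpose[OF assms] by (simp add: eigval_def)

lemma rank_Suc_equal:
  assumes "i \<in> {1..<N}" "\<mu> i = \<mu> (Suc i)"
  shows "rank N \<mu> (Suc i) = Suc (rank N \<mu> i)"
proof -
  have "{j\<in>{1..N}. before \<mu> j (Suc i)} = insert (Suc i) {j\<in>{1..N}. before \<mu> j i}"
    using assms by (auto simp: before_def le_Suc_eq)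
  then show ?thesis
    unfolding rank_def by (simp add: before_def assms(2))
qed

text \<open>The ranks contribute at least 1 and the exponents a strictly positive amount. For a gap
  d above 1 the square of 1 / d is never 1, which later keeps intertwined eigenvectors
  nonzero.\<close>

lemma eigval_gap:
  assumes "\<alpha> > 0" "i \<in> {1..<N}" "\<mu> i > \<mu> (Suc i)"
  shows "eigval N \<alpha> \<mu> i - eigval N \<alpha> \<mu> (Suc i) > 1"
proof -
  have "rank N \<mu> i < rank N \<mu> (Suc i)"
    using assms by (intro rank_strict_mono) (auto simp: before_def)
  moreover have "\<alpha> * of_int (\<mu> (Suc i)) < \<alpha> * of_int (\<mu> i)"
    using assms by auto
  ultimately show ?thesis
    by (simp add: eigval_def)
qed

lemma valid_expo_transpose:
  "i \<in> {1..<N} \<Longrightarrow> valid_expo N (\<mu> \<circ> transpose i (Suc i)) \<longleftrightarrow> valid_expo N \<mu>"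
  unfolding valid_expo_def comp_def
  by (metis transpose_Suc_in_iff transpose_involutory)

section \<open>A triangularity order on exponents and the coefficients of divided
  differences\<close>

definition sqsum :: "nat \<Rightarrow> expo \<Rightarrow> int" where
  "sqsum N \<mu> = (\<Sum>i\<in>{1..N}. (\<mu> i)\<^sup>2)"

definition wsum :: "nat \<Rightarrow> expo \<Rightarrow> int" where
  "wsum N \<mu> = (\<Sum>i\<in>{1..N}. int i * \<mu> i)"

text \<open>A total preorder (no dominance order is needed) for which the Dunkl operators are triangular.\<close>
definition below :: "nat \<Rightarrow> expo \<Rightarrow> expo \<Rightarrow> bool" where
  "below N \<nu> \<mu> \<longleftrightarrow> sqsum N \<nu> < sqsum N \<mu> \<or> (sqsum N \<nu> = sqsum N \<mu> \<and> wsum N \<mu> < wsum N \<nu>)"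

lemma below_irrefl: "\<not> below N \<mu> \<mu>"
  and below_trans: "below N \<mu> \<nu> \<Longrightarrow> below N \<nu> \<rho> \<Longrightarrow> below N \<mu> \<rho>"
  by (auto simp: below_def)

lemma below_negtrans: "below N \<mu> \<rho> \<Longrightarrow> below N \<mu> \<nu> \<or> below N \<nu> \<rho>"
  by (auto simp: below_def)

lemma finite_below_maximal:
  assumes "finite S" "S \<noteq> {}"
  shows "\<exists>\<nu>\<in>S. \<forall>\<rho>\<in>S. \<not> below N \<nu> \<rho>"
  using assms
proof (induction rule: finite_ne_induct)
  case (singleton x)
  then show ?case by (simp add: below_irrefl)
next
  case (insert x F)
  then obtain \<nu> where "\<nu> \<in> F" "\<forall>\<rho>\<in>F. \<not> below N \<nu> \<rho>"
    by blast
  then show ?case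
    using below_irrefl below_trans by (cases "below N \<nu> x") blast+
qed

lemma sum_fun_upd2:
  fixes g :: "nat \<Rightarrow> int \<Rightarrow> int"
  assumes "i \<noteq> j" "i \<in> A" "j \<in> A" "finite A"
  shows "(\<Sum>k\<in>A. g k ((m(i := x, j := y)) k)) = (\<Sum>k\<in>A. g k (m k)) - g i (m i) - g j (m j) + g i x + g j y"
proof -
  have "(\<Sum>k\<in>A. h k) = h i + h j + (\<Sum>k\<in>A - {i} - {j}. h k)" for h :: "nat \<Rightarrow> int"
    using assms by (simp add: sum.remove[where x=i] sum.remove[where A="A - {i}" and x=j])
  note split = this
  have "(\<Sum>k\<in>A - {i} - {j}. g k ((m(i := x, j := y)) k)) = (\<Sum>k\<in>A - {i} - {j}. g k (m k))"
    by (rule sum.cong) auto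
  then show ?thesis
    using split[of "\<lambda>k. g k ((m(i := x, j := y)) k)"] split[of "\<lambda>k. g k (m k)"] assms(1) by simp
qed

lemma below_transpose:
  assumes "i \<in> {1..<N}" "\<mu> i > \<mu> (Suc i)"
  shows "below N (\<mu> \<circ> transpose i (Suc i)) \<mu>"
proof -
  have eq: "\<mu> \<circ> transpose i (Suc i) = \<mu>(i := \<mu> (Suc i), Suc i := \<mu> i)"
    by (auto simp: transpose_def)
  have "sqsum N (\<mu> \<circ> transpose i (Suc i)) = sqsum N \<mu>"
    unfolding sqsum_def eq
    using sum_fun_upd2[of i "Suc i" "{1..N}" "\<lambda>_ x. x\<^sup>2"] assms(1) by simp
  moreover have "wsum N (\<mu> \<circ> transpose i (Suc i)) = wsum N \<mu> + \<mu> i - \<mu> (Suc i)"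
    unfolding wsum_def eq
    using sum_fun_upd2[of i "Suc i" "{1..N}" "\<lambda>k x. int k * x" \<mu> "\<mu> (Suc i)" "\<mu> i"] assms(1)
    by (simp add: algebra_simps del: fun_upd_apply)
  ultimately show ?thesis
    using assms(2) by (simp add: below_def)
qed

text \<open>The strictly inner terms of a divided difference lower the sum of squares; the reflected term
  moves the larger exponent to the right.\<close>
lemma dd_coeff_triangular:
  assumes "i < j" "i \<in> {1..N}" "j \<in> {1..N}" "dd_coeff i j m m' \<noteq> 0"
  shows "m' = m \<or> below N m' m"
proof -
  define lo hi where "lo = min (m i) (m j)" and "hi = max (m i) (m j)"
  obtain k where k: "0 \<le> k" "k < hi - lo" "m' = m(i := lo + k, j := hi - k)"
    using assms(4) by (auto simp: dd_coeff_def Let_def lo_def hi_def split: if_splits)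
  have sq: "sqsum N m' = sqsum N m - (m i)\<^sup>2 - (m j)\<^sup>2 + (lo + k)\<^sup>2 + (hi - k)\<^sup>2"
    unfolding sqsum_def k(3) using sum_fun_upd2[of i j "{1..N}" "\<lambda>_ x. x\<^sup>2"] assms by simp
  have lohi: "(m i)\<^sup>2 + (m j)\<^sup>2 = lo\<^sup>2 + hi\<^sup>2"
    by (auto simp: lo_def hi_def min_def max_def)
  have sq': "sqsum N m' = sqsum N m - 2 * (k * (hi - lo - k))"
    using sq lohi by (simp add: algebra_simps power2_eq_square)
  show ?thesis
  proof (cases "k = 0")
    case False
    then have "k * (hi - lo - k) > 0"
      using k by simp
    then show ?thesis
      using sq' by (simp add: below_def)
  next
    case True
    have w: "wsum N m' = wsum N m - int i * m i - int j * m j + int i * lo + int j * hi"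
      unfolding wsum_def k(3) using sum_fun_upd2[of i j "{1..N}" "\<lambda>k x. int k * x"] assms True by simp
    show ?thesis
    proof (cases "m i < m j")
      case True
      then have "m' = m"
        using k \<open>k = 0\<close> by (auto simp: lo_def hi_def)
      then show ?thesis ..
    next
      case False
      then have lh: "lo = m j" "hi = m i" "m i > m j"
        using k by (auto simp: lo_def hi_def)
      have "(int j - int i) * (m i - m j) > 0"
        using lh assms by simp
      then have "wsum N m' > wsum N m"
        using w lh by (simp add: algebra_simps)
      then show ?thesis
        using sq' True by (simp add: below_def)
    qed
  qed
qed

text \<open>The range of \<open>k\<close> is half open, so only one of the two outermost monomials
  occurs, the one with the smaller exponent at \<open>i\<close>. It is \<open>m\<close> itself
  exactly when \<open>m i < m j\<close>, and then the sign is negative. This asymmetry becomes the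
  tie-breaking in \<open>rank\<close>.\<close>

lemma dd_coeff_diag:
  assumes "i \<noteq> j"
  shows "dd_coeff i j m m = (if m i < m j then - 1 else 0)"
proof -
  have "(\<exists>k::int. 0 \<le> k \<and> k < max (m i) (m j) - min (m i) (m j) \<and>
      m = m(i := min (m i) (m j) + k, j := max (m i) (m j) - k)) \<longleftrightarrow> m i < m j" (is "?L \<longleftrightarrow> _")
  proof
    assume ?L
    then obtain k where k: "0 \<le> k" "k < max (m i) (m j) - min (m i) (m j)"
      "m = m(i := min (m i) (m j) + k, j := max (m i) (m j) - k)"
      by blast
    from k(3) have "m i = min (m i) (m j) + k"
      using assms by (metis fun_upd_same fun_upd_twist)
    then show "m i < m j"
      using k by (auto simp: min_def max_def split: if_splits)
  next
    assume "m i < m j"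
    then show ?L
      by (intro exI[of _ 0]) auto
  qed
  then show ?thesis
    unfolding dd_coeff_def Let_def by simp
qed

lemma dd_coeff_conj:
  assumes "i \<noteq> j"
  shows "dd_coeff i j (m \<circ> transpose a b) m' = dd_coeff (transpose a b i) (transpose a b j) m (m' \<circ> transpose a b)"
proof -
  let ?s = "transpose a b"
  have "m' = (m \<circ> ?s)(i := x, j := y) \<longleftrightarrow> m' \<circ> ?s = m(?s i := x, ?s j := y)" for x y
  proof -
    have "(m \<circ> ?s)(i := x, j := y) \<circ> ?s = m(?s i := x, ?s j := y)"
      by (rule ext) (metis (no_types, lifting) comp_apply fun_upd_apply transpose_involutory)
    then show ?thesis
      by (metis comp_transpose_twice)
  qed
  then show ?thesis
    unfolding dd_coeff_def Let_def by simp
qed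

text \<open>Partial fractions: z_j / (z_j - z_i) and z_i / (z_i - z_j) add up to 1, so only K - 1
  remains. In coefficients the interior monomials cancel and the two ends survive.\<close>

lemma dd_coeff_sum:
  assumes "i \<noteq> j"
  shows "dd_coeff i j m m' + dd_coeff j i m m' =
    (if m' = m \<circ> transpose i j then 1 else 0) - (if m' = m then 1 else 0)"
proof -
  define lo hi where "lo = min (m i) (m j)" and "hi = max (m i) (m j)"
  define A where "A \<longleftrightarrow> (\<exists>k::int. 0 \<le> k \<and> k < hi - lo \<and> m' = m(i := lo + k, j := hi - k))"
  define B where "B \<longleftrightarrow> (\<exists>k::int. 0 < k \<and> k \<le> hi - lo \<and> m' = m(i := lo + k, j := hi - k))"
  define M where "M \<longleftrightarrow> (\<exists>k::int. 0 < k \<and> k < hi - lo \<and> m' = m(i := lo + k, j := hi - k))"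
  define L where "L \<longleftrightarrow> m' = m(i := lo, j := hi)"
  define H where "H \<longleftrightarrow> m' = m(i := hi, j := lo)"
  have d1: "dd_coeff i j m m' = of_int (sgn (m i - m j)) * (if A then 1 else 0)"
    by (simp add: dd_coeff_def Let_def A_def lo_def hi_def)
  \<comment> \<open>Replacing \<open>k\<close> by \<open>hi - lo - k\<close> exchanges the roles of
    the two positions; the omitted end of the range then has \<open>lo\<close> at \<open>i\<close>
    instead of \<open>hi\<close>.\<close>
  have "B \<longleftrightarrow> (\<exists>k::int. 0 \<le> k \<and> k < hi - lo \<and> m' = m(j := lo + k, i := hi - k))"
  proof
    assume B
    then obtain k where "0 < k" "k \<le> hi - lo" "m' = m(i := lo + k, j := hi - k)"
      unfolding B_def by blast
    then show "\<exists>k::int. 0 \<le> k \<and> k < hi - lo \<and> m' = m(j := lo + k, i := hi - k)"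
      by (intro exI[of _ "hi - lo - k"]) (auto simp: fun_upd_twist[OF assms])
  next
    assume "\<exists>k::int. 0 \<le> k \<and> k < hi - lo \<and> m' = m(j := lo + k, i := hi - k)"
    then obtain k where "0 \<le> k" "k < hi - lo" "m' = m(j := lo + k, i := hi - k)"
      by blast
    then show B
      unfolding B_def by (intro exI[of _ "hi - lo - k"]) (auto simp: fun_upd_twist[OF assms])
  qed
  then have d2: "dd_coeff j i m m' = - of_int (sgn (m i - m j)) * (if B then 1 else 0)"
    unfolding dd_coeff_def Let_def lo_def hi_def
    by (simp add: min.commute max.commute sgn_if)
  show ?thesis
  proof (cases "m i = m j")
    case True
    then have "m \<circ> transpose i j = m"
      by (auto simp: transpose_def)
    then show ?thesis
      using True d1 d2 by simp
  next
    case False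
    then have lt: "lo < hi"
      by (auto simp: lo_def hi_def)
    have AL: "A \<longleftrightarrow> M \<or> L"
      unfolding A_def M_def L_def using lt by (auto simp: le_less intro: exI[of _ "0::int"])
    have BH: "B \<longleftrightarrow> M \<or> H"
    proof
      assume B
      then obtain k where k: "0 < k" "k \<le> hi - lo" "m' = m(i := lo + k, j := hi - k)"
        unfolding B_def by blast
      show "M \<or> H"
      proof (cases "k = hi - lo")
        case True
        then show ?thesis
          using k by (simp add: H_def)
      next
        case False
        then have "0 < k \<and> k < hi - lo \<and> m' = m(i := lo + k, j := hi - k)"
          using k by simp
        then show ?thesis
          unfolding M_def by blast
      qed
    next
      assume "M \<or> H"
      then show B
      proof
        assume M
        then obtain k where "0 < k \<and> k < hi - lo \<and> m' = m(i := lo + k, j := hi - k)"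
          unfolding M_def by blast
        then have "0 < k \<and> k \<le> hi - lo \<and> m' = m(i := lo + k, j := hi - k)"
          by simp
        then show B
          unfolding B_def by blast
      next
        assume H
        then have "0 < hi - lo \<and> hi - lo \<le> hi - lo \<and> m' = m(i := lo + (hi - lo), j := hi - (hi - lo))"
          using lt by (simp add: H_def)
        then show B
          unfolding B_def by blast
      qed
    qed
    have upd: "m(i := x, j := y) = m(i := x', j := y') \<longleftrightarrow> x = x' \<and> y = y'" for x y x' y'
      using assms by (metis fun_upd_same fun_upd_twist)
    have "\<not> (M \<and> L)" "\<not> (M \<and> H)" "\<not> (L \<and> H)"
      using lt by (auto simp: M_def L_def H_def upd)
    then have eq: "(if A then 1 else 0) - (if B then 1 else 0) = (if L then 1 else 0) - (if H then 1 else 0 :: complex)"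
      using AL BH by auto
    have sw: "m \<circ> transpose i j = m(i := m j, j := m i)"
      by (auto simp: transpose_def)
    have sum: "dd_coeff i j m m' + dd_coeff j i m m' = of_int (sgn (m i - m j)) * ((if L then 1 else 0) - (if H then 1 else 0))"
      unfolding d1 d2 eq[symmetric] by (simp only: right_diff_distrib mult_minus_left add_uminus_conv_diff)
    show ?thesis
    proof (cases "m i < m j")
      case True
      then have "m(i := lo, j := hi) = m" "m(i := hi, j := lo) = m \<circ> transpose i j" "sgn (m i - m j) = -1"
        unfolding sw by (auto simp: lo_def hi_def)
      then show ?thesis
        unfolding sum L_def H_def by simp
    next
      case F: False
      then have "m(i := hi, j := lo) = m" "m(i := lo, j := hi) = m \<circ> transpose i j" "sgn (m i - m j) = 1"
        using False unfolding sw by (auto simp: lo_def hi_def)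
      then show ?thesis
        unfolding sum L_def H_def by simp
    qed
  qed
qed

section \<open>Joint eigenvectors of the Dunkl operators\<close>

lemma valid_lpoly_lincomb:
  assumes "valid_lpoly N p" "valid_lpoly N q"
  shows "valid_lpoly N (\<lambda>m. a * p m + b * q m)"
proof -
  have "{m. a * p m + b * q m \<noteq> 0} \<subseteq> {m. p m \<noteq> 0} \<union> {m. q m \<noteq> 0}"
    by auto
  then have "finite {m. a * p m + b * q m \<noteq> 0}"
    by (rule finite_subset) (use assms in \<open>simp add: valid_lpoly_def\<close>)
  moreover have "valid_expo N m" if "a * p m + b * q m \<noteq> 0" for m
    using that assms by (cases "p m = 0") (auto simp: valid_lpoly_def)
  ultimately show ?thesis
    by (simp add: valid_lpoly_def)
qed

lemma valid_lpoly_zero: "valid_lpoly N (\<lambda>m. 0)"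
  by (simp add: valid_lpoly_def)

lemma valid_lpoly_sum:
  assumes "finite S" "\<And>s. s \<in> S \<Longrightarrow> valid_lpoly N (P s)"
  shows "valid_lpoly N (\<lambda>m. \<Sum>s\<in>S. c s * P s m)"
  using assms
proof (induction S rule: finite_induct)
  case (insert x F)
  then show ?case
    using valid_lpoly_lincomb[of N "P x" "\<lambda>m. \<Sum>s\<in>F. c s * P s m" "c x" 1] by simp
qed (simp add: valid_lpoly_zero)

lemma dd_superset:
  assumes "finite S" "{m. p m \<noteq> 0} \<subseteq> S"
  shows "dd i j p m' = (\<Sum>m\<in>S. p m * dd_coeff i j m m')"
  unfolding dd_def using assms by (intro sum.mono_neutral_left) auto

lemma dd_lincomb:
  assumes "valid_lpoly N p" "valid_lpoly N q"
  shows "dd i j (\<lambda>m. a * p m + b * q m) m' = a * dd i j p m' + b * dd i j q m'"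
proof -
  let ?S = "{m. p m \<noteq> 0} \<union> {m. q m \<noteq> 0}"
  have S: "finite ?S"
    using assms by (simp add: valid_lpoly_def)
  have "dd i j (\<lambda>m. a * p m + b * q m) m' = (\<Sum>m\<in>?S. (a * p m + b * q m) * dd_coeff i j m m')"
    using S by (intro dd_superset) auto
  also have "\<dots> = a * (\<Sum>m\<in>?S. p m * dd_coeff i j m m') + b * (\<Sum>m\<in>?S. q m * dd_coeff i j m m')"
    by (simp add: sum.distrib sum_distrib_left algebra_simps)
  also have "(\<Sum>m\<in>?S. p m * dd_coeff i j m m') = dd i j p m'"
    using S by (intro dd_superset[symmetric]) auto
  also have "(\<Sum>m\<in>?S. q m * dd_coeff i j m m') = dd i j q m'"
    using S by (intro dd_superset[symmetric]) auto
  finally show ?thesis .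
qed

lemma dunkl_lincomb:
  assumes "valid_lpoly N p" "valid_lpoly N q"
  shows "dunkl N \<alpha> i (\<lambda>m. a * p m + b * q m) = (\<lambda>m. a * dunkl N \<alpha> i p m + b * dunkl N \<alpha> i q m)"
  unfolding dunkl_def dd_lincomb[OF assms]
  by (simp add: sum.distrib sum_distrib_left[symmetric] algebra_simps)

lemma dunkl_zero: "dunkl N \<alpha> i (\<lambda>m. 0) = (\<lambda>m. 0)"
  by (simp add: dunkl_def dd_def)

lemma dunkl_sum:
  assumes "finite S" "\<And>s. s \<in> S \<Longrightarrow> valid_lpoly N (P s)"
  shows "dunkl N \<alpha> i (\<lambda>m. \<Sum>s\<in>S. c s * P s m) = (\<lambda>m. \<Sum>s\<in>S. c s * dunkl N \<alpha> i (P s) m)"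
  using assms
proof (induction S rule: finite_induct)
  case (insert x F)
  then have "valid_lpoly N (P x)" "valid_lpoly N (\<lambda>m. \<Sum>s\<in>F. c s * P s m)"
    using valid_lpoly_sum[of F N P c] by auto
  then show ?case
    using dunkl_lincomb[of N "P x" "\<lambda>m. \<Sum>s\<in>F. c s * P s m" \<alpha> i "c x" 1] insert by simp
qed (simp add: dunkl_zero)

section \<open>Exchange relations with adjacent transpositions\<close>

lemma valid_lpoly_Kop:
  assumes "i \<in> {1..<N}" "valid_lpoly N p"
  shows "valid_lpoly N (Kop i (Suc i) p)"
proof -
  have "{m. Kop i (Suc i) p m \<noteq> 0} \<subseteq> (\<lambda>m. m \<circ> transpose i (Suc i)) ` {m. p m \<noteq> 0}"
  proof
    fix m assume "m \<in> {m. Kop i (Suc i) p m \<noteq> 0}"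
    then have "m \<circ> transpose i (Suc i) \<in> {m. p m \<noteq> 0}"
      by (simp add: Kop_def)
    then show "m \<in> (\<lambda>m. m \<circ> transpose i (Suc i)) ` {m. p m \<noteq> 0}"
      by (metis comp_transpose_twice imageI)
  qed
  then have "finite {m. Kop i (Suc i) p m \<noteq> 0}"
    by (rule finite_subset) (use assms in \<open>simp add: valid_lpoly_def\<close>)
  moreover have "valid_expo N m" if "Kop i (Suc i) p m \<noteq> 0" for m
    using that assms valid_expo_transpose[OF assms(1), of m] by (simp add: Kop_def valid_lpoly_def)
  ultimately show ?thesis
    by (simp add: valid_lpoly_def)
qed

lemma Kop_Kop: "Kop i j (Kop i j p) = p"
  by (simp add: Kop_def)

lemma dd_Kop:
  assumes "i \<noteq> j"
  shows "dd i j (Kop a b p) m' = dd (transpose a b i) (transpose a b j) p (m' \<circ> transpose a b)"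
proof -
  have "(\<Sum>m\<in>{m. Kop a b p m \<noteq> 0}. Kop a b p m * dd_coeff i j m m')
      = (\<Sum>m\<in>{m. p m \<noteq> 0}. p m * dd_coeff i j (m \<circ> transpose a b) m')"
    by (rule sum.reindex_bij_witness[where i="\<lambda>m. m \<circ> transpose a b" and j="\<lambda>m. m \<circ> transpose a b"])
      (auto simp: Kop_def)
  then show ?thesis
    unfolding dd_def dd_coeff_conj[OF assms] .
qed

lemma dd_add_swap:
  assumes "i \<noteq> j" "valid_lpoly N p"
  shows "dd i j p m + dd j i p m = p (m \<circ> transpose i j) - p m"
proof -
  let ?S = "{m. p m \<noteq> 0}"
  have S: "finite ?S"
    using assms(2) by (simp add: valid_lpoly_def)
  have sw: "m = x \<circ> transpose i j \<longleftrightarrow> x = m \<circ> transpose i j" for x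
    by (metis comp_transpose_twice)
  have "dd i j p m + dd j i p m = (\<Sum>x\<in>?S. p x * (dd_coeff i j x m + dd_coeff j i x m))"
    by (simp add: dd_def sum.distrib distrib_left)
  also have "\<dots> = (\<Sum>x\<in>?S. (if x = m \<circ> transpose i j then p x else 0)) - (\<Sum>x\<in>?S. (if m = x then p x else 0))"
    unfolding dd_coeff_sum[OF assms(1)] sw
    by (simp only: sum_subtractf[symmetric] right_diff_distrib) (intro sum.cong refl, simp)
  also have "\<dots> = p (m \<circ> transpose i j) - p m"
    using S by (simp add: sum.delta sum.delta')
  finally show ?thesis .
qed

lemma sum_greaterThanAtMost_Suc:
  fixes g :: "nat \<Rightarrow> complex"
  shows "i < N \<Longrightarrow> (\<Sum>j\<in>{i<..N}. g j) = g (Suc i) + (\<Sum>j\<in>{Suc i<..N}. g j)"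
proof -
  assume "i < N"
  then have "{i<..N} = insert (Suc i) {Suc i<..N}"
    by auto
  then show ?thesis
    by simp
qed

text \<open>The divided differences between \<open>i\<close> and \<open>Suc i\<close> in the two
  operators combine to K - 1. Its -1 matches the change of the constant from -i to -(i + 1), and its
  K becomes the inhomogeneous term \<open>p m\<close>.\<close>

lemma dunkl_Kop:
  assumes "i \<in> {1..<N}" "valid_lpoly N p"
  shows "dunkl N \<alpha> i (Kop i (Suc i) p) m = dunkl N \<alpha> (Suc i) p (m \<circ> transpose i (Suc i)) + p m"
proof -
  let ?s = "transpose i (Suc i)"
  let ?m = "m \<circ> ?s"
  have a: "(\<Sum>j\<in>{i<..N}. dd i j (Kop i (Suc i) p) m)
      = dd (Suc i) i p ?m + (\<Sum>j\<in>{Suc i<..N}. dd (Suc i) j p ?m)"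
    using assms(1) by (subst sum_greaterThanAtMost_Suc) (auto simp: dd_Kop intro!: sum.cong)
  have b: "(\<Sum>j\<in>{1..<i}. dd j i (Kop i (Suc i) p) m) = (\<Sum>j\<in>{1..<i}. dd j (Suc i) p ?m)"
    by (intro sum.cong) (auto simp: dd_Kop)
  have c: "(\<Sum>j\<in>{1..<Suc i}. dd j (Suc i) p ?m) = dd i (Suc i) p ?m + (\<Sum>j\<in>{1..<i}. dd j (Suc i) p ?m)"
    using assms(1) by (simp add: atLeastLessThanSuc)
  have d: "dd (Suc i) i p ?m = p m - p ?m - dd i (Suc i) p ?m"
    using dd_add_swap[of i "Suc i" N p ?m] assms by (simp add: eq_diff_eq add.commute)
  have "Kop i (Suc i) p m = p ?m"
    by (simp add: Kop_def)
  then show ?thesis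
    unfolding dunkl_def a b c d by (simp add: algebra_simps)
qed

lemma dunkl_Suc_Kop:
  assumes "i \<in> {1..<N}" "valid_lpoly N p"
  shows "dunkl N \<alpha> (Suc i) (Kop i (Suc i) p) m = dunkl N \<alpha> i p (m \<circ> transpose i (Suc i)) - p m"
  using dunkl_Kop[OF assms(1) valid_lpoly_Kop[OF assms], of \<alpha> "m \<circ> transpose i (Suc i)"]
  by (simp add: Kop_Kop) (simp add: Kop_def)

lemma dunkl_Kop_other:
  assumes "i \<in> {1..<N}" "j \<in> {1..N}" "j \<noteq> i" "j \<noteq> Suc i"
  shows "dunkl N \<alpha> j (Kop i (Suc i) p) m = dunkl N \<alpha> j p (m \<circ> transpose i (Suc i))"
proof -
  let ?s = "transpose i (Suc i)"
  let ?m = "m \<circ> ?s"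
  have sj: "?s j = j"
    using assms by simp
  \<comment> \<open>Both \<open>i\<close> and \<open>Suc i\<close> lie on the same side of
    \<open>j\<close>, so exchanging them permutes each range of summation or fixes it
    pointwise.\<close>
  have perm: "(\<Sum>k\<in>A. g (?s k)) = (\<Sum>k\<in>A. g k)" if "i \<in> A \<longleftrightarrow> Suc i \<in> A" for A and g :: "nat \<Rightarrow> complex"
  proof (cases "i \<in> A")
    case True
    then have "?s permutes A"
      using that by (intro permutes_swap_id) auto
    then show ?thesis
      using sum.permute[of ?s A g] by (simp add: comp_def)
  next
    case False
    then show ?thesis
      using that by (intro sum.cong) (auto simp: transpose_def)
  qed
  have a: "(\<Sum>k\<in>{j<..N}. dd j k (Kop i (Suc i) p) m) = (\<Sum>k\<in>{j<..N}. dd j k p ?m)"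
  proof -
    have "(\<Sum>k\<in>{j<..N}. dd j k (Kop i (Suc i) p) m) = (\<Sum>k\<in>{j<..N}. dd j (?s k) p ?m)"
      using sj by (intro sum.cong) (auto simp: dd_Kop)
    also have "\<dots> = (\<Sum>k\<in>{j<..N}. dd j k p ?m)"
      using assms by (intro perm) auto
    finally show ?thesis .
  qed
  have b: "(\<Sum>k\<in>{1..<j}. dd k j (Kop i (Suc i) p) m) = (\<Sum>k\<in>{1..<j}. dd k j p ?m)"
  proof -
    have "(\<Sum>k\<in>{1..<j}. dd k j (Kop i (Suc i) p) m) = (\<Sum>k\<in>{1..<j}. dd (?s k) j p ?m)"
      using sj by (intro sum.cong) (auto simp: dd_Kop)
    also have "\<dots> = (\<Sum>k\<in>{1..<j}. dd k j p ?m)"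
      using assms by (intro perm) auto
    finally show ?thesis .
  qed
  show ?thesis
    unfolding dunkl_def a b using sj by (simp add: Kop_def)
qed

section \<open>Leading exponents and uniqueness\<close>

definition eigvec :: "nat \<Rightarrow> real \<Rightarrow> (nat \<Rightarrow> real) \<Rightarrow> lpoly \<Rightarrow> bool" where
  "eigvec N \<alpha> x p \<longleftrightarrow> valid_lpoly N p \<and>
    (\<forall>i\<in>{1..N}. dunkl N \<alpha> i p = (\<lambda>m. complex_of_real (x i) * p m))"

lemma eigvec_valid: "eigvec N \<alpha> x p \<Longrightarrow> valid_lpoly N p"
  by (simp add: eigvec_def)

lemma eigvec_dunkl: "eigvec N \<alpha> x p \<Longrightarrow> i \<in> {1..N} \<Longrightarrow> dunkl N \<alpha> i p m = complex_of_real (x i) * p m"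
  by (simp add: eigvec_def)

lemma eigvec_lincomb:
  assumes "eigvec N \<alpha> x p" "eigvec N \<alpha> x q"
  shows "eigvec N \<alpha> x (\<lambda>m. a * p m + b * q m)"
  using assms valid_lpoly_lincomb dunkl_lincomb[of N p q \<alpha> _ a b]
  by (auto simp: eigvec_def algebra_simps)

text \<open>By triangularity no other monomial of \<open>p\<close> contributes to the coefficient at
  a maximal exponent, so the eigenvalue is the diagonal entry there.\<close>

lemma eigvec_maximal:
  assumes "eigvec N \<alpha> x p" "p \<nu> \<noteq> 0" "\<And>\<rho>. p \<rho> \<noteq> 0 \<Longrightarrow> \<not> below N \<nu> \<rho>" "i \<in> {1..N}"
  shows "x i = eigval N \<alpha> \<nu> i"
proof -
  have fin: "finite {m. p m \<noteq> 0}"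
    using assms(1) by (simp add: eigvec_def valid_lpoly_def)
  have dd: "dd j k p \<nu> = (if \<nu> j < \<nu> k then - p \<nu> else 0)" if "j < k" "j \<in> {1..N}" "k \<in> {1..N}" for j k
  proof -
    have "dd j k p \<nu> = (\<Sum>m\<in>{m. p m \<noteq> 0}. if \<nu> = m then p m * dd_coeff j k m \<nu> else 0)"
      unfolding dd_def using dd_coeff_triangular[OF that] assms(3) by (intro sum.cong) auto
    also have "\<dots> = p \<nu> * dd_coeff j k \<nu> \<nu>"
      using fin assms(2) by simp
    finally show ?thesis
      using dd_coeff_diag[of j k \<nu>] that(1) by simp
  qed
  have a: "(\<Sum>j\<in>{i<..N}. dd i j p \<nu>) = - p \<nu> * of_nat (card {j\<in>{i<..N}. \<nu> j > \<nu> i})"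
  proof -
    have "(\<Sum>j\<in>{i<..N}. dd i j p \<nu>) = (\<Sum>j\<in>{i<..N}. if \<nu> j > \<nu> i then - p \<nu> else 0)"
      using dd assms(4) by (intro sum.cong) auto
    also have "\<dots> = (\<Sum>j\<in>{j\<in>{i<..N}. \<nu> j > \<nu> i}. - p \<nu>)"
      by (rule sum.inter_filter[symmetric]) simp
    finally show ?thesis
      by simp
  qed
  have b: "(\<Sum>j\<in>{1..<i}. dd j i p \<nu>) = - p \<nu> * of_nat (card {j\<in>{1..<i}. \<nu> j < \<nu> i})"
  proof -
    have "(\<Sum>j\<in>{1..<i}. dd j i p \<nu>) = (\<Sum>j\<in>{1..<i}. if \<nu> j < \<nu> i then - p \<nu> else 0)"
      using dd assms(4) by (intro sum.cong) auto
    also have "\<dots> = (\<Sum>j\<in>{j\<in>{1..<i}. \<nu> j < \<nu> i}. - p \<nu>)"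
      by (rule sum.inter_filter[symmetric]) simp
    finally show ?thesis
      by simp
  qed
  \<comment> \<open>The constant -i and the diagonal entries from the left of \<open>i\<close>
    together leave minus the non-strict count in \<open>rank_alt\<close>.\<close>
  have "{1..i} = {j\<in>{1..<i}. \<nu> j < \<nu> i} \<union> {j\<in>{1..i}. \<nu> j \<ge> \<nu> i}"
    using assms(4) by (auto simp: le_less)
  then have "card {1..i} = card ({j\<in>{1..<i}. \<nu> j < \<nu> i} \<union> {j\<in>{1..i}. \<nu> j \<ge> \<nu> i})"
    by (rule arg_cong)
  also have "\<dots> = card {j\<in>{1..<i}. \<nu> j < \<nu> i} + card {j\<in>{1..i}. \<nu> j \<ge> \<nu> i}"
    by (rule card_Un_disjoint) auto
  finally have "card {1..i} = card {j\<in>{1..<i}. \<nu> j < \<nu> i} + card {j\<in>{1..i}. \<nu> j \<ge> \<nu> i}" .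
  then have c: "of_nat i = (of_nat (card {j\<in>{1..<i}. \<nu> j < \<nu> i}) + of_nat (card {j\<in>{1..i}. \<nu> j \<ge> \<nu> i}) :: complex)"
    by (simp flip: of_nat_add)
  have "complex_of_real (x i) * p \<nu> = dunkl N \<alpha> i p \<nu>"
    using eigvec_dunkl[OF assms(1,4)] by simp
  also have "\<dots> = complex_of_real (eigval N \<alpha> \<nu> i) * p \<nu>"
    unfolding dunkl_def a b c eigval_def rank_alt[OF assms(4)] by (simp add: algebra_simps)
  finally show ?thesis
    using assms(2) by simp
qed

lemma valid_lpoly_maximal:
  assumes "valid_lpoly N p" "p \<rho> \<noteq> 0"
  shows "\<exists>\<nu>. p \<nu> \<noteq> 0 \<and> valid_expo N \<nu> \<and> (\<forall>\<tau>. p \<tau> \<noteq> 0 \<longrightarrow> \<not> below N \<nu> \<tau>)"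
  using finite_below_maximal[of "{m. p m \<noteq> 0}" N] assms by (auto simp: valid_lpoly_def)

text \<open>A maximal exponent of the support carries the spectrum of \<open>\<mu>\<close> and is
  therefore \<open>\<mu>\<close>. An exponent not below \<open>\<mu>\<close> would itself be maximal
  by negative transitivity, so it is again \<open>\<mu>\<close>.\<close>

lemma eigvec_support:
  assumes "\<alpha> > 0" "valid_expo N \<mu>" "eigvec N \<alpha> (eigval N \<alpha> \<mu>) p" "p \<nu> \<noteq> 0"
  shows "p \<mu> \<noteq> 0 \<and> (\<nu> = \<mu> \<or> below N \<nu> \<mu>)"
proof -
  have v: "valid_lpoly N p"
    using assms(3) by (rule eigvec_valid)
  have max: "\<rho> = \<mu>" if "p \<rho> \<noteq> 0" "\<forall>\<tau>. p \<tau> \<noteq> 0 \<longrightarrow> \<not> below N \<rho> \<tau>" for \<rho>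
    using that v eigvec_maximal[OF assms(3)] by (intro eigval_inj[OF assms(1,2)]) (auto simp: valid_lpoly_def)
  obtain \<rho> where \<rho>: "p \<rho> \<noteq> 0" "\<forall>\<tau>. p \<tau> \<noteq> 0 \<longrightarrow> \<not> below N \<rho> \<tau>"
    using valid_lpoly_maximal[OF v assms(4)] by blast
  then have mu: "p \<mu> \<noteq> 0" "\<forall>\<tau>. p \<tau> \<noteq> 0 \<longrightarrow> \<not> below N \<mu> \<tau>"
    using max by blast+
  have "\<nu> = \<mu>" if nb: "\<not> below N \<nu> \<mu>"
  proof (rule max[OF assms(4)], intro allI impI notI)
    fix \<tau> assume "p \<tau> \<noteq> 0" "below N \<nu> \<tau>"
    then show False
      using mu nb below_negtrans by blast
  qed
  then show ?thesis
    using mu by blast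
qed

text \<open>The difference is an eigenvector whose coefficient at \<open>\<mu>\<close> vanishes, so
  its support is empty.\<close>

lemma eigvec_unique:
  assumes "\<alpha> > 0" "valid_expo N \<mu>" "eigvec N \<alpha> (eigval N \<alpha> \<mu>) p" "eigvec N \<alpha> (eigval N \<alpha> \<mu>) q"
    and "p \<mu> = q \<mu>"
  shows "p = q"
proof
  fix \<nu>
  have "eigvec N \<alpha> (eigval N \<alpha> \<mu>) (\<lambda>m. 1 * p m + (-1) * q m)"
    using assms(3,4) by (rule eigvec_lincomb)
  from eigvec_support[OF assms(1,2) this, of \<nu>] show "p \<nu> = q \<nu>"
    using assms(5) by auto
qed

section \<open>Existence of joint eigenvectors\<close>

text \<open>The constant c solves \<open>x i * c = 1 + x (Suc i) * c\<close>, which absorbs the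
  inhomogeneous term of the exchange relations. The result may be zero; nonvanishing is argued
  separately.\<close>

lemma eigvec_intertwine:
  assumes "i \<in> {1..<N}" "eigvec N \<alpha> x p" "x i \<noteq> x (Suc i)"
  shows "eigvec N \<alpha> (x \<circ> transpose i (Suc i))
    (\<lambda>m. Kop i (Suc i) p m - complex_of_real (1 / (x i - x (Suc i))) * p m)"
proof -
  define c where "c = complex_of_real (1 / (x i - x (Suc i)))"
  have v: "valid_lpoly N p"
    using assms(2) by (rule eigvec_valid)
  note vK = valid_lpoly_Kop[OF assms(1) v]
  have c: "complex_of_real (x i) * c = 1 + complex_of_real (x (Suc i)) * c"
  proof -
    have "complex_of_real (x i) - complex_of_real (x (Suc i)) \<noteq> 0"
      using assms(3) by simp
    then show ?thesis
      unfolding c_def by (simp add: field_simps)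
  qed
  have lin: "(\<lambda>m. Kop i (Suc i) p m - c * p m) = (\<lambda>m. 1 * Kop i (Suc i) p m + (- c) * p m)"
    by simp
  have "dunkl N \<alpha> j (\<lambda>m. Kop i (Suc i) p m - c * p m)
      = (\<lambda>m. complex_of_real ((x \<circ> transpose i (Suc i)) j) * (Kop i (Suc i) p m - c * p m))"
    if j: "j \<in> {1..N}" for j
  proof
    fix m
    let ?Kp = "p (m \<circ> transpose i (Suc i))"
    have D: "dunkl N \<alpha> j (\<lambda>m. Kop i (Suc i) p m - c * p m) m
        = dunkl N \<alpha> j (Kop i (Suc i) p) m - c * (complex_of_real (x j) * p m)"
      unfolding lin dunkl_lincomb[OF vK v] using eigvec_dunkl[OF assms(2) j] by simp
    have Kp: "Kop i (Suc i) p m = ?Kp"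
      by (simp add: Kop_def)
    have ii: "i \<in> {1..N}" "Suc i \<in> {1..N}"
      using assms(1) by auto
    consider "j = i" | "j = Suc i" | "j \<noteq> i" "j \<noteq> Suc i"
      by blast
    then show "dunkl N \<alpha> j (\<lambda>m. Kop i (Suc i) p m - c * p m) m
      = complex_of_real ((x \<circ> transpose i (Suc i)) j) * (Kop i (Suc i) p m - c * p m)"
    proof cases
      case 1
      have "p m + complex_of_real (x (Suc i)) * ?Kp - c * (complex_of_real (x i) * p m)
          = complex_of_real (x (Suc i)) * (?Kp - c * p m)"
        using c by algebra
      then show ?thesis
        unfolding D Kp using 1 dunkl_Kop[OF assms(1) v, of \<alpha> m] eigvec_dunkl[OF assms(2) ii(2)]
        by (simp add: add.commute)
    next
      case 2
      have "complex_of_real (x i) * ?Kp - p m - c * (complex_of_real (x (Suc i)) * p m)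
          = complex_of_real (x i) * (?Kp - c * p m)"
        using c by algebra
      then show ?thesis
        unfolding D Kp using 2 dunkl_Suc_Kop[OF assms(1) v, of \<alpha> m] eigvec_dunkl[OF assms(2) ii(1)]
        by simp
    next
      case 3
      then show ?thesis
        unfolding D Kp using dunkl_Kop_other[OF assms(1) j 3, of \<alpha> p m] eigvec_dunkl[OF assms(2) j]
        by (simp add: algebra_simps)
    qed
  qed
  moreover have "valid_lpoly N (\<lambda>m. Kop i (Suc i) p m - c * p m)"
    unfolding lin by (rule valid_lpoly_lincomb[OF vK v])
  ultimately show ?thesis
    by (simp add: eigvec_def c_def)
qed

text \<open>The operator sending \<open>z\<close> to the power \<open>\<mu>\<close> to \<open>z\<close> to the power \<open>raise_expo N \<mu>\<close> intertwines \<open>d i\<close> with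
  \<open>d (i + 1)\<close> for \<open>i < N\<close>, and \<open>d N\<close> with \<open>d 1 + \<alpha>\<close>. Together with the adjacent intertwiners it
  reaches every exponent from the constant ones, so that eigenvectors are obtained without proving
  that the Dunkl operators commute.\<close>
definition raise_expo :: "nat \<Rightarrow> expo \<Rightarrow> expo" where
  "raise_expo N \<mu> = (\<lambda>i. if i = N then \<mu> 1 + 1 else if 1 \<le> i \<and> i < N then \<mu> (Suc i) else \<mu> i)"

text \<open>A Laurent polynomial is its coefficient function, so the operator on polynomials is
  precomposition with this inverse of \<open>raise_expo\<close>.\<close>

definition lower_expo :: "nat \<Rightarrow> expo \<Rightarrow> expo" where
  "lower_expo N \<nu> = (\<lambda>i. if i = 1 then \<nu> N - 1 else if 1 < i \<and> i \<le> N then \<nu> (i - 1) else \<nu> i)"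

lemma raise_lower: "N \<ge> 1 \<Longrightarrow> raise_expo N (lower_expo N \<nu>) = \<nu>"
  by (auto simp: raise_expo_def lower_expo_def fun_eq_iff)

lemma lower_raise: "N \<ge> 1 \<Longrightarrow> lower_expo N (raise_expo N \<mu>) = \<mu>"
  by (auto simp: raise_expo_def lower_expo_def fun_eq_iff)

lemma raise_eq_iff: "N \<ge> 1 \<Longrightarrow> raise_expo N \<mu> = raise_expo N \<nu> \<longleftrightarrow> \<mu> = \<nu>"
  by (metis lower_raise)

lemma valid_raise: "N \<ge> 1 \<Longrightarrow> valid_expo N \<mu> \<Longrightarrow> valid_expo N (raise_expo N \<mu>)"
  by (auto simp: valid_expo_def raise_expo_def)

lemma valid_lower: "N \<ge> 1 \<Longrightarrow> valid_expo N \<mu> \<Longrightarrow> valid_expo N (lower_expo N \<mu>)"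
  by (auto simp: valid_expo_def lower_expo_def)

text \<open>The index \<open>k\<close> is determined by \<open>m' i\<close>, and \<open>m' j\<close>
  by conservation of the sum of the two exponents. Without the existential, coefficients can be
  compared by integer arithmetic.\<close>

lemma dd_coeff_closed:
  assumes "i \<noteq> j"
  shows "dd_coeff i j m m' = (if m' = m(i := m' i, j := m i + m j - m' i) \<and>
      min (m i) (m j) \<le> m' i \<and> m' i < max (m i) (m j) then of_int (sgn (m i - m j)) else 0)"
proof -
  have s: "max (m i) (m j) = m i + m j - min (m i) (m j)"
    by (simp add: min_def max_def)
  have "(\<exists>k::int. 0 \<le> k \<and> k < max (m i) (m j) - min (m i) (m j) \<and>
      m' = m(i := min (m i) (m j) + k, j := max (m i) (m j) - k)) \<longleftrightarrow>
    m' = m(i := m' i, j := m i + m j - m' i) \<and> min (m i) (m j) \<le> m' i \<and> m' i < max (m i) (m j)"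
    (is "?L \<longleftrightarrow> ?R")
  proof
    assume ?L
    then obtain k where k: "0 \<le> k" "k < max (m i) (m j) - min (m i) (m j)"
      "m' = m(i := min (m i) (m j) + k, j := max (m i) (m j) - k)"
      by blast
    have mi: "m' i = min (m i) (m j) + k"
      using k(3) assms by simp
    have "max (m i) (m j) - k = m i + m j - m' i"
      unfolding mi s by simp
    then show ?R
      using k mi by auto
  next
    assume R: ?R
    then have "0 \<le> m' i - min (m i) (m j) \<and> m' i - min (m i) (m j) < max (m i) (m j) - min (m i) (m j)"
      by simp
    moreover have e: "max (m i) (m j) - (m' i - min (m i) (m j)) = m i + m j - m' i"
      "min (m i) (m j) + (m' i - min (m i) (m j)) = m' i"
      unfolding s by simp_all
    have "m' = m(i := min (m i) (m j) + (m' i - min (m i) (m j)), j := max (m i) (m j) - (m' i - min (m i) (m j)))"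
      unfolding e using R by (rule conjunct1)
    ultimately show ?L
      by blast
  qed
  then show ?thesis
    unfolding dd_coeff_def Let_def by simp
qed

lemma dd_coeff_raise:
  assumes "i < j" "1 \<le> i" "j < N"
  shows "dd_coeff i j (raise_expo N \<mu>) (raise_expo N \<mu>') = dd_coeff (Suc i) (Suc j) \<mu> \<mu>'"
proof -
  have "(raise_expo N \<mu>)(i := x, j := y) = raise_expo N (\<mu>(Suc i := x, Suc j := y))" for x y
    using assms by (auto simp: raise_expo_def fun_eq_iff)
  moreover have "raise_expo N \<nu> i = \<nu> (Suc i)" "raise_expo N \<nu> j = \<nu> (Suc j)" for \<nu>
    using assms by (auto simp: raise_expo_def)
  ultimately show ?thesis
    using assms by (simp add: dd_coeff_closed raise_eq_iff)
qed

text \<open>Swapping the roles of the positions reverses the sign, and raising one exponent shifts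
  one end of the half-open range. The end monomial gained or lost is \<open>\<mu>\<close> itself,
  hence the diagonal correction.\<close>

lemma dd_coeff_raise_last:
  assumes "1 \<le> i" "i < N"
  shows "dd_coeff i N (raise_expo N \<mu>) (raise_expo N \<mu>') =
    - dd_coeff 1 (Suc i) \<mu> \<mu>' - (if \<mu>' = \<mu> then 1 else 0)"
proof -
  define a b t where "a = \<mu> 1" and "b = \<mu> (Suc i)" and "t = \<mu>' (Suc i)"
  define Q where "Q \<longleftrightarrow> \<mu>' = \<mu>(1 := a + b - t, Suc i := t)"
  have upd: "(raise_expo N \<mu>)(i := x, N := y) = raise_expo N (\<mu>(1 := y - 1, Suc i := x))" for x y
    using assms by (auto simp: raise_expo_def fun_eq_iff)
  have r: "raise_expo N \<nu> i = \<nu> (Suc i)" "raise_expo N \<nu> N = \<nu> 1 + 1" for \<nu>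
    using assms by (auto simp: raise_expo_def)
  have arith: "t + x - 1 = x + t - 1" "b + (a + 1) - t - 1 = a + b - t" for x :: int
    by simp_all
  have L: "dd_coeff i N (raise_expo N \<mu>) (raise_expo N \<mu>') =
      (if Q \<and> min b (a + 1) \<le> t \<and> t < max b (a + 1) then of_int (sgn (b - (a + 1))) else 0)"
    using assms
    by (simp add: dd_coeff_closed upd r raise_eq_iff a_def[symmetric] b_def[symmetric] t_def[symmetric] arith Q_def[symmetric]
        del: One_nat_def)
  have Q1: "\<mu>' = \<mu>(1 := \<mu>' 1, Suc i := a + b - \<mu>' 1) \<longleftrightarrow> Q"
    unfolding Q_def t_def
  proof
    assume A: "\<mu>' = \<mu>(1 := \<mu>' 1, Suc i := a + b - \<mu>' 1)"
    then have "\<mu>' (Suc i) = a + b - \<mu>' 1"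
      by (metis fun_upd_same)
    then show "\<mu>' = \<mu>(1 := a + b - \<mu>' (Suc i), Suc i := \<mu>' (Suc i))"
      using A by simp
  next
    assume A: "\<mu>' = \<mu>(1 := a + b - \<mu>' (Suc i), Suc i := \<mu>' (Suc i))"
    have "\<mu>' 1 = (\<mu>(1 := a + b - \<mu>' (Suc i), Suc i := \<mu>' (Suc i))) 1"
      using A by (rule fun_cong)
    then have "\<mu>' 1 = a + b - \<mu>' (Suc i)"
      using assms by simp
    then show "\<mu>' = \<mu>(1 := \<mu>' 1, Suc i := a + b - \<mu>' 1)"
      using A by simp
  qed
  have t1: "\<mu>' 1 = a + b - t" if Q
    using fun_cong[OF that[unfolded Q_def], of 1] assms by simp
  have eq: "\<mu>' = \<mu> \<longleftrightarrow> Q \<and> t = b"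
    by (auto simp: Q_def a_def b_def t_def)
  have R: "dd_coeff 1 (Suc i) \<mu> \<mu>' =
      (if Q \<and> min a b \<le> a + b - t \<and> a + b - t < max a b then of_int (sgn (a - b)) else 0)"
    using assms t1 Q1 by (auto simp: dd_coeff_closed a_def[symmetric] b_def[symmetric] simp del: One_nat_def)
  show ?thesis
    unfolding L R eq by (auto simp: sgn_if min_def max_def split: if_splits)
qed

lemma dd_raise:
  assumes "N \<ge> 1"
  shows "dd i j (\<lambda>\<nu>. p (lower_expo N \<nu>)) (raise_expo N m') =
    (\<Sum>m\<in>{m. p m \<noteq> 0}. p m * dd_coeff i j (raise_expo N m) (raise_expo N m'))"
  unfolding dd_def
  by (rule sum.reindex_bij_witness[where i="raise_expo N" and j="lower_expo N"])
    (auto simp: raise_lower[OF assms] lower_raise[OF assms])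

lemma dd_raise_inner:
  assumes "i < j" "1 \<le> i" "j < N"
  shows "dd i j (\<lambda>\<nu>. p (lower_expo N \<nu>)) (raise_expo N m') = dd (Suc i) (Suc j) p m'"
proof -
  have "N \<ge> 1"
    using assms by simp
  then show ?thesis
    using dd_raise[of N i j p m'] assms by (simp add: dd_def dd_coeff_raise)
qed

lemma dd_raise_last:
  assumes "1 \<le> i" "i < N" "valid_lpoly N p"
  shows "dd i N (\<lambda>\<nu>. p (lower_expo N \<nu>)) (raise_expo N m') = - dd 1 (Suc i) p m' - p m'"
proof -
  have fin: "finite {m. p m \<noteq> 0}"
    using assms(3) by (simp add: valid_lpoly_def)
  have "dd i N (\<lambda>\<nu>. p (lower_expo N \<nu>)) (raise_expo N m')
      = (\<Sum>m\<in>{m. p m \<noteq> 0}. p m * (- dd_coeff 1 (Suc i) m m' - (if m' = m then 1 else 0)))"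
    using dd_raise[of N i N p m'] assms by (simp add: dd_coeff_raise_last)
  also have "\<dots> = - (\<Sum>m\<in>{m. p m \<noteq> 0}. p m * dd_coeff 1 (Suc i) m m')
      - (\<Sum>m\<in>{m. p m \<noteq> 0}. if m' = m then p m else 0)"
    unfolding sum_negf[symmetric] sum_subtractf[symmetric] by (intro sum.cong) (auto simp: algebra_simps)
  also have "\<dots> = - dd 1 (Suc i) p m' - p m'"
    using fin by (simp add: dd_def)
  finally show ?thesis .
qed

text \<open>The term of \<open>d (i + 1)\<close> with j = 1 becomes the term of \<open>d i\<close>
  with j = N. The diagonal correction in \<open>dd_raise_last\<close> makes up for the constant -i
  in place of -(i + 1).\<close>

lemma dunkl_raise:
  assumes "1 \<le> i" "i < N" "valid_lpoly N p"
  shows "dunkl N \<alpha> i (\<lambda>\<nu>. p (lower_expo N \<nu>)) (raise_expo N m) = dunkl N \<alpha> (Suc i) p m"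
proof -
  let ?q = "\<lambda>\<nu>. p (lower_expo N \<nu>)" and ?m = "raise_expo N m"
  have e: "{i<..N} = insert N {i<..<N}"
    using assms by auto
  have a: "(\<Sum>j\<in>{i<..N}. dd i j ?q ?m) = (\<Sum>j\<in>{i<..<N}. dd (Suc i) (Suc j) p m) - dd 1 (Suc i) p m - p m"
    unfolding e using assms dd_raise_last[OF assms, of m] by (simp add: dd_raise_inner)
  have b: "(\<Sum>j\<in>{Suc i<..N}. dd (Suc i) j p m) = (\<Sum>j\<in>{i<..<N}. dd (Suc i) (Suc j) p m)"
    by (rule sum.reindex_bij_witness[where i=Suc and j="\<lambda>k. k - 1"]) auto
  have c: "(\<Sum>j\<in>{1..<i}. dd j i ?q ?m) = (\<Sum>j\<in>{1..<i}. dd (Suc j) (Suc i) p m)"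
    using assms by (intro sum.cong) (auto simp: dd_raise_inner)
  have d: "(\<Sum>j\<in>{1..<Suc i}. dd j (Suc i) p m) = dd 1 (Suc i) p m + (\<Sum>j\<in>{1..<i}. dd (Suc j) (Suc i) p m)"
    using assms sum.atLeast_Suc_lessThan[of 1 "Suc i" "\<lambda>j. dd j (Suc i) p m"]
      sum.shift_bounds_Suc_ivl[of "\<lambda>j. dd j (Suc i) p m" 1 i] by (simp del: sum.op_ivl_Suc)
  have "p (lower_expo N ?m) = p m" "?m i = m (Suc i)"
    using assms by (auto simp: lower_raise) (simp add: raise_expo_def)
  then show ?thesis
    unfolding dunkl_def a b c d by (simp add: algebra_simps)
qed

text \<open>All N - 1 left terms of \<open>d N\<close> become right terms of \<open>d 1\<close>;
  their diagonal corrections turn the constant -N into -1, and the raised exponent contributes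
  \<alpha>.\<close>

lemma dunkl_raise_last:
  assumes "1 \<le> N" "valid_lpoly N p"
  shows "dunkl N \<alpha> N (\<lambda>\<nu>. p (lower_expo N \<nu>)) (raise_expo N m) = dunkl N \<alpha> 1 p m + complex_of_real \<alpha> * p m"
proof -
  let ?q = "\<lambda>\<nu>. p (lower_expo N \<nu>)" and ?m = "raise_expo N m"
  have "(\<Sum>j\<in>{1..<N}. dd j N ?q ?m) = (\<Sum>j\<in>{1..<N}. - dd 1 (Suc j) p m - p m)"
    using assms by (intro sum.cong) (auto simp: dd_raise_last)
  also have "\<dots> = - (\<Sum>j\<in>{1..<N}. dd 1 (Suc j) p m) - (of_nat N - 1) * p m"
    using assms by (simp add: sum_subtractf sum_negf of_nat_diff)
  also have "(\<Sum>j\<in>{1..<N}. dd 1 (Suc j) p m) = (\<Sum>j\<in>{1<..N}. dd 1 j p m)"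
    by (rule sum.reindex_bij_witness[where i="\<lambda>k. k - 1" and j=Suc]) auto
  finally have a: "(\<Sum>j\<in>{1..<N}. dd j N ?q ?m) = - (\<Sum>j\<in>{1<..N}. dd 1 j p m) - (of_nat N - 1) * p m" .
  have "p (lower_expo N ?m) = p m" "?m N = m 1 + 1"
    using assms by (auto simp: lower_raise) (simp add: raise_expo_def)
  then show ?thesis
    unfolding dunkl_def a by (simp add: algebra_simps)
qed

lemma eigvec_raise:
  assumes "1 \<le> N" "eigvec N \<alpha> x p"
  shows "eigvec N \<alpha> (\<lambda>i. if i = N then x 1 + \<alpha> else x (Suc i)) (\<lambda>\<nu>. p (lower_expo N \<nu>))"
proof -
  have v: "valid_lpoly N p"
    using assms(2) by (rule eigvec_valid)
  have "{\<nu>. p (lower_expo N \<nu>) \<noteq> 0} \<subseteq> raise_expo N ` {m. p m \<noteq> 0}"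
  proof
    fix \<nu> assume "\<nu> \<in> {\<nu>. p (lower_expo N \<nu>) \<noteq> 0}"
    then show "\<nu> \<in> raise_expo N ` {m. p m \<noteq> 0}"
      by (intro image_eqI[of _ _ "lower_expo N \<nu>"]) (simp_all add: raise_lower[OF assms(1)])
  qed
  then have "finite {\<nu>. p (lower_expo N \<nu>) \<noteq> 0}"
    by (rule finite_subset) (use v in \<open>simp add: valid_lpoly_def\<close>)
  moreover have "valid_expo N \<nu>" if "p (lower_expo N \<nu>) \<noteq> 0" for \<nu>
    using that v valid_raise[OF assms(1), of "lower_expo N \<nu>"]
    by (simp add: valid_lpoly_def raise_lower[OF assms(1)])
  moreover have "dunkl N \<alpha> i (\<lambda>\<nu>. p (lower_expo N \<nu>)) \<nu>
      = complex_of_real (if i = N then x 1 + \<alpha> else x (Suc i)) * p (lower_expo N \<nu>)"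
    if "i \<in> {1..N}" for i \<nu>
  proof -
    have "dunkl N \<alpha> i (\<lambda>\<nu>. p (lower_expo N \<nu>)) (raise_expo N (lower_expo N \<nu>))
        = complex_of_real (if i = N then x 1 + \<alpha> else x (Suc i)) * p (lower_expo N \<nu>)"
    proof (cases "i = N")
      case True
      then show ?thesis
        using dunkl_raise_last[OF assms(1) v, of \<alpha>] eigvec_dunkl[OF assms(2), of 1] assms(1)
        by (simp add: algebra_simps)
    next
      case False
      then show ?thesis
        using dunkl_raise[of i N p \<alpha>] v eigvec_dunkl[OF assms(2), of "Suc i"] that by simp
    qed
    then show ?thesis
      by (simp add: raise_lower[OF assms(1)])
  qed
  ultimately show ?thesis
    by (auto simp: eigvec_def valid_lpoly_def)
qed

text \<open>Position 1 wins every tie. After its entry has moved to position N, where it loses every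
  tie, the added 1 restores exactly these comparisons.\<close>

lemma before_raise:
  assumes "j \<in> {1..N}" "k \<in> {1..N}"
  shows "before (raise_expo N \<mu>) j k \<longleftrightarrow>
    before \<mu> (if j = N then 1 else Suc j) (if k = N then 1 else Suc k)"
  using assms by (auto simp: before_def raise_expo_def)

lemma rank_raise:
  assumes "k \<in> {1..N}"
  shows "rank N (raise_expo N \<mu>) k = rank N \<mu> (if k = N then 1 else Suc k)"
proof -
  define c where "c = (\<lambda>j. if j = N then 1 else Suc j)"
  have "{j\<in>{1..N}. before (raise_expo N \<mu>) j k} = {j\<in>{1..N}. before \<mu> (c j) (c k)}"
    using before_raise assms unfolding c_def by blast
  moreover have inj: "inj_on c {j\<in>{1..N}. before \<mu> (c j) (c k)}"
    by (auto simp: c_def inj_on_def split: if_splits)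
  moreover have "c ` {j\<in>{1..N}. before \<mu> (c j) (c k)} = {j\<in>{1..N}. before \<mu> j (c k)}"
  proof (intro equalityI subsetI)
    fix j assume j: "j \<in> {j\<in>{1..N}. before \<mu> j (c k)}"
    define k' where "k' = (if j = 1 then N else j - 1)"
    have k': "j = c k'" "k' \<in> {1..N}"
      using j by (auto simp: c_def k'_def)
    then show "j \<in> c ` {j\<in>{1..N}. before \<mu> (c j) (c k)}"
      using j by (intro image_eqI[of _ _ k']) simp_all
  qed (auto simp: c_def)
  ultimately have "rank N (raise_expo N \<mu>) k = rank N \<mu> (c k)"
    unfolding rank_def using card_image[OF inj] by (simp only:)
  then show ?thesis
    by (simp add: c_def)
qed

lemma eigval_raise:
  assumes "i \<in> {1..N}"
  shows "eigval N \<alpha> (raise_expo N \<mu>) i = (if i = N then eigval N \<alpha> \<mu> 1 + \<alpha> else eigval N \<alpha> \<mu> (Suc i))"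
proof -
  have "raise_expo N \<mu> i = (if i = N then \<mu> 1 + 1 else \<mu> (Suc i))"
    using assms by (auto simp: raise_expo_def)
  then show ?thesis
    using rank_raise[OF assms, of \<mu>] by (auto simp: eigval_def algebra_simps)
qed

text \<open>\<open>eigvec\<close> admits the zero polynomial so that joint eigenspaces are closed
  under linear combinations; nonvanishing is added here.\<close>

definition has_eigvec :: "nat \<Rightarrow> real \<Rightarrow> expo \<Rightarrow> bool" where
  "has_eigvec N \<alpha> \<mu> \<longleftrightarrow> (\<exists>p \<nu>. eigvec N \<alpha> (eigval N \<alpha> \<mu>) p \<and> p \<nu> \<noteq> 0)"

lemma has_eigvec_raise:
  assumes "1 \<le> N" "has_eigvec N \<alpha> \<mu>"
  shows "has_eigvec N \<alpha> (raise_expo N \<mu>)"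
proof -
  obtain p \<nu> where p: "eigvec N \<alpha> (eigval N \<alpha> \<mu>) p" "p \<nu> \<noteq> 0"
    using assms(2) by (auto simp: has_eigvec_def)
  have "eigvec N \<alpha> (eigval N \<alpha> (raise_expo N \<mu>)) (\<lambda>\<nu>. p (lower_expo N \<nu>))"
    using eigvec_raise[OF assms(1) p(1)] eigval_raise[of _ N \<alpha> \<mu>] by (simp add: eigvec_def)
  moreover have "p (lower_expo N (raise_expo N \<nu>)) \<noteq> 0"
    using p(2) lower_raise[OF assms(1)] by simp
  ultimately show ?thesis
    unfolding has_eigvec_def by blast
qed

lemma eigval_gap_abs:
  assumes "\<alpha> > 0" "i \<in> {1..<N}" "\<mu> i \<noteq> \<mu> (Suc i)"
  shows "\<bar>eigval N \<alpha> \<mu> i - eigval N \<alpha> \<mu> (Suc i)\<bar> > 1"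
proof (cases "\<mu> i > \<mu> (Suc i)")
  case True
  then show ?thesis
    using eigval_gap[OF assms(1,2)] by fastforce
next
  case False
  then have "\<mu> (Suc i) > \<mu> i"
    using assms(3) by simp
  then show ?thesis
    using eigval_gap[OF assms(1,2), of "\<mu> \<circ> transpose i (Suc i)"] eigval_transpose[OF assms(2,3)] by simp
qed

lemma has_eigvec_transpose:
  assumes "\<alpha> > 0" "i \<in> {1..<N}" "has_eigvec N \<alpha> \<mu>"
  shows "has_eigvec N \<alpha> (\<mu> \<circ> transpose i (Suc i))"
proof (cases "\<mu> i = \<mu> (Suc i)")
  case True
  then have "\<mu> \<circ> transpose i (Suc i) = \<mu>"
    by (auto simp: transpose_def)
  then show ?thesis
    using assms(3) by simp
next
  case False
  obtain p \<nu> where p: "eigvec N \<alpha> (eigval N \<alpha> \<mu>) p" "p \<nu> \<noteq> 0"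
    using assms(3) by (auto simp: has_eigvec_def)
  define d where "d = eigval N \<alpha> \<mu> i - eigval N \<alpha> \<mu> (Suc i)"
  define q where "q = (\<lambda>m. Kop i (Suc i) p m - complex_of_real (1 / d) * p m)"
  have gap: "\<bar>d\<bar> > 1"
    using eigval_gap_abs[OF assms(1,2) False] by (simp add: d_def)
  have "eigvec N \<alpha> (eigval N \<alpha> \<mu> \<circ> transpose i (Suc i)) q"
    using eigvec_intertwine[OF assms(2) p(1)] gap by (auto simp: q_def d_def)
  then have q: "eigvec N \<alpha> (eigval N \<alpha> (\<mu> \<circ> transpose i (Suc i))) q"
    using eigval_transpose[OF assms(2) False] by (simp add: eigvec_def)
  \<comment> \<open>If \<open>q\<close> vanished, then K would act on \<open>p\<close> as 1 / d;
    since K is an involution this forces \<open>d * d = 1\<close>, against the gap.\<close>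
  have "\<exists>\<rho>. q \<rho> \<noteq> 0"
  proof (rule ccontr)
    assume "\<nexists>\<rho>. q \<rho> \<noteq> 0"
    then have z: "p (m \<circ> transpose i (Suc i)) = complex_of_real (1 / d) * p m" for m
      by (simp add: q_def Kop_def)
    have "p \<nu> = complex_of_real (1 / d) * (complex_of_real (1 / d) * p \<nu>)"
      using z[of "\<nu> \<circ> transpose i (Suc i)"] z[of \<nu>] by simp
    then have "complex_of_real (1 / d * (1 / d)) * p \<nu> = p \<nu>"
      by (simp only: of_real_mult mult.assoc)
    then have "complex_of_real (1 / d * (1 / d)) = 1"
      using p(2) by (metis mult_cancel_right1)
    then have "1 / d * (1 / d) = 1"
      using of_real_eq_1_iff by blast
    then have "d * d = 1"
      by (simp add: field_simps split: if_splits)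
    then show False
      using gap by (metis abs_1 abs_square_eq_1 less_irrefl power2_eq_square)
  qed
  then show ?thesis
    using q by (auto simp: has_eigvec_def)
qed

lemma has_eigvec_const:
  assumes "\<And>i. i \<in> {1..N} \<Longrightarrow> \<mu> i = c" "valid_expo N \<mu>"
  shows "has_eigvec N \<alpha> \<mu>"
proof -
  define p :: lpoly where "p = (\<lambda>m. if m = \<mu> then 1 else 0)"
  have supp: "{m. p m \<noteq> 0} = {\<mu>}"
    by (auto simp: p_def)
  have v: "valid_lpoly N p"
    unfolding valid_lpoly_def supp using assms(2) by (auto simp: p_def)
  have z: "dd i j p m = 0" if "i \<in> {1..N}" "j \<in> {1..N}" for i j m
    using that assms(1) unfolding dd_def supp by (simp add: dd_coeff_def Let_def del: atLeastAtMost_iff)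
  have r: "rank N \<mu> i = i" if "i \<in> {1..N}" for i
  proof -
    have "before \<mu> j i \<longleftrightarrow> j \<le> i" if "j \<in> {1..N}" for j
      using assms(1)[OF that] assms(1)[OF \<open>i \<in> {1..N}\<close>] by (simp add: before_def)
    then have "{j\<in>{1..N}. before \<mu> j i} = {1..i}"
      using that by force
    then show ?thesis
      by (simp add: rank_def)
  qed
  have "dunkl N \<alpha> i p m = complex_of_real (eigval N \<alpha> \<mu> i) * p m" if "i \<in> {1..N}" for i m
  proof -
    have "(\<Sum>j\<in>{i<..N}. dd i j p m) = 0" "(\<Sum>j\<in>{1..<i}. dd j i p m) = 0"
      using z that by (auto intro!: sum.neutral)
    then show ?thesis
      using r[OF that] by (simp add: dunkl_def eigval_def p_def algebra_simps)
  qed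
  then have "eigvec N \<alpha> (eigval N \<alpha> \<mu>) p"
    using v by (auto simp: eigvec_def)
  moreover have "p \<mu> \<noteq> 0"
    by (simp add: p_def)
  ultimately show ?thesis
    unfolding has_eigvec_def by blast
qed

lemma sum_lower:
  assumes "1 \<le> N"
  shows "(\<Sum>i\<in>{1..N}. lower_expo N \<mu> i) = (\<Sum>i\<in>{1..N}. \<mu> i) - 1"
proof -
  have "(\<Sum>i\<in>{1..N}. lower_expo N \<mu> i) = lower_expo N \<mu> 1 + (\<Sum>i\<in>{2..N}. lower_expo N \<mu> i)"
    using assms by (simp add: sum.atLeast_Suc_atMost numeral_2_eq_2)
  also have "(\<Sum>i\<in>{2..N}. lower_expo N \<mu> i) = (\<Sum>i\<in>{1..<N}. \<mu> i)"
    by (rule sum.reindex_bij_witness[where i=Suc and j="\<lambda>k. k - 1"]) (auto simp: lower_expo_def)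
  also have "lower_expo N \<mu> 1 = \<mu> N - 1"
    by (simp add: lower_expo_def)
  also have "\<mu> N - 1 + (\<Sum>i\<in>{1..<N}. \<mu> i) = (\<Sum>i\<in>{1..N}. \<mu> i) - 1"
    using assms by (simp add: sum.last_plus)
  finally show ?thesis .
qed

text \<open>\<open>s\<close> is the total excess over the constant exponent \<open>c\<close>. An
  entry above \<open>c\<close> is carried to position N by adjacent transpositions; the exponent is
  then the image under \<open>raise_expo\<close> of one with excess \<open>s - 1\<close> and entries
  still at least \<open>c\<close>.\<close>

lemma has_eigvec_bounded:
  assumes "\<alpha> > 0" "1 \<le> N"
  shows "valid_expo N \<mu> \<Longrightarrow> (\<And>i. i \<in> {1..N} \<Longrightarrow> c \<le> \<mu> i) \<Longrightarrow> (\<Sum>i\<in>{1..N}. \<mu> i) = int s + int N * c \<Longrightarrow>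
    has_eigvec N \<alpha> \<mu>"
proof (induction s arbitrary: \<mu> rule: less_induct)
  case (less s)
  show ?case
  proof (cases "\<forall>i\<in>{1..N}. \<mu> i = c")
    case True
    then show ?thesis
      using has_eigvec_const less.prems(1) by blast
  next
    case False
    have last: "has_eigvec N \<alpha> \<mu>"
      if \<mu>: "valid_expo N \<mu>" "\<And>i. i \<in> {1..N} \<Longrightarrow> c \<le> \<mu> i" "(\<Sum>i\<in>{1..N}. \<mu> i) = int s + int N * c" "c < \<mu> N" for \<mu>
    proof -
      have low: "c \<le> lower_expo N \<mu> i" if "i \<in> {1..N}" for i
      proof (cases "i = 1")
        case True
        then show ?thesis
          using \<mu>(4) by (simp add: lower_expo_def)
      next
        case False
        then have "i - 1 \<in> {1..N}" "1 < i" "i \<le> N"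
          using that by auto
        then show ?thesis
          using \<mu>(2)[of "i - 1"] by (simp add: lower_expo_def)
      qed
      have sl: "(\<Sum>i\<in>{1..N}. lower_expo N \<mu> i) = int s + int N * c - 1"
        using sum_lower[OF assms(2), of \<mu>] \<mu>(3) by simp
      \<comment> \<open>The bound below is needed for \<open>s - 1\<close> to be a genuine, not
        truncated, subtraction.\<close>
      have "int N * c = (\<Sum>i\<in>{1..N}. c)"
        by simp
      also have "\<dots> \<le> (\<Sum>i\<in>{1..N}. lower_expo N \<mu> i)"
        using low by (intro sum_mono)
      finally have "s \<ge> 1"
        using sl by simp
      then have "has_eigvec N \<alpha> (lower_expo N \<mu>)"
        using less.IH[of "s - 1" "lower_expo N \<mu>"] low sl valid_lower[OF assms(2) \<mu>(1)] by simp
      then show ?thesis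
        using has_eigvec_raise[OF assms(2)] raise_lower[OF assms(2)] by metis
    qed
    have move: "has_eigvec N \<alpha> \<mu>"
      if "i \<le> N" "1 \<le> i" "valid_expo N \<mu>" "\<And>i. i \<in> {1..N} \<Longrightarrow> c \<le> \<mu> i"
        "(\<Sum>i\<in>{1..N}. \<mu> i) = int s + int N * c" "c < \<mu> i" for i \<mu>
      using that
    proof (induction arbitrary: \<mu> rule: inc_induct)
      case base
      then show ?case
        by (intro last) auto
    next
      \<comment> \<open>The large entry moves one place towards N; since transpositions are
        involutions, the eigenvector found there can be moved back.\<close>
      case (step i)
      let ?\<nu> = "\<mu> \<circ> transpose i (Suc i)"
      have i: "i \<in> {1..<N}"
        using step by simp
      have sum: "(\<Sum>i\<in>{1..N}. ?\<nu> i) = int s + int N * c"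
        using sum.permute[OF transpose_Suc_permutes[OF i], of \<mu>] step.prems(4) by simp
      have low: "c \<le> ?\<nu> j" if "j \<in> {1..N}" for j
        using step.prems(3)[of "transpose i (Suc i) j"] transpose_Suc_in_iff[OF i] that by simp
      have "valid_expo N ?\<nu>" "c < ?\<nu> (Suc i)" "1 \<le> Suc i"
        using step.prems valid_expo_transpose[OF i] by auto
      then have "has_eigvec N \<alpha> ?\<nu>"
        using step.IH[of ?\<nu>] low sum by blast
      then have "has_eigvec N \<alpha> (?\<nu> \<circ> transpose i (Suc i))"
        using has_eigvec_transpose[OF assms(1) i] by blast
      then show ?case
        by simp
    qed
    obtain i where "i \<in> {1..N}" "c < \<mu> i"
      using False less.prems(2) by force
    then show ?thesis
      using move[of i \<mu>] less.prems by simp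
  qed
qed

lemma has_eigvec:
  assumes "\<alpha> > 0" "1 \<le> N" "valid_expo N \<mu>"
  shows "has_eigvec N \<alpha> \<mu>"
proof -
  define c where "c = - (\<Sum>i\<in>{1..N}. \<bar>\<mu> i\<bar>)"
  have c: "c \<le> \<mu> i" if "i \<in> {1..N}" for i
  proof -
    have "\<bar>\<mu> i\<bar> \<le> (\<Sum>i\<in>{1..N}. \<bar>\<mu> i\<bar>)"
      using that by (intro member_le_sum) auto
    then show ?thesis
      by (simp add: c_def)
  qed
  then have "(\<Sum>i\<in>{1..N}. c) \<le> (\<Sum>i\<in>{1..N}. \<mu> i)"
    by (intro sum_mono)
  then have "(\<Sum>i\<in>{1..N}. \<mu> i) = int (nat ((\<Sum>i\<in>{1..N}. \<mu> i) - int N * c)) + int N * c"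
    by simp
  then show ?thesis
    using has_eigvec_bounded[OF assms(1-3), of c "nat ((\<Sum>i\<in>{1..N}. \<mu> i) - int N * c)"] c by blast
qed

section \<open>Action of adjacent transpositions on the eigenbasis\<close>

locale dunkl_setting =
  fixes N :: nat and \<alpha> :: real and m :: expo
  assumes N_pos: "1 \<le> N" and alpha_pos: "\<alpha> > 0" and m_MN: "m \<in> MN N"
begin

abbreviation S :: "(nat \<Rightarrow> nat) set" where
  "S \<equiv> Sm N m"

abbreviation \<Phi> :: "(nat \<Rightarrow> nat) \<Rightarrow> lpoly" where
  "\<Phi> \<equiv> Phi N \<alpha> m"

section \<open>Combinatorics of the index set S\<close>

lemma S_permutes: "\<sigma> \<in> S \<Longrightarrow> \<sigma> permutes {1..N}"
  by (simp add: Sm_def)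

lemma S_iff: "\<sigma> \<in> S \<longleftrightarrow> \<sigma> permutes {1..N} \<and> (\<forall>i\<in>{1..N}. \<sigma> i = rank N (m \<circ> \<sigma>) i)"
  using rank_alt[of _ N "m \<circ> \<sigma>"] by (auto simp: Sm_def)

lemma S_rank: "\<sigma> \<in> S \<Longrightarrow> i \<in> {1..N} \<Longrightarrow> rank N (m \<circ> \<sigma>) i = \<sigma> i"
  by (simp add: S_iff)

lemma finite_S: "finite S"
  by (rule finite_subset[OF _ finite_permutations[of "{1..N}"]]) (auto simp: Sm_def)

lemma valid_comp:
  assumes "\<sigma> \<in> S"
  shows "valid_expo N (m \<circ> \<sigma>)"
  using assms m_MN S_permutes[OF assms] unfolding valid_expo_def MN_def permutes_def by auto

lemma xi_sig_eigval:
  "\<sigma> \<in> S \<Longrightarrow> i \<in> {1..N} \<Longrightarrow> xi_sig \<alpha> m \<sigma> i = complex_of_real (eigval N \<alpha> (m \<circ> \<sigma>) i)"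
  by (simp add: xi_sig_def eigval_def S_rank del: atLeastAtMost_iff)

lemma S_inj:
  assumes "\<sigma> \<in> S" "\<tau> \<in> S" "m \<circ> \<sigma> = m \<circ> \<tau>"
  shows "\<sigma> = \<tau>"
proof
  fix i
  show "\<sigma> i = \<tau> i"
    using S_rank[OF assms(1), of i] S_rank[OF assms(2), of i] assms(3)
      S_permutes[OF assms(1)] S_permutes[OF assms(2)]
    by (cases "i \<in> {1..N}") (simp_all add: permutes_def)
qed

lemma S_swap:
  assumes "\<sigma> \<in> S" "i \<in> {1..<N}" "m (\<sigma> i) \<noteq> m (\<sigma> (Suc i))"
  shows "\<sigma> \<circ> transpose i (Suc i) \<in> S"
proof -
  have "\<sigma> \<circ> transpose i (Suc i) permutes {1..N}"
    using permutes_compose[OF transpose_Suc_permutes[OF assms(2)] S_permutes[OF assms(1)]] .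
  moreover have "rank N (m \<circ> (\<sigma> \<circ> transpose i (Suc i))) k = (\<sigma> \<circ> transpose i (Suc i)) k" if "k \<in> {1..N}" for k
    using rank_transpose[of i N "m \<circ> \<sigma>" k] assms(2,3) S_rank[OF assms(1), of "transpose i (Suc i) k"]
      transpose_Suc_in_iff[OF assms(2), of k] that by (simp add: comp_assoc)
  ultimately show ?thesis
    by (simp add: S_iff)
qed

text \<open>Equal neighbours have consecutive ranks, so their spectral parameters differ by exactly
  1, the point where the R-matrix degenerates.\<close>

lemma S_Suc_equal:
  assumes "\<sigma> \<in> S" "i \<in> {1..<N}" "m (\<sigma> i) = m (\<sigma> (Suc i))"
  shows "\<sigma> (Suc i) = Suc (\<sigma> i)"
  using rank_Suc_equal[of i N "m \<circ> \<sigma>"] assms S_rank[OF assms(1), of i] S_rank[OF assms(1), of "Suc i"]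
  by simp

lemma rank_antitone:
  assumes "\<And>i. i \<in> {1..<N} \<Longrightarrow> \<mu> (Suc i) \<le> \<mu> i" "i \<in> {1..N}"
  shows "rank N \<mu> i = i"
proof -
  have anti: "\<mu> k \<le> \<mu> j" if "j \<le> k" "1 \<le> j" "k \<le> N" for j k
    using that
  proof (induction rule: dec_induct)
    case (step k)
    then show ?case
      using assms(1)[of k] by simp
  qed simp
  have "before \<mu> j i \<longleftrightarrow> j \<le> i" if "j \<in> {1..N}" for j
    using anti[of i j] anti[of j i] that assms(2) by (cases i j rule: linorder_cases) (auto simp: before_def)
  then have "{j\<in>{1..N}. before \<mu> j i} = {1..i}"
    using assms(2) by force
  then show ?thesis
    by (simp add: rank_def)
qed

lemma id_in_S: "id \<in> S"
  using m_MN rank_antitone[of m] by (auto simp: S_iff MN_def permutes_id)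

text \<open>A non-increasing exponent has the identity as rank function. Hence every other member of
  S has an ascent, along which inductions can go back to \<open>id\<close>.\<close>

lemma S_antitone_id:
  assumes "\<sigma> \<in> S" "\<And>i. i \<in> {1..<N} \<Longrightarrow> m (\<sigma> (Suc i)) \<le> m (\<sigma> i)"
  shows "\<sigma> = id"
proof
  fix i
  show "\<sigma> i = id i"
    using S_rank[OF assms(1), of i] rank_antitone[of "m \<circ> \<sigma>" i] assms(2) S_permutes[OF assms(1)]
    by (cases "i \<in> {1..N}") (auto simp: permutes_def)
qed

section \<open>The eigenbasis\<close>

lemma Phi_props:
  assumes "\<sigma> \<in> S"
  shows "eigvec N \<alpha> (eigval N \<alpha> (m \<circ> \<sigma>)) (\<Phi> \<sigma>)" "\<Phi> \<sigma> (m \<circ> \<sigma>) = 1"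
proof -
  let ?x = "eigval N \<alpha> (m \<circ> \<sigma>)"
  note v = valid_comp[OF assms]
  obtain p \<nu> where p: "eigvec N \<alpha> ?x p" "p \<nu> \<noteq> 0"
    using has_eigvec[OF alpha_pos N_pos v] by (auto simp: has_eigvec_def)
  have nz: "p (m \<circ> \<sigma>) \<noteq> 0"
    using eigvec_support[OF alpha_pos v p] by (rule conjunct1)
  \<comment> \<open>The vanishing second summand only brings the rescaled vector into the shape of
    \<open>eigvec_lincomb\<close>.\<close>
  define q where "q = (\<lambda>k. inverse (p (m \<circ> \<sigma>)) * p k + 0 * p k)"
  have q: "eigvec N \<alpha> ?x q" "q (m \<circ> \<sigma>) = 1"
    unfolding q_def using eigvec_lincomb[OF p(1) p(1)] nz by (auto simp del: mult_zero_left)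
  have "\<Phi> \<sigma> = (THE p. eigvec N \<alpha> ?x p \<and> p (m \<circ> \<sigma>) = 1)"
    unfolding Phi_def eigvec_def
    by (intro arg_cong[where f=The] ext) (auto simp: xi_sig_eigval[OF assms] simp del: atLeastAtMost_iff)
  also have "\<dots> = q"
    using q eigvec_unique[OF alpha_pos v] by (intro the_equality) auto
  finally show "eigvec N \<alpha> ?x (\<Phi> \<sigma>)" "\<Phi> \<sigma> (m \<circ> \<sigma>) = 1"
    using q by simp_all
qed

lemma Phi_valid: "\<sigma> \<in> S \<Longrightarrow> valid_lpoly N (\<Phi> \<sigma>)"
  using Phi_props(1) eigvec_valid by blast

lemma Phi_dunkl:
  assumes "\<sigma> \<in> S" "i \<in> {1..N}"
  shows "dunkl N \<alpha> i (\<Phi> \<sigma>) = (\<lambda>k. xi_sig \<alpha> m \<sigma> i * \<Phi> \<sigma> k)"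
  using eigvec_dunkl[OF Phi_props(1)[OF assms(1)] assms(2)] xi_sig_eigval[OF assms] by auto

lemma Phi_support:
  "\<sigma> \<in> S \<Longrightarrow> \<Phi> \<sigma> \<nu> \<noteq> 0 \<Longrightarrow> \<nu> = m \<circ> \<sigma> \<or> below N \<nu> (m \<circ> \<sigma>)"
  using eigvec_support[OF alpha_pos valid_comp Phi_props(1)] by blast

text \<open>Among the exponents with nonzero coefficient a maximal one
  \<open>m \<circ> \<tau>\<close> exists. By triangularity and injectivity of
  \<open>\<sigma> \<mapsto> m \<circ> \<sigma>\<close> on S only \<open>\<Phi> \<tau>\<close>
  contributes at that exponent.\<close>

lemma Phi_independent:
  assumes "\<And>k. (\<Sum>\<sigma>\<in>S. c \<sigma> * \<Phi> \<sigma> k) = 0" "\<sigma> \<in> S"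
  shows "c \<sigma> = 0"
proof (rule ccontr)
  assume nz: "c \<sigma> \<noteq> 0"
  let ?M = "{\<sigma>\<in>S. c \<sigma> \<noteq> 0}"
  have "\<exists>\<nu>\<in>(\<lambda>\<sigma>. m \<circ> \<sigma>) ` ?M. \<forall>\<rho>\<in>(\<lambda>\<sigma>. m \<circ> \<sigma>) ` ?M. \<not> below N \<nu> \<rho>"
    using finite_S nz assms(2) by (intro finite_below_maximal) auto
  then obtain \<tau> where \<tau>: "\<tau> \<in> S" "c \<tau> \<noteq> 0"
    and max: "\<And>\<rho>. \<rho> \<in> S \<Longrightarrow> c \<rho> \<noteq> 0 \<Longrightarrow> \<not> below N (m \<circ> \<tau>) (m \<circ> \<rho>)"
    by auto
  have "c \<rho> * \<Phi> \<rho> (m \<circ> \<tau>) = (if \<rho> = \<tau> then c \<tau> else 0)" if "\<rho> \<in> S" for \<rho>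
  proof (cases "\<rho> = \<tau> \<or> c \<rho> = 0")
    case True
    then show ?thesis
      using Phi_props(2)[OF \<tau>(1)] \<tau>(2) by (elim disjE) auto
  next
    case False
    then have "\<Phi> \<rho> (m \<circ> \<tau>) = 0"
      using Phi_support[OF that, of "m \<circ> \<tau>"] max[OF that] S_inj[OF that \<tau>(1)] by metis
    then show ?thesis
      using False by simp
  qed
  then have "(\<Sum>\<rho>\<in>S. c \<rho> * \<Phi> \<rho> (m \<circ> \<tau>)) = (\<Sum>\<rho>\<in>S. if \<rho> = \<tau> then c \<tau> else 0)"
    by (intro sum.cong) auto
  also have "\<dots> = c \<tau>"
    using finite_S \<tau>(1) by simp
  finally show False
    using assms(1) \<tau>(2) by simp
qed

lemma Phi_coeff_unique:
  assumes "\<And>k. (\<Sum>\<sigma>\<in>S. c \<sigma> * \<Phi> \<sigma> k) = (\<Sum>\<sigma>\<in>S. d \<sigma> * \<Phi> \<sigma> k)" "\<sigma> \<in> S"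
  shows "c \<sigma> = d \<sigma>"
  using Phi_independent[of "\<lambda>\<sigma>. c \<sigma> - d \<sigma>", OF _ assms(2)] assms(1)
  by (simp add: left_diff_distrib sum_subtractf)

text \<open>The eigenvalue gap is 1, so the intertwiner is K - 1. A nonzero image would have the
  transposed spectrum, yet its leading exponent would be the unchanged
  \<open>m \<circ> \<sigma>\<close>, whose eigenvalues at \<open>i\<close> and \<open>Suc i\<close>
  differ.\<close>

lemma Kop_Phi_equal:
  assumes "\<sigma> \<in> S" "i \<in> {1..<N}" "m (\<sigma> i) = m (\<sigma> (Suc i))"
  shows "Kop i (Suc i) (\<Phi> \<sigma>) = \<Phi> \<sigma>"
proof -
  let ?\<mu> = "m \<circ> \<sigma>" and ?s = "transpose i (Suc i)"
  note v = valid_comp[OF assms(1)]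
  have d: "eigval N \<alpha> ?\<mu> i - eigval N \<alpha> ?\<mu> (Suc i) = 1"
    using rank_Suc_equal[OF assms(2), of ?\<mu>] assms(3) by (simp add: eigval_def)
  define q where "q = (\<lambda>k. Kop i (Suc i) (\<Phi> \<sigma>) k - \<Phi> \<sigma> k)"
  have q: "eigvec N \<alpha> (eigval N \<alpha> ?\<mu> \<circ> ?s) q"
    using eigvec_intertwine[OF assms(2) Phi_props(1)[OF assms(1)]] d by (auto simp: q_def)
  have "q k = 0" for k
  proof (rule ccontr)
    assume "q k \<noteq> 0"
    then obtain \<nu> where \<nu>: "q \<nu> \<noteq> 0" "valid_expo N \<nu>" "\<forall>\<tau>. q \<tau> \<noteq> 0 \<longrightarrow> \<not> below N \<nu> \<tau>"
      using valid_lpoly_maximal[OF eigvec_valid[OF q]] by blast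
    have e: "eigval N \<alpha> \<nu> j = eigval N \<alpha> ?\<mu> (?s j)" if "j \<in> {1..N}" for j
      using eigvec_maximal[OF q \<nu>(1) _ that] \<nu>(3) by simp
    have "\<nu> = ?\<mu> \<circ> ?s"
      using e by (rule eigval_determines_expo[OF alpha_pos v \<nu>(2) transpose_Suc_permutes[OF assms(2)]])
    also have "\<dots> = ?\<mu>"
      using assms(3) by (auto simp: transpose_def)
    finally have "eigval N \<alpha> ?\<mu> i = eigval N \<alpha> ?\<mu> (Suc i)"
      using e[of i] assms(2) by simp
    then show False
      using d by simp
  qed
  then show ?thesis
    by (auto simp: q_def)
qed

definition acoef :: "nat \<Rightarrow> (nat \<Rightarrow> nat) \<Rightarrow> complex" where
  "acoef i \<sigma> = 1 / (xi_sig \<alpha> m \<sigma> i - xi_sig \<alpha> m \<sigma> (Suc i))"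

text \<open>The coefficient of \<open>\<Phi> \<sigma>\<close> in K applied to the partner of
  \<open>\<Phi> \<sigma>\<close>. The asymmetry reflects the normalisation of leading coefficients
  to 1.\<close>

definition bcoef :: "nat \<Rightarrow> (nat \<Rightarrow> nat) \<Rightarrow> complex" where
  "bcoef i \<sigma> = (if m (\<sigma> i) > m (\<sigma> (Suc i)) then 1 else 1 - (acoef i \<sigma>)\<^sup>2)"

lemma acoef_swap: "acoef i (\<sigma> \<circ> transpose i (Suc i)) = - acoef i \<sigma>"
proof -
  have "1 / (b - a) = - (1 / (a - b))" for a b :: complex
    using divide_minus_right[of 1 "a - b"] by simp
  then show ?thesis
    unfolding acoef_def xi_sig_def comp_apply transpose_apply_first transpose_apply_second .
qed

text \<open>The intertwiner produces an eigenvector with the spectrum of \<open>\<sigma>\<close>.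
  The support of the lower vector lies below \<open>m \<circ> \<sigma>\<close>, so the leading
  coefficient comes from K alone and equals 1; no further scalar appears.\<close>

lemma Kop_Phi_lower:
  assumes "\<sigma> \<in> S" "i \<in> {1..<N}" "m (\<sigma> i) > m (\<sigma> (Suc i))"
  shows "Kop i (Suc i) (\<Phi> (\<sigma> \<circ> transpose i (Suc i)))
    = (\<lambda>k. \<Phi> \<sigma> k - acoef i \<sigma> * \<Phi> (\<sigma> \<circ> transpose i (Suc i)) k)"
proof -
  let ?\<mu> = "m \<circ> \<sigma>" and ?s = "transpose i (Suc i)"
  let ?\<nu> = "m \<circ> (\<sigma> \<circ> ?s)"
  have \<nu>: "?\<nu> = ?\<mu> \<circ> ?s"
    by (simp add: comp_assoc)
  have \<tau>: "\<sigma> \<circ> ?s \<in> S"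
    using assms by (intro S_swap) auto
  define p where "p = \<Phi> (\<sigma> \<circ> ?s)"
  have p: "eigvec N \<alpha> (eigval N \<alpha> ?\<nu>) p" "p ?\<nu> = 1"
    using Phi_props[OF \<tau>] by (simp_all add: p_def)
  have ev: "eigval N \<alpha> ?\<nu> j = eigval N \<alpha> ?\<mu> (?s j)" for j
    unfolding \<nu> using assms by (intro eigval_transpose) auto
  have gap: "eigval N \<alpha> ?\<mu> i - eigval N \<alpha> ?\<mu> (Suc i) > 1"
    using assms by (intro eigval_gap[OF alpha_pos]) auto
  have a: "- complex_of_real (1 / (eigval N \<alpha> ?\<nu> i - eigval N \<alpha> ?\<nu> (Suc i))) = acoef i \<sigma>"
  proof -
    have "1 / (y - x) = - (1 / (x - y))" for x y :: real
      using divide_minus_right[of 1 "x - y"] by simp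
    then have "- (1 / (eigval N \<alpha> ?\<nu> i - eigval N \<alpha> ?\<nu> (Suc i))) = 1 / (eigval N \<alpha> ?\<mu> i - eigval N \<alpha> ?\<mu> (Suc i))"
      unfolding ev transpose_apply_first transpose_apply_second by (metis minus_minus)
    then have "- complex_of_real (1 / (eigval N \<alpha> ?\<nu> i - eigval N \<alpha> ?\<nu> (Suc i)))
        = complex_of_real (1 / (eigval N \<alpha> ?\<mu> i - eigval N \<alpha> ?\<mu> (Suc i)))"
      by (metis of_real_minus)
    then show ?thesis
      using assms xi_sig_eigval[OF assms(1), of i] xi_sig_eigval[OF assms(1), of "Suc i"]
      by (simp add: acoef_def)
  qed
  define q where "q = (\<lambda>k. Kop i (Suc i) p k + acoef i \<sigma> * p k)"
  have q_eq: "q = (\<lambda>k. Kop i (Suc i) p k - complex_of_real (1 / (eigval N \<alpha> ?\<nu> i - eigval N \<alpha> ?\<nu> (Suc i))) * p k)"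
    unfolding q_def a[symmetric] by simp
  have "eigval N \<alpha> ?\<nu> i \<noteq> eigval N \<alpha> ?\<nu> (Suc i)"
    using gap unfolding ev by simp
  then have "eigvec N \<alpha> (eigval N \<alpha> ?\<nu> \<circ> ?s) q"
    unfolding q_eq by (rule eigvec_intertwine[OF assms(2) p(1)])
  then have q: "eigvec N \<alpha> (eigval N \<alpha> ?\<mu>) q"
    using ev by (simp add: eigvec_def)
  have "p ?\<mu> = 0"
  proof (rule ccontr)
    assume "p ?\<mu> \<noteq> 0"
    then have "?\<mu> = ?\<nu> \<or> below N ?\<mu> ?\<nu>"
      using Phi_support[OF \<tau>] by (simp add: p_def)
    moreover have "below N ?\<nu> ?\<mu>"
      unfolding \<nu> using assms by (intro below_transpose) auto
    ultimately show False
      using below_irrefl below_trans by metis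
  qed
  then have "q ?\<mu> = \<Phi> \<sigma> ?\<mu>"
    using p(2) Phi_props(2)[OF assms(1)] by (simp add: q_def Kop_def \<nu>)
  then have "q = \<Phi> \<sigma>"
    by (rule eigvec_unique[OF alpha_pos valid_comp[OF assms(1)] q Phi_props(1)[OF assms(1)]])
  then show ?thesis
    unfolding p_def[symmetric] by (auto simp: q_def fun_eq_iff eq_diff_eq)
qed

text \<open>Applying K once more to the lower formula, with K an involution, forces the entry
  \<open>1 - a\<^sup>2\<close>.\<close>

lemma Kop_Phi_upper:
  assumes "\<sigma> \<in> S" "i \<in> {1..<N}" "m (\<sigma> i) > m (\<sigma> (Suc i))"
  shows "Kop i (Suc i) (\<Phi> \<sigma>)
    = (\<lambda>k. acoef i \<sigma> * \<Phi> \<sigma> k + (1 - (acoef i \<sigma>)\<^sup>2) * \<Phi> (\<sigma> \<circ> transpose i (Suc i)) k)"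
proof
  fix k
  let ?s = "transpose i (Suc i)"
  let ?p = "\<Phi> (\<sigma> \<circ> ?s)" and ?a = "acoef i \<sigma>"
  have K: "?p (k \<circ> ?s) = \<Phi> \<sigma> k - ?a * ?p k" for k
    using fun_cong[OF Kop_Phi_lower[OF assms], of k] by (simp add: Kop_def)
  have "?p k = \<Phi> \<sigma> (k \<circ> ?s) - ?a * (\<Phi> \<sigma> k - ?a * ?p k)"
    using K[of "k \<circ> ?s"] K[of k] by simp
  then show "Kop i (Suc i) (\<Phi> \<sigma>) k = ?a * \<Phi> \<sigma> k + (1 - ?a\<^sup>2) * ?p k"
    by (simp add: Kop_def algebra_simps power2_eq_square)
qed

lemma Kop_Phi:
  assumes "\<sigma> \<in> S" "i \<in> {1..<N}" "m (\<sigma> i) \<noteq> m (\<sigma> (Suc i))"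
  shows "Kop i (Suc i) (\<Phi> \<sigma>) k = acoef i \<sigma> * \<Phi> \<sigma> k +
    bcoef i (\<sigma> \<circ> transpose i (Suc i)) * \<Phi> (\<sigma> \<circ> transpose i (Suc i)) k"
proof (cases "m (\<sigma> i) > m (\<sigma> (Suc i))")
  case True
  then show ?thesis
    using Kop_Phi_upper[OF assms(1,2)] by (simp add: bcoef_def acoef_swap)
next
  case False
  then show ?thesis
    using Kop_Phi_lower[OF S_swap[OF assms] assms(2)] assms(3)
    by (simp add: bcoef_def acoef_swap)
qed

text \<open>The coefficient at \<open>\<Phi> \<sigma>\<close> after K has acted on the combination
  with coefficients \<open>c\<close>: the matrix of K is read by rows, hence \<open>bcoef\<close> at
  \<open>\<sigma>\<close> and not at its partner.\<close>

definition twist :: "nat \<Rightarrow> ((nat \<Rightarrow> nat) \<Rightarrow> complex) \<Rightarrow> (nat \<Rightarrow> nat) \<Rightarrow> complex" where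
  "twist i c \<sigma> = (if m (\<sigma> i) = m (\<sigma> (Suc i)) then c \<sigma>
    else acoef i \<sigma> * c \<sigma> + bcoef i \<sigma> * c (\<sigma> \<circ> transpose i (Suc i)))"

lemma Kop_sum_Phi:
  assumes "i \<in> {1..<N}"
  shows "Kop i (Suc i) (\<lambda>k. \<Sum>\<sigma>\<in>S. c \<sigma> * \<Phi> \<sigma> k) k = (\<Sum>\<sigma>\<in>S. twist i c \<sigma> * \<Phi> \<sigma> k)"
proof -
  let ?s = "transpose i (Suc i)"
  define E D where "E = {\<sigma>\<in>S. m (\<sigma> i) = m (\<sigma> (Suc i))}" and "D = {\<sigma>\<in>S. m (\<sigma> i) \<noteq> m (\<sigma> (Suc i))}"
  have split: "(\<Sum>\<sigma>\<in>S. g \<sigma>) = (\<Sum>\<sigma>\<in>E. g \<sigma>) + (\<Sum>\<sigma>\<in>D. g \<sigma>)" for g :: "(nat \<Rightarrow> nat) \<Rightarrow> complex"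
  proof -
    have "S = E \<union> D" "E \<inter> D = {}" "finite E" "finite D"
      using finite_S by (auto simp: E_def D_def)
    then show ?thesis
      using sum.union_disjoint by metis
  qed
  have D_swap: "\<sigma> \<circ> ?s \<in> D" if "\<sigma> \<in> D" for \<sigma>
    using that S_swap[OF _ assms] by (auto simp: D_def)
  have "Kop i (Suc i) (\<lambda>k. \<Sum>\<sigma>\<in>S. c \<sigma> * \<Phi> \<sigma> k) k = (\<Sum>\<sigma>\<in>S. c \<sigma> * Kop i (Suc i) (\<Phi> \<sigma>) k)"
    by (simp add: Kop_def)
  also have "\<dots> = (\<Sum>\<sigma>\<in>E. twist i c \<sigma> * \<Phi> \<sigma> k)
      + (\<Sum>\<sigma>\<in>D. c \<sigma> * (acoef i \<sigma> * \<Phi> \<sigma> k + bcoef i (\<sigma> \<circ> ?s) * \<Phi> (\<sigma> \<circ> ?s) k))"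
    unfolding split using Kop_Phi[OF _ assms] Kop_Phi_equal[OF _ assms]
    by (intro arg_cong2[where f="(+)"] sum.cong) (auto simp: E_def D_def twist_def)
  also have "(\<Sum>\<sigma>\<in>D. c \<sigma> * (acoef i \<sigma> * \<Phi> \<sigma> k + bcoef i (\<sigma> \<circ> ?s) * \<Phi> (\<sigma> \<circ> ?s) k))
      = (\<Sum>\<sigma>\<in>D. c \<sigma> * acoef i \<sigma> * \<Phi> \<sigma> k) + (\<Sum>\<sigma>\<in>D. c \<sigma> * bcoef i (\<sigma> \<circ> ?s) * \<Phi> (\<sigma> \<circ> ?s) k)"
    by (simp add: sum.distrib algebra_simps)
  also have "(\<Sum>\<sigma>\<in>D. c \<sigma> * bcoef i (\<sigma> \<circ> ?s) * \<Phi> (\<sigma> \<circ> ?s) k) = (\<Sum>\<sigma>\<in>D. c (\<sigma> \<circ> ?s) * bcoef i \<sigma> * \<Phi> \<sigma> k)"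
    by (rule sum.reindex_bij_witness[where i="\<lambda>\<sigma>. \<sigma> \<circ> ?s" and j="\<lambda>\<sigma>. \<sigma> \<circ> ?s"])
      (simp_all add: D_swap)
  also have "(\<Sum>\<sigma>\<in>D. c \<sigma> * acoef i \<sigma> * \<Phi> \<sigma> k) + (\<Sum>\<sigma>\<in>D. c (\<sigma> \<circ> ?s) * bcoef i \<sigma> * \<Phi> \<sigma> k)
      = (\<Sum>\<sigma>\<in>D. twist i c \<sigma> * \<Phi> \<sigma> k)"
    unfolding sum.distrib[symmetric] by (intro sum.cong) (auto simp: twist_def D_def algebra_simps)
  finally show ?thesis
    unfolding split .
qed

section \<open>Invariance as a recursion on coefficient vectors\<close>

lemma Rchk_apply:
  "Rchk i (- xi_sig \<alpha> m \<sigma> i + xi_sig \<alpha> m \<sigma> (Suc i)) v e = - acoef i \<sigma> * v e + v (e \<circ> transpose i (Suc i))"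
proof -
  have "inverse (- a + b) = - (1 / (a - b))" for a b :: complex
    by (metis inverse_eq_divide inverse_minus_eq minus_diff_eq uminus_add_conv_diff)
  then show ?thesis
    by (simp add: Rchk_def Pop_def acoef_def)
qed

definition lift :: "((nat \<Rightarrow> nat) \<Rightarrow> tvec) \<Rightarrow> hvec" where
  "lift V = (\<lambda>e k. \<Sum>\<sigma>\<in>S. V \<sigma> e * \<Phi> \<sigma> k)"

lemma lift_invariant_iff:
  assumes "i \<in> {1..<N}"
  shows "(\<lambda>e. Kop i (Suc i) (Pop i (Suc i) (lift V) e)) = lift V \<longleftrightarrow>
    (\<forall>\<sigma>\<in>S. (m (\<sigma> i) = m (\<sigma> (Suc i)) \<longrightarrow> Pop i (Suc i) (V \<sigma>) = V \<sigma>) \<and>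
      (m (\<sigma> i) > m (\<sigma> (Suc i)) \<longrightarrow> V (\<sigma> \<circ> transpose i (Suc i)) =
        Rchk i (- xi_sig \<alpha> m \<sigma> i + xi_sig \<alpha> m \<sigma> (Suc i)) (V \<sigma>)))"
    (is "?L \<longleftrightarrow> ?R")
proof -
  let ?s = "transpose i (Suc i)"
  have K: "Kop i (Suc i) (Pop i (Suc i) (lift V) e) k = (\<Sum>\<sigma>\<in>S. twist i (\<lambda>\<sigma>. V \<sigma> (e \<circ> ?s)) \<sigma> * \<Phi> \<sigma> k)" for e k
    using Kop_sum_Phi[OF assms, of "\<lambda>\<sigma>. V \<sigma> (e \<circ> ?s)" k] by (simp add: lift_def Pop_def)
  have "?L \<longleftrightarrow> (\<forall>\<sigma>\<in>S. \<forall>e. twist i (\<lambda>\<sigma>. V \<sigma> (e \<circ> ?s)) \<sigma> = V \<sigma> e)" (is "_ \<longleftrightarrow> ?T")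
  proof
    assume L: ?L
    have eq: "(\<Sum>\<sigma>\<in>S. twist i (\<lambda>\<sigma>. V \<sigma> (e \<circ> ?s)) \<sigma> * \<Phi> \<sigma> k) = (\<Sum>\<sigma>\<in>S. V \<sigma> e * \<Phi> \<sigma> k)" for e k
      unfolding K[symmetric] using fun_cong[OF fun_cong[OF L], of e k] by (simp add: lift_def)
    show ?T
    proof (intro ballI allI)
      fix \<sigma> e assume "\<sigma> \<in> S"
      then show "twist i (\<lambda>\<sigma>. V \<sigma> (e \<circ> ?s)) \<sigma> = V \<sigma> e"
        using Phi_coeff_unique[of "twist i (\<lambda>\<sigma>. V \<sigma> (e \<circ> ?s))" "\<lambda>\<sigma>. V \<sigma> e", OF eq] by blast
    qed
  next
    assume T: ?T
    show ?L
    proof (intro ext)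
      fix e k
      show "Kop i (Suc i) (Pop i (Suc i) (lift V) e) k = lift V e k"
        unfolding K using T by (simp add: lift_def)
    qed
  qed
  also have "\<dots> \<longleftrightarrow> ?R"
  proof
    assume T: ?T
    show ?R
    proof (intro ballI conjI impI)
      fix \<sigma> assume "\<sigma> \<in> S" "m (\<sigma> i) = m (\<sigma> (Suc i))"
      then show "Pop i (Suc i) (V \<sigma>) = V \<sigma>"
        using T by (auto simp: twist_def Pop_def)
    next
      fix \<sigma> assume \<sigma>: "\<sigma> \<in> S" "m (\<sigma> i) > m (\<sigma> (Suc i))"
      show "V (\<sigma> \<circ> ?s) = Rchk i (- xi_sig \<alpha> m \<sigma> i + xi_sig \<alpha> m \<sigma> (Suc i)) (V \<sigma>)"
      proof
        fix e
        have "twist i (\<lambda>\<sigma>. V \<sigma> (e \<circ> ?s \<circ> ?s)) \<sigma> = V \<sigma> (e \<circ> ?s)"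
          using T \<sigma>(1) by blast
        then have "acoef i \<sigma> * V \<sigma> e + V (\<sigma> \<circ> ?s) e = V \<sigma> (e \<circ> ?s)"
          using \<sigma>(2) by (simp add: twist_def bcoef_def)
        then show "V (\<sigma> \<circ> ?s) e = Rchk i (- xi_sig \<alpha> m \<sigma> i + xi_sig \<alpha> m \<sigma> (Suc i)) (V \<sigma>) e"
          unfolding Rchk_apply by (simp add: eq_diff_eq add.commute)
      qed
    qed
  next
    assume R: ?R
    show ?T
    proof (intro ballI allI)
      fix \<sigma> e assume \<sigma>: "\<sigma> \<in> S"
      consider "m (\<sigma> i) = m (\<sigma> (Suc i))" | "m (\<sigma> i) > m (\<sigma> (Suc i))" | "m (\<sigma> i) < m (\<sigma> (Suc i))"
        by linarith
      then show "twist i (\<lambda>\<sigma>. V \<sigma> (e \<circ> ?s)) \<sigma> = V \<sigma> e"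
      proof cases
        case 1
        then have "Pop i (Suc i) (V \<sigma>) e = V \<sigma> e"
          using R \<sigma> by simp
        then show ?thesis
          using 1 by (simp add: twist_def Pop_def)
      next
        case 2
        then have "V (\<sigma> \<circ> ?s) (e \<circ> ?s) = - acoef i \<sigma> * V \<sigma> (e \<circ> ?s) + V \<sigma> (e \<circ> ?s \<circ> ?s)"
          using R \<sigma> Rchk_apply by simp
        then show ?thesis
          using 2 by (simp add: twist_def bcoef_def)
      next
        \<comment> \<open>The condition at an ascent follows from the one at its partner
          \<open>\<tau>\<close>: since P is an involution, (P + a) (P - a) = 1 - a^2 with a =
          \<open>acoef i \<tau>\<close>.\<close>
        case 3
        define \<tau> where "\<tau> = \<sigma> \<circ> ?s"
        have \<tau>: "\<tau> \<in> S" "m (\<tau> i) > m (\<tau> (Suc i))" "\<sigma> = \<tau> \<circ> ?s"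
          using 3 S_swap[OF \<sigma> assms] by (auto simp: \<tau>_def)
        have V: "V \<sigma> e = - acoef i \<tau> * V \<tau> e + V \<tau> (e \<circ> ?s)" for e
          using R \<tau> Rchk_apply by simp
        have a: "acoef i \<sigma> = - acoef i \<tau>"
          unfolding \<tau>(3) by (rule acoef_swap)
        have "twist i (\<lambda>\<sigma>. V \<sigma> (e \<circ> ?s)) \<sigma> = - acoef i \<tau> * V \<sigma> (e \<circ> ?s) + (1 - (acoef i \<tau>)\<^sup>2) * V \<tau> (e \<circ> ?s)"
          using 3 by (simp add: twist_def bcoef_def a \<tau>_def)
        also have "\<dots> = V \<sigma> e"
          unfolding V comp_transpose_twice by (simp add: algebra_simps power2_eq_square)
        finally show ?thesis .
      qed
    qed
  qed
  finally show ?thesis .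
qed

end

section \<open>Products of R-matrices\<close>

lemma Rchk_zero: "Rchk i u (\<lambda>e. 0) = (\<lambda>e. 0)"
  by (simp add: Rchk_def Pop_def)

lemma Rchk_minus_one: "Rchk i (- 1) v = (\<lambda>e. 0) \<longleftrightarrow> Pop i (Suc i) v = v"
  by (auto simp: Rchk_def Pop_def fun_eq_iff)

lemma comp_transpose_far:
  assumes "Suc i < j"
  shows "f \<circ> transpose i (Suc i) \<circ> transpose j (Suc j) = f \<circ> transpose j (Suc j) \<circ> transpose i (Suc i)"
  using assms by (auto simp: fun_eq_iff transpose_def)

lemma comp_transpose_braid:
  "f \<circ> transpose i (Suc i) \<circ> transpose (Suc i) (Suc (Suc i)) \<circ> transpose i (Suc i) =
   f \<circ> transpose (Suc i) (Suc (Suc i)) \<circ> transpose i (Suc i) \<circ> transpose (Suc i) (Suc (Suc i))"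
  by (auto simp: fun_eq_iff transpose_def)

lemma Rchk_far:
  assumes "Suc i < j"
  shows "Rchk i u (Rchk j v x) = Rchk j v (Rchk i u x)"
  unfolding Rchk_def Pop_def comp_transpose_far[OF assms] by (simp add: algebra_simps)

lemma Pop_Rchk_far:
  assumes "Suc i < j \<or> Suc j < i"
  shows "Pop i (Suc i) (Rchk j v x) = Rchk j v (Pop i (Suc i) x)"
proof -
  have "e \<circ> transpose i (Suc i) \<circ> transpose j (Suc j) = e \<circ> transpose j (Suc j) \<circ> transpose i (Suc i)" for e :: label
    using assms comp_transpose_far[of i j e] comp_transpose_far[of j i e] by auto
  then show ?thesis
    by (simp add: Rchk_def Pop_def)
qed

text \<open>The cubic terms agree by the braid relation, and the terms linear in the transpositions
  by 1 / (u v) = (1 / u + 1 / v) / (u + v).\<close>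

lemma yang_baxter:
  assumes "u \<noteq> 0" "v \<noteq> 0" "u + v \<noteq> 0"
  shows "Rchk i u (Rchk (Suc i) (u + v) (Rchk i v x)) = Rchk (Suc i) v (Rchk i (u + v) (Rchk (Suc i) u x))"
proof
  fix e
  have inv: "inverse u * inverse v = inverse (u + v) * (inverse u + inverse v)"
    using assms by (simp add: field_simps)
  define U V W where "U = inverse u" and "V = inverse v" and "W = inverse (u + v)"
  have UV: "U * V = W * U + W * V"
    using inv by (simp add: U_def V_def W_def distrib_left)
  \<comment> \<open>The trailing factor lets the identity rewrite inside right-nested
    products.\<close>
  have UV': "U * (V * c) = W * (U * c) + W * (V * c)" for c
    using arg_cong[OF UV, of "\<lambda>t. t * c"] by (simp add: algebra_simps)
  show "Rchk i u (Rchk (Suc i) (u + v) (Rchk i v x)) e = Rchk (Suc i) v (Rchk i (u + v) (Rchk (Suc i) u x)) e"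
    unfolding Rchk_def Pop_def U_def[symmetric] V_def[symmetric] W_def[symmetric]
      comp_transpose_twice comp_transpose_braid
    by (simp add: algebra_simps UV')
qed

context dunkl_setting
begin

abbreviation \<xi> :: "nat \<Rightarrow> complex" where
  "\<xi> \<equiv> xi \<alpha> m"

lemma xi_sig_eq: "xi_sig \<alpha> m \<sigma> i = \<xi> (\<sigma> i)"
  by (simp add: xi_sig_def xi_def)

lemma xi_inj:
  assumes "j \<in> {1..N}" "k \<in> {1..N}" "\<xi> j = \<xi> k"
  shows "j = k"
proof -
  have "\<xi> i = complex_of_real (eigval N \<alpha> m i)" if "i \<in> {1..N}" for i
    using xi_sig_eigval[OF id_in_S that] by (simp add: xi_sig_eq)
  then have "eigval N \<alpha> m j = eigval N \<alpha> m k"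
    using assms by (metis of_real_eq_iff)
  then show ?thesis
    using eigval_le_iff[OF alpha_pos assms(1,2), of m] eigval_le_iff[OF alpha_pos assms(2,1), of m]
    by (auto simp: before_def)
qed

lemma S_range: "\<sigma> \<in> S \<Longrightarrow> i \<in> {1..N} \<Longrightarrow> \<sigma> i \<in> {1..N}"
  using S_permutes permutes_in_image by metis

text \<open>Guarantees that the inverses in the R-matrices are genuine and not the default value of
  \<open>inverse 0\<close>.\<close>

lemma xi_diff_nonzero:
  assumes "\<sigma> \<in> S" "i \<in> {1..N}" "j \<in> {1..N}" "i \<noteq> j"
  shows "\<xi> (\<sigma> i) - \<xi> (\<sigma> j) \<noteq> 0"
  using assms xi_inj[of "\<sigma> i" "\<sigma> j"] S_range permutes_inj[OF S_permutes[OF assms(1)]]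
  by (auto dest: injD simp del: atLeastAtMost_iff)

text \<open>Measure for the induction along the weak order on \<open>S\<close>: it drops towards \<open>id\<close>.\<close>
definition depth :: "(nat \<Rightarrow> nat) \<Rightarrow> nat" where
  "depth \<sigma> = card {\<rho>\<in>S. below N (m \<circ> \<sigma>) (m \<circ> \<rho>)}"

lemma depth_less:
  assumes "\<sigma> \<in> S" "i \<in> {1..<N}" "m (\<sigma> i) < m (\<sigma> (Suc i))"
  shows "depth (\<sigma> \<circ> transpose i (Suc i)) < depth \<sigma>"
proof -
  let ?\<tau> = "\<sigma> \<circ> transpose i (Suc i)"
  have \<tau>: "?\<tau> \<in> S"
    using assms by (intro S_swap) auto
  have b: "below N (m \<circ> \<sigma>) (m \<circ> ?\<tau>)"
    using below_transpose[OF assms(2), of "m \<circ> ?\<tau>"] assms(3) by (simp add: comp_assoc)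
  have "{\<rho>\<in>S. below N (m \<circ> ?\<tau>) (m \<circ> \<rho>)} \<subset> {\<rho>\<in>S. below N (m \<circ> \<sigma>) (m \<circ> \<rho>)}"
    using \<tau> b below_irrefl below_trans by blast
  then show ?thesis
    unfolding depth_def using finite_S by (intro psubset_card_mono) auto
qed

lemma S_ascent_or_id:
  assumes "\<sigma> \<in> S" "\<sigma> \<noteq> id"
  obtains i where "i \<in> {1..<N}" "m (\<sigma> i) < m (\<sigma> (Suc i))"
  using S_antitone_id[OF assms(1)] assms(2) by (meson not_le)

text \<open>The recursion step read from its target: for a step from
  \<open>\<sigma> \<circ> transpose i (Suc i)\<close> to \<open>\<sigma>\<close> the two spectral
  parameters trade places, which removes the sign in the argument.\<close>

abbreviation Rinto :: "nat \<Rightarrow> (nat \<Rightarrow> nat) \<Rightarrow> tvec \<Rightarrow> tvec" where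
  "Rinto i \<sigma> \<equiv> Rchk i (\<xi> (\<sigma> i) - \<xi> (\<sigma> (Suc i)))"

abbreviation R_rel :: "(nat \<Rightarrow> nat) \<Rightarrow> (tvec \<Rightarrow> tvec) \<Rightarrow> bool" where
  "R_rel \<equiv> Rrel N \<alpha> m"

section \<open>Well-definedness of the R-matrix recursion\<close>

lemma R_rel_S: "R_rel \<sigma> M \<Longrightarrow> \<sigma> \<in> S"
proof (induction rule: Rrel.induct)
  case Rrel_id
  show ?case
    by (rule id_in_S)
next
  case (Rrel_step \<sigma> M i)
  then show ?case
    by (intro S_swap[OF Rrel_step.IH]) simp_all
qed

lemma R_rel_into:
  assumes "\<sigma> \<in> S" "i \<in> {1..<N}" "m (\<sigma> i) < m (\<sigma> (Suc i))" "R_rel (\<sigma> \<circ> transpose i (Suc i)) M"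
  shows "R_rel \<sigma> (Rinto i \<sigma> \<circ> M)"
proof -
  have "\<sigma> \<circ> transpose i (Suc i) \<in> S"
    using assms by (intro S_swap) auto
  from Rrel_step[OF assms(4) this assms(2)] show ?thesis
    using assms(3) by (simp add: xi_sig_eq)
qed

lemma R_rel_cases:
  assumes "R_rel \<sigma> M"
  obtains "\<sigma> = id" "M = (\<lambda>v. v)"
  | i M' where "i \<in> {1..<N}" "m (\<sigma> i) < m (\<sigma> (Suc i))" "R_rel (\<sigma> \<circ> transpose i (Suc i)) M'" "M = Rinto i \<sigma> \<circ> M'"
  using assms
proof (cases rule: Rrel.cases)
  case Rrel_id
  then show ?thesis
    using that(1) by simp
next
  case (Rrel_step \<tau> M' i)
  then show ?thesis
    using that(2)[of i M'] by (simp add: xi_sig_eq)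
qed

lemma R_rel_exists: "\<sigma> \<in> S \<Longrightarrow> \<exists>M. R_rel \<sigma> M"
proof (induction "depth \<sigma>" arbitrary: \<sigma> rule: less_induct)
  case less
  show ?case
  proof (cases "\<sigma> = id")
    case True
    then show ?thesis
      using Rrel_id by blast
  next
    case False
    then obtain i where i: "i \<in> {1..<N}" "m (\<sigma> i) < m (\<sigma> (Suc i))"
      using S_ascent_or_id[OF less.prems] by blast
    have "\<sigma> \<circ> transpose i (Suc i) \<in> S"
      using i less.prems by (intro S_swap) auto
    then show ?thesis
      using less.hyps[OF depth_less[OF less.prems i]] R_rel_into[OF less.prems i] by blast
  qed
qed

text \<open>Local confluence. Distant ascents commute. Adjacent ascents involve three strictly
  increasing exponents, so both ways of reversing them stay inside S and meet in a common ancestor;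
  the two sides of the hexagon agree by Yang-Baxter.\<close>

lemma R_rel_diamond:
  assumes \<sigma>: "\<sigma> \<in> S" and i: "i \<in> {1..<N}" "m (\<sigma> i) < m (\<sigma> (Suc i))"
    and j: "j \<in> {1..<N}" "m (\<sigma> j) < m (\<sigma> (Suc j))" and "i < j"
  shows "\<exists>A B. R_rel (\<sigma> \<circ> transpose i (Suc i)) A \<and> R_rel (\<sigma> \<circ> transpose j (Suc j)) B \<and>
    Rinto i \<sigma> \<circ> A = Rinto j \<sigma> \<circ> B"
proof -
  have \<sigma>i: "\<sigma> \<circ> transpose i (Suc i) \<in> S" and \<sigma>j: "\<sigma> \<circ> transpose j (Suc j) \<in> S"
    using assms by (auto intro: S_swap)
  show ?thesis
  proof (cases "Suc i < j")
    case True
    let ?\<tau> = "\<sigma> \<circ> transpose i (Suc i) \<circ> transpose j (Suc j)"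
    have "?\<tau> \<in> S"
      using True j by (intro S_swap[OF \<sigma>i]) auto
    then obtain M where M: "R_rel ?\<tau> M"
      using R_rel_exists by blast
    have A: "R_rel (\<sigma> \<circ> transpose i (Suc i)) (Rinto j \<sigma> \<circ> M)"
      using R_rel_into[OF \<sigma>i j(1) _ M] True j(2) by simp
    have B: "R_rel (\<sigma> \<circ> transpose j (Suc j)) (Rinto i \<sigma> \<circ> M)"
      using R_rel_into[OF \<sigma>j i(1) _ M[unfolded comp_transpose_far[OF True]]] True i(2) by simp
    have "Rinto i \<sigma> \<circ> (Rinto j \<sigma> \<circ> M) = Rinto j \<sigma> \<circ> (Rinto i \<sigma> \<circ> M)"
      using Rchk_far[OF True] by (auto simp: fun_eq_iff)
    then show ?thesis
      using A B by blast
  next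
    case False
    then have ji: "j = Suc i"
      using assms(6) by simp
    let ?s = "transpose i (Suc i)" and ?t = "transpose (Suc i) (Suc (Suc i))"
    let ?a = "\<sigma> i" and ?b = "\<sigma> (Suc i)" and ?c = "\<sigma> (Suc (Suc i))"
    have ii: "i \<in> {1..<N}" "Suc i \<in> {1..<N}"
      using i j ji by auto
    have abc: "m ?a < m ?b" "m ?b < m ?c"
      using i j ji by auto
    have \<sigma>st: "\<sigma> \<circ> ?s \<circ> ?t \<in> S"
      using abc by (intro S_swap[OF \<sigma>i ii(2)]) auto
    have \<sigma>ts: "\<sigma> \<circ> ?t \<circ> ?s \<in> S"
      using abc \<sigma>j ji by (intro S_swap[OF _ ii(1)]) auto
    have "\<sigma> \<circ> ?s \<circ> ?t \<circ> ?s \<in> S"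
      using abc by (intro S_swap[OF \<sigma>st ii(1)]) auto
    then obtain M where M: "R_rel (\<sigma> \<circ> ?s \<circ> ?t \<circ> ?s) M"
      using R_rel_exists by blast
    have "R_rel (\<sigma> \<circ> ?s \<circ> ?t) (Rchk i (\<xi> ?b - \<xi> ?c) \<circ> M)"
      using R_rel_into[OF \<sigma>st ii(1) _ M] abc by simp
    from R_rel_into[OF \<sigma>i ii(2) _ this]
    have A: "R_rel (\<sigma> \<circ> ?s) (Rchk (Suc i) (\<xi> ?a - \<xi> ?c) \<circ> (Rchk i (\<xi> ?b - \<xi> ?c) \<circ> M))"
      using abc by simp
    have "R_rel (\<sigma> \<circ> ?t \<circ> ?s) (Rchk (Suc i) (\<xi> ?a - \<xi> ?b) \<circ> M)"
      using R_rel_into[OF \<sigma>ts ii(2) _ M[unfolded comp_transpose_braid]] abc by simp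
    from R_rel_into[OF \<sigma>j[unfolded ji] ii(1) _ this]
    have B: "R_rel (\<sigma> \<circ> ?t) (Rchk i (\<xi> ?a - \<xi> ?c) \<circ> (Rchk (Suc i) (\<xi> ?a - \<xi> ?b) \<circ> M))"
      using abc by simp
    have nz: "\<xi> ?a - \<xi> ?b \<noteq> 0" "\<xi> ?b - \<xi> ?c \<noteq> 0" "\<xi> ?a - \<xi> ?c \<noteq> 0"
      using ii by (intro xi_diff_nonzero[OF \<sigma>]; simp)+
    have "Rinto i \<sigma> \<circ> (Rchk (Suc i) (\<xi> ?a - \<xi> ?c) \<circ> (Rchk i (\<xi> ?b - \<xi> ?c) \<circ> M))
        = Rinto j \<sigma> \<circ> (Rchk i (\<xi> ?a - \<xi> ?c) \<circ> (Rchk (Suc i) (\<xi> ?a - \<xi> ?b) \<circ> M))"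
    proof
      fix v
      have "\<xi> ?a - \<xi> ?b + (\<xi> ?b - \<xi> ?c) = \<xi> ?a - \<xi> ?c"
        by simp
      then show "(Rinto i \<sigma> \<circ> (Rchk (Suc i) (\<xi> ?a - \<xi> ?c) \<circ> (Rchk i (\<xi> ?b - \<xi> ?c) \<circ> M))) v
        = (Rinto j \<sigma> \<circ> (Rchk i (\<xi> ?a - \<xi> ?c) \<circ> (Rchk (Suc i) (\<xi> ?a - \<xi> ?b) \<circ> M))) v"
        using yang_baxter[of "\<xi> ?a - \<xi> ?b" "\<xi> ?b - \<xi> ?c" i "M v"] nz ji by simp
    qed
    then show ?thesis
      using A B ji by blast
  qed
qed

text \<open>Two derivations ending in different steps are compared through the diamond; the
  induction hypothesis at the two predecessors identifies the given maps with those of the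
  diamond.\<close>

lemma R_rel_unique: "R_rel \<sigma> M \<Longrightarrow> R_rel \<sigma> M' \<Longrightarrow> M = M'"
proof (induction "depth \<sigma>" arbitrary: \<sigma> M M' rule: less_induct)
  case less
  note \<sigma> = R_rel_S[OF less.prems(1)]
  \<comment> \<open>As \<open>m\<close> is non-increasing, no step ends in \<open>id\<close>, so
    there the value can only come from the base rule.\<close>
  have no_ascent: False if "i \<in> {1..<N}" "m (id i) < m (id (Suc i))" for i
    using that m_MN by (force simp: MN_def)
  have main: "Rinto i \<sigma> \<circ> A' = Rinto j \<sigma> \<circ> B'"
    if i: "i \<in> {1..<N}" "m (\<sigma> i) < m (\<sigma> (Suc i))" and j: "j \<in> {1..<N}" "m (\<sigma> j) < m (\<sigma> (Suc j))"
      and A': "R_rel (\<sigma> \<circ> transpose i (Suc i)) A'" and B': "R_rel (\<sigma> \<circ> transpose j (Suc j)) B'"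
      and "i < j" for i j A' B'
  proof -
    obtain A B where "R_rel (\<sigma> \<circ> transpose i (Suc i)) A" "R_rel (\<sigma> \<circ> transpose j (Suc j)) B"
      "Rinto i \<sigma> \<circ> A = Rinto j \<sigma> \<circ> B"
      using R_rel_diamond[OF \<sigma> i j \<open>i < j\<close>] by blast
    moreover have "A' = A" "B' = B"
      using less.hyps[OF depth_less[OF \<sigma> i] A'] less.hyps[OF depth_less[OF \<sigma> j] B'] calculation by auto
    ultimately show ?thesis
      by simp
  qed
  from less.prems(1) show ?case
  proof (cases rule: R_rel_cases)
    case 1
    from less.prems(2) show ?thesis
      by (cases rule: R_rel_cases) (use 1 no_ascent in auto)
  next
    case A: (2 i A')
    from less.prems(2) show ?thesis
    proof (cases rule: R_rel_cases)
      case 1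
      then show ?thesis
        using A no_ascent by auto
    next
      case B: (2 j B')
      consider "i < j" | "j < i" | "i = j"
        by linarith
      then show ?thesis
      proof cases
        case 1
        then show ?thesis
          using main[OF A(1,2) B(1,2) A(3) B(3)] A(4) B(4) by simp
      next
        case 2
        then show ?thesis
          using main[OF B(1,2) A(1,2) B(3) A(3)] A(4) B(4) by simp
      next
        case 3
        then show ?thesis
          using less.hyps[OF depth_less[OF \<sigma> A(1,2)] A(3)] A(4) B(3,4) by simp
      qed
    qed
  qed
qed

section \<open>Linearity, validity and symmetry of the R-matrix products\<close>

abbreviation R :: "(nat \<Rightarrow> nat) \<Rightarrow> tvec \<Rightarrow> tvec" where
  "R \<equiv> Rcal N \<alpha> m"

lemma R_rel_R: "\<sigma> \<in> S \<Longrightarrow> R_rel \<sigma> (R \<sigma>)"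
  unfolding Rcal_def using R_rel_exists R_rel_unique by (metis the_equality)

lemma R_eqI: "R_rel \<sigma> M \<Longrightarrow> R \<sigma> = M"
  using R_rel_R R_rel_S R_rel_unique by blast

lemma R_id: "R id = (\<lambda>v. v)"
  by (rule R_eqI) (rule Rrel_id)

lemma R_into:
  assumes "\<sigma> \<in> S" "i \<in> {1..<N}" "m (\<sigma> i) < m (\<sigma> (Suc i))"
  shows "R \<sigma> v = Rinto i \<sigma> (R (\<sigma> \<circ> transpose i (Suc i)) v)"
proof -
  have "\<sigma> \<circ> transpose i (Suc i) \<in> S"
    using assms by (intro S_swap) auto
  then have "R \<sigma> = Rinto i \<sigma> \<circ> R (\<sigma> \<circ> transpose i (Suc i))"
    using R_eqI R_rel_into[OF assms] R_rel_R by blast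
  then show ?thesis
    by simp
qed

lemma R_step:
  assumes "\<sigma> \<in> S" "i \<in> {1..<N}" "m (\<sigma> i) > m (\<sigma> (Suc i))"
  shows "R (\<sigma> \<circ> transpose i (Suc i)) v = Rchk i (- xi_sig \<alpha> m \<sigma> i + xi_sig \<alpha> m \<sigma> (Suc i)) (R \<sigma> v)"
  using R_eqI[OF Rrel_step[OF R_rel_R[OF assms(1)] assms]] by simp

lemma R_induct [consumes 1, case_names id step]:
  assumes "\<sigma> \<in> S" "P id"
    and "\<And>\<sigma> i. \<sigma> \<in> S \<Longrightarrow> i \<in> {1..<N} \<Longrightarrow> m (\<sigma> i) > m (\<sigma> (Suc i)) \<Longrightarrow> P \<sigma> \<Longrightarrow> P (\<sigma> \<circ> transpose i (Suc i))"
  shows "P \<sigma>"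
  using R_rel_R[OF assms(1)]
proof (induction rule: Rrel.induct)
  case Rrel_id
  show ?case
    by (rule assms(2))
next
  case (Rrel_step \<sigma> M i)
  show ?case
    by (rule assms(3)[OF Rrel_step.hyps(2-4) Rrel_step.IH])
qed

lemma R_add: "\<sigma> \<in> S \<Longrightarrow> R \<sigma> (\<lambda>e. v e + w e) = (\<lambda>e. R \<sigma> v e + R \<sigma> w e)"
proof (induction rule: R_induct)
  case id
  show ?case
    unfolding R_id ..
next
  case (step \<sigma> i)
  show ?case
    unfolding R_step[OF step(1-3)] step(4) by (simp add: Rchk_def Pop_def algebra_simps)
qed

lemma R_scale: "\<sigma> \<in> S \<Longrightarrow> R \<sigma> (\<lambda>e. c * v e) = (\<lambda>e. c * R \<sigma> v e)"
proof (induction rule: R_induct)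
  case id
  show ?case
    unfolding R_id ..
next
  case (step \<sigma> i)
  show ?case
    unfolding R_step[OF step(1-3)] step(4) by (simp add: Rchk_def Pop_def algebra_simps)
qed

lemma valid_label_transpose:
  assumes "i \<in> {1..<N}"
  shows "valid_label N n (e \<circ> transpose i (Suc i)) \<longleftrightarrow> valid_label N n e"
proof -
  have "valid_label N n (e \<circ> transpose i (Suc i))" if "valid_label N n e" for e
    using that assms by (auto simp: valid_label_def transpose_def)
  from this[of e] this[of "e \<circ> transpose i (Suc i)"] show ?thesis
    by auto
qed

lemma R_valid: "\<sigma> \<in> S \<Longrightarrow> valid_tvec N n w \<Longrightarrow> valid_tvec N n (R \<sigma> w)"
proof (induction rule: R_induct)
  case (step \<sigma> i)
  show ?case
    unfolding valid_tvec_def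
  proof (intro allI impI, rule ccontr)
    fix e assume *: "R (\<sigma> \<circ> transpose i (Suc i)) w e \<noteq> 0" "\<not> valid_label N n e"
    then have "R \<sigma> w e = 0" "R \<sigma> w (e \<circ> transpose i (Suc i)) = 0"
      using step valid_label_transpose[OF step(2)] by (auto simp: valid_tvec_def)
    then show False
      using *(1) R_step[OF step(1-3)] by (simp add: Rchk_def Pop_def)
  qed
qed (simp only: R_id)

text \<open>Equal neighbours at \<open>i\<close> and \<open>i + 1\<close> contribute the factor with spectral parameter \<open>- 1\<close>, which is
  \<open>P - 1\<close>; the Yang-Baxter equation moves it through the product towards \<open>w\<close>, which it annihilates.\<close>
lemma R_equal:
  assumes w: "\<And>i. i \<in> {1..<N} \<Longrightarrow> m i = m (Suc i) \<Longrightarrow> Pop i (Suc i) w = w"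
  shows "\<sigma> \<in> S \<Longrightarrow> i \<in> {1..<N} \<Longrightarrow> m (\<sigma> i) = m (\<sigma> (Suc i)) \<Longrightarrow> Pop i (Suc i) (R \<sigma> w) = R \<sigma> w"
proof (induction "depth \<sigma>" arbitrary: \<sigma> i rule: less_induct)
  case less
  note \<sigma> = less.prems(1) and i = less.prems(2) and eq = less.prems(3)
  have \<xi>_Suc: "\<xi> (\<sigma> (Suc i)) = \<xi> (\<sigma> i) - 1"
    using S_Suc_equal[OF \<sigma> i eq] eq by (simp add: xi_def)
  show ?case
  proof (cases "\<sigma> = id")
    case True
    then show ?thesis
      using w i eq by (simp add: R_id)
  next
    case False
    then obtain k where k: "k \<in> {1..<N}" "m (\<sigma> k) < m (\<sigma> (Suc k))"
      using S_ascent_or_id[OF \<sigma>] by blast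
    let ?\<tau> = "\<sigma> \<circ> transpose k (Suc k)"
    have \<tau>: "?\<tau> \<in> S"
      using k by (intro S_swap[OF \<sigma>]) auto
    note d\<tau> = depth_less[OF \<sigma> k]
    consider "Suc i < k \<or> Suc k < i" | "k = Suc i" | "i = Suc k"
      using k(2) eq by (metis less_irrefl linorder_neqE_nat not_less_eq)
    then show ?thesis
    proof cases
      case 1
      then have "Pop i (Suc i) (R ?\<tau> w) = R ?\<tau> w"
        using eq by (intro less.hyps[OF d\<tau> \<tau> i]) auto
      then show ?thesis
        using R_into[OF \<sigma> k] Pop_Rchk_far[OF 1] by simp
    next
      case 2
      \<comment> \<open>In \<open>?\<rho>\<close> the larger third exponent has passed both equal
        ones, so the equal pair sits at \<open>k\<close> and \<open>Suc k\<close>, and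
        \<open>?\<rho>\<close> has smaller depth.\<close>
      let ?\<rho> = "?\<tau> \<circ> transpose i (Suc i)"
      have asc: "m (?\<tau> i) < m (?\<tau> (Suc i))"
        using 2 k eq by simp
      have \<rho>: "?\<rho> \<in> S"
        using asc by (intro S_swap[OF \<tau> i]) auto
      have "Pop k (Suc k) (R ?\<rho> w) = R ?\<rho> w"
        using 2 eq by (intro less.hyps[OF less_trans[OF depth_less[OF \<tau> i asc] d\<tau>] \<rho> k(1)]) simp
      then have z: "Rchk (Suc i) (- 1) (R ?\<rho> w) = (\<lambda>e. 0)"
        using 2 by (simp add: Rchk_minus_one)
      define y where "y = \<xi> (\<sigma> i) - \<xi> (\<sigma> (Suc (Suc i)))"
      have y: "\<xi> (\<sigma> (Suc i)) - \<xi> (\<sigma> (Suc (Suc i))) = - 1 + y"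
        by (simp add: y_def \<xi>_Suc)
      have nz: "y \<noteq> 0" "- 1 + y \<noteq> 0"
        unfolding y[symmetric] unfolding y_def using 2 i k by (intro xi_diff_nonzero[OF \<sigma>]; simp)+
      have "R \<sigma> w = Rchk (Suc i) (- 1 + y) (Rchk i y (R ?\<rho> w))"
        using R_into[OF \<sigma> k, of w] R_into[of ?\<tau> i w, OF \<tau> i asc] 2 y by (simp add: y_def)
      then have "Rchk i (- 1) (R \<sigma> w) = (\<lambda>e. 0)"
        using yang_baxter[of "- 1" y i "R ?\<rho> w"] nz z by (simp add: Rchk_zero)
      then show ?thesis
        by (simp add: Rchk_minus_one)
    next
      case 3
      \<comment> \<open>The mirror image: the smaller exponent has passed both equal ones to the
        right, and the pair again sits at \<open>k\<close> and \<open>Suc k\<close>.\<close>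
      let ?\<rho> = "?\<tau> \<circ> transpose i (Suc i)"
      have asc: "m (?\<tau> i) < m (?\<tau> (Suc i))"
        using 3 k eq by simp
      have \<rho>: "?\<rho> \<in> S"
        using asc by (intro S_swap[OF \<tau> i]) auto
      have "Pop k (Suc k) (R ?\<rho> w) = R ?\<rho> w"
        using 3 eq by (intro less.hyps[OF less_trans[OF depth_less[OF \<tau> i asc] d\<tau>] \<rho> k(1)]) simp
      then have z: "Rchk k (- 1) (R ?\<rho> w) = (\<lambda>e. 0)"
        by (simp add: Rchk_minus_one)
      define y where "y = \<xi> (\<sigma> k) - \<xi> (\<sigma> (Suc i))"
      have y: "\<xi> (\<sigma> k) - \<xi> (\<sigma> i) = y + - 1"
        by (simp add: y_def \<xi>_Suc)
      have nz: "y \<noteq> 0" "y + - 1 \<noteq> 0"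
        unfolding y[symmetric] unfolding y_def using 3 i k by (intro xi_diff_nonzero[OF \<sigma>]; simp)+
      have e: "\<xi> (\<sigma> k) - \<xi> (\<sigma> (Suc k)) = y + - 1"
        using y 3 by (simp only:)
      have "R \<sigma> w = Rchk k (y + - 1) (Rchk (Suc k) y (R ?\<rho> w))"
        using R_into[OF \<sigma> k, of w] R_into[of ?\<tau> i w, OF \<tau> i asc] 3 unfolding e by (simp add: y_def)
      then have "Rchk (Suc k) (- 1) (R \<sigma> w) = (\<lambda>e. 0)"
        using yang_baxter[of y "- 1" k "R ?\<rho> w"] nz z by (simp add: Rchk_zero)
      then show ?thesis
        using 3 by (simp add: Rchk_minus_one)
    qed
  qed
qed

end

section \<open>The Yangian action\<close>

lemma sum_fun_apply: "(\<Sum>i\<in>A. f i) x = (\<Sum>i\<in>A. f i x)"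
  for f :: "'i \<Rightarrow> 'a \<Rightarrow> 'b::comm_monoid_add"
  by (induction A rule: infinite_finite_induct) auto

text \<open>Arbitrary lists of factors allow the product to be cut around the two positions on which
  the R-matrix acts.\<close>

definition ser :: "(nat \<Rightarrow> 'p \<Rightarrow> 'p) \<Rightarrow> nat list \<Rightarrow> nat \<Rightarrow> (label \<Rightarrow> 'p) \<Rightarrow> (label \<Rightarrow> 'p::comm_monoid_add)" where
  "ser D xs = foldr (\<lambda>i acc. sprod (sfactor D i) acc) xs sone"

lemma ser_Nil: "ser D [] = sone"
  and ser_Cons: "ser D (i # xs) = sprod (sfactor D i) (ser D xs)"
  by (simp_all add: ser_def)

lemma Tser_eq_ser: "Tser D N = ser D [1..<Suc N]"
  by (simp only: Tser_def ser_def)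

abbreviation scal :: "(nat \<Rightarrow> complex) \<Rightarrow> nat \<Rightarrow> complex \<Rightarrow> complex" where
  "scal x \<equiv> \<lambda>i c. x i * c"

lemma scal_funpow: "(scal x i ^^ k) c = x i ^ k * c"
  by (induction k) simp_all

lemma sfactor_scal:
  "sfactor (scal x) i r v = (if r = 0 then v else (\<lambda>e. x i ^ (r - 1) * v (e \<circ> transpose 0 i)))"
  by (simp add: sfactor_def Pop_def scal_funpow)

lemma sfactor_scal_sum:
  "sfactor (scal x) i r (\<Sum>k\<in>A. f k) = (\<Sum>k\<in>A. sfactor (scal x) i r (f k))"
  by (auto simp: sfactor_scal sum_fun_apply sum_distrib_left fun_eq_iff)

lemma Rchk_sum: "Rchk i u (\<Sum>k\<in>A. f k) = (\<Sum>k\<in>A. Rchk i u (f k))"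
  by (auto simp: Rchk_def Pop_def sum_fun_apply sum_distrib_left sum.distrib fun_eq_iff)

text \<open>Associativity of the Cauchy product: both sides sum over all triples of indices with
  total \<open>r\<close>.\<close>

lemma sum_triangle_assoc:
  fixes f :: "nat \<Rightarrow> nat \<Rightarrow> nat \<Rightarrow> 'b::comm_monoid_add"
  shows "(\<Sum>j\<le>r. \<Sum>k\<le>r - j. f j k (r - j - k)) = (\<Sum>q\<le>r. \<Sum>j\<le>q. f j (q - j) (r - q))"
proof -
  have "(\<Sum>j\<le>r. \<Sum>k\<le>r - j. f j k (r - j - k)) = (\<Sum>(j, k)\<in>(SIGMA j:{..r}. {..r - j}). f j k (r - j - k))"
    by (simp add: sum.Sigma)
  also have "\<dots> = (\<Sum>(q, j)\<in>(SIGMA q:{..r}. {..q}). f j (q - j) (r - q))"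
    by (rule sum.reindex_bij_witness[where i="\<lambda>(q, j). (j, q - j)" and j="\<lambda>(j, k). (j + k, j)"]) auto
  finally show ?thesis
    by (simp add: sum.Sigma)
qed

text \<open>The complete homogeneous polynomial of degree n - 1 in two variables, which arises when
  two geometric series are multiplied.\<close>

definition hsum :: "complex \<Rightarrow> complex \<Rightarrow> nat \<Rightarrow> complex" where
  "hsum a b n = (\<Sum>j<n. b ^ (n - Suc j) * a ^ j)"

lemma diff_mult_hsum: "(a - b) * hsum a b n = a ^ n - b ^ n"
  by (simp add: hsum_def power_diff_sumr2)

lemma hsum_commute:
  assumes "a \<noteq> b"
  shows "hsum a b n = hsum b a n"
proof -
  have "(a - b) * hsum a b n = - ((b - a) * hsum b a n)"
    unfolding diff_mult_hsum by simp
  also have "\<dots> = (a - b) * hsum b a n"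
    by (simp add: algebra_simps)
  finally show ?thesis
    using assms by simp
qed

text \<open>The coefficient of \<open>u\<close> to the power \<open>-q\<close> in
  \<open>(1 + P\<^sub>0\<^sub>,\<^sub>i / (u - x\<^sub>i)) (1 + P\<^sub>0\<^sub>,\<^sub>i\<^sub>+\<^sub>1 / (u - x\<^sub>i\<^sub>+\<^sub>1))\<close>.\<close>
definition pair_coeff :: "(nat \<Rightarrow> complex) \<Rightarrow> nat \<Rightarrow> nat \<Rightarrow> tvec \<Rightarrow> tvec" where
  "pair_coeff x i q v = (\<Sum>j\<le>q. sfactor (scal x) i j (sfactor (scal x) (Suc i) (q - j) v))"

lemma sprod_pair:
  "sprod (sfactor (scal x) i) (sprod (sfactor (scal x) (Suc i)) A) r v = (\<Sum>q\<le>r. pair_coeff x i q (A (r - q) v))"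
  unfolding sprod_def pair_coeff_def sfactor_scal_sum
  by (rule sum_triangle_assoc[where f="\<lambda>j k l. sfactor (scal x) i j (sfactor (scal x) (Suc i) k (A l v))"])

lemma pair_coeff_apply:
  "pair_coeff x i q v e = (if q = 0 then v e else
    x i ^ (q - 1) * v (e \<circ> transpose 0 i) + x (Suc i) ^ (q - 1) * v (e \<circ> transpose 0 (Suc i)) +
    hsum (x i) (x (Suc i)) (q - 1) * v (e \<circ> transpose 0 i \<circ> transpose 0 (Suc i)))"
proof (cases q)
  case 0
  then show ?thesis
    by (simp add: pair_coeff_def sfactor_scal)
next
  case (Suc n)
  let ?F = "\<lambda>j. sfactor (scal x) i j (sfactor (scal x) (Suc i) (q - j) v) e"
  have "pair_coeff x i q v e = (\<Sum>j\<le>Suc n. ?F j)"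
    by (simp add: pair_coeff_def sum_fun_apply Suc)
  \<comment> \<open>The two extreme terms take the summand 1 from one of the factors; only the terms
    between them contain both transpositions.\<close>
  also have "\<dots> = ?F 0 + (\<Sum>j<n. ?F (Suc j)) + ?F (Suc n)"
    by (simp only: sum.atMost_shift sum.lessThan_Suc add.assoc)
  also have "(\<Sum>j<n. ?F (Suc j)) = (\<Sum>j<n. x (Suc i) ^ (n - Suc j) * x i ^ j * v (e \<circ> transpose 0 i \<circ> transpose 0 (Suc i)))"
    by (intro sum.cong) (auto simp: sfactor_scal Suc)
  also have "\<dots> = hsum (x i) (x (Suc i)) n * v (e \<circ> transpose 0 i \<circ> transpose 0 (Suc i))"
    by (simp add: hsum_def sum_distrib_right)
  finally show ?thesis
    by (simp add: sfactor_scal Suc)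
qed

text \<open>The Yang-Baxter equation in the auxiliary space and the two neighbouring spaces.\<close>
lemma pair_coeff_Rchk:
  assumes "i \<ge> 1" "x i \<noteq> x (Suc i)" "x' i = x (Suc i)" "x' (Suc i) = x i"
  shows "pair_coeff x' i q (Rchk i (- x i + x (Suc i)) v) = Rchk i (- x i + x (Suc i)) (pair_coeff x i q v)"
proof
  fix e :: label
  define a b c where "a = x i" and "b = x (Suc i)" and "c = inverse (- a + b)"
  define h where "h = hsum a b (q - 1)"
  let ?t = "transpose i (Suc i)" and ?r = "transpose 0 i" and ?s = "transpose 0 (Suc i)"
  have h': "hsum b a (q - 1) = h"
    using hsum_commute[of a b] assms(2) by (simp add: h_def a_def b_def)
  have nz: "- a + b \<noteq> 0"
    using assms(2) by (simp add: a_def b_def)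
  have "(- a + b) * h = b ^ (q - 1) - a ^ (q - 1)"
    using diff_mult_hsum[of a b "q - 1"] by (simp add: h_def algebra_simps)
  then have "c * ((- a + b) * h) = c * (b ^ (q - 1) - a ^ (q - 1))"
    by simp
  \<comment> \<open>Here \<open>c\<close> is the scalar part of the R-matrix. Partial fractions
    express the coefficient of the double transposition by the coefficients of the single ones, the
    one relation on which the exchange rests.\<close>
  then have ch: "h = c * b ^ (q - 1) - c * a ^ (q - 1)"
    using nz by (simp only: c_def mult.assoc[symmetric] left_inverse[OF nz] mult_1 right_diff_distrib)
  have "i \<noteq> 0"
    using assms(1) by simp
  then have t': "?r (?t k) = ?t (?s k)" "?s (?t k) = ?t (?r k)" "?t (?s (?r k)) = ?s k" "?t (?r (?s k)) = ?r k" for k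
    by (simp_all add: transpose_def)
  have t: "e \<circ> ?r \<circ> ?t = e \<circ> ?t \<circ> ?s" "e \<circ> ?s \<circ> ?t = e \<circ> ?t \<circ> ?r"
    "e \<circ> ?r \<circ> ?s \<circ> ?t = e \<circ> ?s" "e \<circ> ?t \<circ> ?r \<circ> ?s = e \<circ> ?r"
    by (simp_all add: fun_eq_iff t')
  show "pair_coeff x' i q (Rchk i (- x i + x (Suc i)) v) e = Rchk i (- x i + x (Suc i)) (pair_coeff x i q v) e"
  proof (cases "q = 0")
    case True
    then show ?thesis
      by (simp add: Rchk_def Pop_def pair_coeff_apply)
  next
    case False
    have L: "pair_coeff x' i q (Rchk i (- x i + x (Suc i)) v) e =
      b ^ (q - 1) * (c * v (e \<circ> ?r) + v (e \<circ> ?t \<circ> ?s)) +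
      a ^ (q - 1) * (c * v (e \<circ> ?s) + v (e \<circ> ?t \<circ> ?r)) +
      h * (c * v (e \<circ> ?r \<circ> ?s) + v (e \<circ> ?s))"
      unfolding pair_coeff_apply Rchk_def Pop_def t assms(3,4) a_def[symmetric] b_def[symmetric]
        c_def[symmetric] h' by (simp only: False if_False)
    have R: "Rchk i (- x i + x (Suc i)) (pair_coeff x i q v) e =
      c * (a ^ (q - 1) * v (e \<circ> ?r) + b ^ (q - 1) * v (e \<circ> ?s) + h * v (e \<circ> ?r \<circ> ?s)) +
      (a ^ (q - 1) * v (e \<circ> ?t \<circ> ?r) + b ^ (q - 1) * v (e \<circ> ?t \<circ> ?s) + h * v (e \<circ> ?r))"
      unfolding pair_coeff_apply Rchk_def Pop_def t a_def[symmetric] b_def[symmetric]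
        c_def[symmetric] h_def[symmetric] by (simp only: False if_False)
    \<comment> \<open>All powers and values of \<open>v\<close> are abstracted, so that a polynomial
      identity in independent variables remains.\<close>
    have alg: "B * (c * p + s) + A * (c * p' + s') + H * (c * z + p') =
        c * (A * p + B * p' + H * z) + (A * s' + B * s + H * p)"
      if "H = c * B - c * A" for A B H p p' s s' z :: complex
      unfolding that by (simp add: algebra_simps)
    show ?thesis
      unfolding L R by (rule alg[OF ch])
  qed
qed

lemma sfactor_Rchk_far:
  assumes "i \<ge> 1" "j \<noteq> i" "j \<noteq> Suc i" "x' j = x j"
  shows "sfactor (scal x') j r (Rchk i u v) = Rchk i u (sfactor (scal x) j r v)"
proof -
  have c: "e \<circ> transpose 0 j \<circ> transpose i (Suc i) = e \<circ> transpose i (Suc i) \<circ> transpose 0 j" for e :: label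
    using assms by (auto simp: fun_eq_iff transpose_def)
  show ?thesis
    unfolding sfactor_scal Rchk_def Pop_def by (simp add: c assms(4) algebra_simps)
qed

text \<open>The suffix \<open>ys\<close> makes the lemma serve twice: empty for the factors to the
  right of the pair, then containing the pair for the factors to its left.\<close>

lemma ser_Rchk_far:
  assumes "i \<ge> 1" "\<And>j. j \<in> set xs \<Longrightarrow> j \<noteq> i \<and> j \<noteq> Suc i \<and> x' j = x j"
    and "\<And>r v. ser (scal x') ys r (Rchk i u v) = Rchk i u (ser (scal x) ys r v)"
  shows "ser (scal x') (xs @ ys) r (Rchk i u v) = Rchk i u (ser (scal x) (xs @ ys) r v)"
  using assms(2)
proof (induction xs arbitrary: r)
  case Nil
  then show ?case
    using assms(3) by simp
next
  case (Cons j xs)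
  then show ?case
    using sfactor_Rchk_far[OF assms(1), of j x' x]
    by (simp add: ser_Cons sprod_def Rchk_sum)
qed

lemma Tser_Rchk:
  assumes "i \<in> {1..<N}" "x i \<noteq> x (Suc i)"
  shows "Tser (scal (x \<circ> transpose i (Suc i))) N r (Rchk i (- x i + x (Suc i)) v)
    = Rchk i (- x i + x (Suc i)) (Tser (scal x) N r v)"
proof -
  let ?x' = "x \<circ> transpose i (Suc i)" and ?u = "- x i + x (Suc i)"
  have i: "i \<ge> 1"
    using assms(1) by simp
  have "ser (scal ?x') [] r (Rchk i ?u v) = Rchk i ?u (ser (scal x) [] r v)" for r v
    by (auto simp: ser_Nil sone_def Rchk_def Pop_def fun_eq_iff)
  then have "ser (scal ?x') ([Suc (Suc i)..<Suc N] @ []) r (Rchk i ?u v)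
      = Rchk i ?u (ser (scal x) ([Suc (Suc i)..<Suc N] @ []) r v)" for r v
    by (intro ser_Rchk_far[OF i]) (auto simp: transpose_def)
  then have post: "ser (scal ?x') [Suc (Suc i)..<Suc N] r (Rchk i ?u v)
      = Rchk i ?u (ser (scal x) [Suc (Suc i)..<Suc N] r v)" for r v
    by (simp only: append_Nil2)
  have pair: "ser (scal ?x') (i # Suc i # [Suc (Suc i)..<Suc N]) r (Rchk i ?u v)
      = Rchk i ?u (ser (scal x) (i # Suc i # [Suc (Suc i)..<Suc N]) r v)" for r v
    unfolding ser_Cons sprod_pair Rchk_sum post
    by (intro sum.cong refl pair_coeff_Rchk[OF i assms(2)]) simp_all
  have "ser (scal ?x') ([1..<i] @ i # Suc i # [Suc (Suc i)..<Suc N]) r (Rchk i ?u v)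
      = Rchk i ?u (ser (scal x) ([1..<i] @ i # Suc i # [Suc (Suc i)..<Suc N]) r v)"
    by (intro ser_Rchk_far[OF i _ pair]) (auto simp: transpose_def)
  moreover have "[1..<Suc N] = [1..<i] @ i # Suc i # [Suc (Suc i)..<Suc N]"
  proof -
    have "[1..<Suc N] = [1..<i] @ [i..<Suc N]"
      using assms(1) upt_add_eq_append[of 1 i "Suc N - i"] by simp
    also have "[i..<Suc N] = i # Suc i # [Suc (Suc i)..<Suc N]"
      using assms(1) by (simp add: upt_conv_Cons del: upt_Suc)
    finally show ?thesis .
  qed
  ultimately show ?thesis
    unfolding Tser_eq_ser by (simp only:)
qed

text \<open>The tensor product of the auxiliary basis vector with label \<open>b\<close> and
  \<open>v\<close>; resetting position 0 returns to labels without auxiliary space.\<close>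

definition attach :: "nat \<Rightarrow> (label \<Rightarrow> 'p) \<Rightarrow> label \<Rightarrow> 'p::zero" where
  "attach b v = (\<lambda>e. if e 0 = b then v (e(0 := 0)) else 0)"

lemma Tab_attach: "Tab D N a b r v = (\<lambda>e. if e 0 = 0 then Tser D N r (attach b v) (e(0 := a)) else 0)"
  unfolding Tab_def attach_def ..

lemma fun_upd_zero_transpose:
  assumes "i \<ge> 1"
  shows "(e \<circ> transpose i (Suc i))(0 := a) = e(0 := a) \<circ> transpose i (Suc i)"
  using assms by (auto simp: fun_eq_iff transpose_def)

lemma attach_Rchk:
  assumes "i \<ge> 1"
  shows "attach b (Rchk i u v) = Rchk i u (attach b v)"
proof
  fix e :: label
  have "(e \<circ> transpose i (Suc i)) 0 = e 0"
    using assms by simp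
  then show "attach b (Rchk i u v) e = Rchk i u (attach b v) e"
    unfolding attach_def Rchk_def Pop_def fun_upd_zero_transpose[OF assms] by simp
qed

lemma Tab_Rchk:
  assumes "i \<in> {1..<N}" "x i \<noteq> x (Suc i)"
  shows "Tab (scal (x \<circ> transpose i (Suc i))) N a b r (Rchk i (- x i + x (Suc i)) v)
    = Rchk i (- x i + x (Suc i)) (Tab (scal x) N a b r v)"
proof
  fix e :: label
  have i: "i \<ge> 1"
    using assms(1) by simp
  have e0: "(e \<circ> transpose i (Suc i)) 0 = e 0"
    using i by simp
  show "Tab (scal (x \<circ> transpose i (Suc i))) N a b r (Rchk i (- x i + x (Suc i)) v) e
    = Rchk i (- x i + x (Suc i)) (Tab (scal x) N a b r v) e"
    unfolding Tab_attach attach_Rchk[OF i] Tser_Rchk[OF assms]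
    unfolding Rchk_def Pop_def e0 fun_upd_zero_transpose[OF i] by simp
qed

context dunkl_setting
begin

section \<open>The action on expansions in the eigenbasis\<close>

lemma lift_cong: "(\<And>\<sigma>. \<sigma> \<in> S \<Longrightarrow> V \<sigma> = W \<sigma>) \<Longrightarrow> lift V = lift W"
  by (simp add: lift_def)

lemma lift_inj: "lift V = lift W \<Longrightarrow> \<sigma> \<in> S \<Longrightarrow> V \<sigma> = W \<sigma>"
proof
  fix e assume eq: "lift V = lift W" and \<sigma>: "\<sigma> \<in> S"
  show "V \<sigma> e = W \<sigma> e"
    using Phi_coeff_unique[of "\<lambda>\<sigma>. V \<sigma> e" "\<lambda>\<sigma>. W \<sigma> e", OF _ \<sigma>] fun_cong[OF fun_cong[OF eq], of e]
    by (simp add: lift_def)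
qed

lemma lift_sum: "(\<Sum>j\<in>A. lift (V j)) = lift (\<lambda>\<sigma>. \<Sum>j\<in>A. V j \<sigma>)"
proof (intro ext)
  fix e k
  show "(\<Sum>j\<in>A. lift (V j)) e k = lift (\<lambda>\<sigma>. \<Sum>j\<in>A. V j \<sigma>) e k"
    unfolding lift_def sum_fun_apply sum_distrib_right by (rule sum.swap)
qed

lemma dunkl_funpow_sum:
  assumes "i \<in> {1..N}"
  shows "(dunkl N \<alpha> i ^^ r) (\<lambda>k. \<Sum>\<sigma>\<in>S. c \<sigma> * \<Phi> \<sigma> k) = (\<lambda>k. \<Sum>\<sigma>\<in>S. xi_sig \<alpha> m \<sigma> i ^ r * c \<sigma> * \<Phi> \<sigma> k)"
proof (induction r)
  case (Suc r)
  have "(dunkl N \<alpha> i ^^ Suc r) (\<lambda>k. \<Sum>\<sigma>\<in>S. c \<sigma> * \<Phi> \<sigma> k)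
      = dunkl N \<alpha> i (\<lambda>k. \<Sum>\<sigma>\<in>S. xi_sig \<alpha> m \<sigma> i ^ r * c \<sigma> * \<Phi> \<sigma> k)"
    by (simp add: Suc)
  also have "\<dots> = (\<lambda>k. \<Sum>\<sigma>\<in>S. xi_sig \<alpha> m \<sigma> i ^ r * c \<sigma> * dunkl N \<alpha> i (\<Phi> \<sigma>) k)"
    by (rule dunkl_sum[OF finite_S Phi_valid])
  also have "\<dots> = (\<lambda>k. \<Sum>\<sigma>\<in>S. xi_sig \<alpha> m \<sigma> i ^ Suc r * c \<sigma> * \<Phi> \<sigma> k)"
    using Phi_dunkl[OF _ assms] by (intro ext sum.cong) auto
  finally show ?case .
qed simp

lemma sfactor_lift:
  assumes "i \<in> {1..N}"
  shows "sfactor (dunkl N \<alpha>) i r (lift V) = lift (\<lambda>\<sigma>. sfactor (scal (xi_sig \<alpha> m \<sigma>)) i r (V \<sigma>))"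
proof (cases "r = 0")
  case True
  then show ?thesis
    by (simp add: sfactor_def)
next
  case False
  then show ?thesis
    unfolding sfactor_def Pop_def scal_funpow lift_def
    using dunkl_funpow_sum[OF assms] by simp
qed

lemma ser_lift:
  assumes "set xs \<subseteq> {1..N}"
  shows "ser (dunkl N \<alpha>) xs r (lift V) = lift (\<lambda>\<sigma>. ser (scal (xi_sig \<alpha> m \<sigma>)) xs r (V \<sigma>))"
  using assms
proof (induction xs arbitrary: r)
  case Nil
  show ?case
    by (auto simp: ser_Nil sone_def lift_def fun_eq_iff)
next
  case (Cons i xs)
  then show ?case
    by (simp add: ser_Cons sprod_def sfactor_lift lift_sum)
qed

lemma attach_lift: "attach b (lift V) = lift (\<lambda>\<sigma>. attach b (V \<sigma>))"
  by (auto simp: attach_def lift_def fun_eq_iff)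

lemma Tab_lift:
  "Tab (dunkl N \<alpha>) N a b r (lift V) = lift (\<lambda>\<sigma>. Tab (scal (xi_sig \<alpha> m \<sigma>)) N a b r (V \<sigma>))"
proof -
  have "ser (dunkl N \<alpha>) [1..<Suc N] r (lift V) = lift (\<lambda>\<sigma>. ser (scal (xi_sig \<alpha> m \<sigma>)) [1..<Suc N] r (V \<sigma>))" for V
    by (rule ser_lift) auto
  then show ?thesis
    unfolding Tab_attach attach_lift Tser_eq_ser by (auto simp: lift_def fun_eq_iff)
qed

text \<open>A recursion step exchanges two neighbouring eigenvalues, which is exactly the exchange
  of parameters that occurs when the R-matrix passes through the product.\<close>

lemma Tab_R:
  assumes "\<sigma> \<in> S"
  shows "R \<sigma> (TW N \<alpha> m a b r v) = Tab (scal (xi_sig \<alpha> m \<sigma>)) N a b r (R \<sigma> v)"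
  using assms
proof (induction rule: R_induct)
  case id
  have "xi_sig \<alpha> m id = \<xi>"
    by (auto simp: xi_sig_eq)
  then show ?case
    unfolding R_id TW_def by (simp only:)
next
  case (step \<sigma> i)
  have x: "xi_sig \<alpha> m (\<sigma> \<circ> transpose i (Suc i)) = xi_sig \<alpha> m \<sigma> \<circ> transpose i (Suc i)"
    by (auto simp: xi_sig_eq)
  have "xi_sig \<alpha> m \<sigma> i \<noteq> xi_sig \<alpha> m \<sigma> (Suc i)"
    using xi_diff_nonzero[OF step(1), of i "Suc i"] step(2) by (simp add: xi_sig_eq)
  then show ?case
    unfolding R_step[OF step(1-3)] step(4) x by (intro Tab_Rchk[OF step(2), symmetric])
qed

section \<open>The isomorphism\<close>

lemma Um_lift: "Um N \<alpha> m v = lift (\<lambda>\<sigma>. R \<sigma> v)"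
  by (simp add: Um_def lift_def)

lemma Um_TW: "Um N \<alpha> m (TW N \<alpha> m a b r v) = TH N \<alpha> a b r (Um N \<alpha> m v)"
  unfolding Um_lift TH_def Tab_lift by (rule lift_cong) (rule Tab_R)

lemma lift_in_Bm_iff:
  "lift V \<in> Bm N n \<alpha> m \<longleftrightarrow> valid_hvec N n (lift V) \<and>
    (\<forall>i\<in>{1..<N}. (\<lambda>e. Kop i (Suc i) (Pop i (Suc i) (lift V) e)) = lift V)"
proof -
  have "lift V e \<in> Em N \<alpha> m" for e
    unfolding Em_def lift_def mem_Collect_eq by (rule exI[of _ "\<lambda>\<sigma>. V \<sigma> e"]) (rule refl)
  then show ?thesis
    by (simp add: Bm_def Hplus_def)
qed

lemma Wm_Pop: "w \<in> Wm N n m \<Longrightarrow> i \<in> {1..<N} \<Longrightarrow> m i = m (Suc i) \<Longrightarrow> Pop i (Suc i) w = w"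
  by (simp add: Wm_def)

lemma Um_in_Bm:
  assumes "w \<in> Wm N n m"
  shows "Um N \<alpha> m w \<in> Bm N n \<alpha> m"
  unfolding Um_lift lift_in_Bm_iff
proof (intro conjI ballI)
  have v: "valid_tvec N n w"
    using assms by (simp add: Wm_def)
  have "lift (\<lambda>\<sigma>. R \<sigma> w) e = 0" if "\<not> valid_label N n e" for e
  proof
    fix k
    have "R \<sigma> w e = 0" if "\<sigma> \<in> S" for \<sigma>
      using R_valid[OF that v] \<open>\<not> valid_label N n e\<close> by (auto simp: valid_tvec_def)
    then show "lift (\<lambda>\<sigma>. R \<sigma> w) e k = 0 k"
      by (simp add: lift_def)
  qed
  moreover have "valid_lpoly N (lift (\<lambda>\<sigma>. R \<sigma> w) e)" for e
    unfolding lift_def by (rule valid_lpoly_sum[OF finite_S Phi_valid])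
  ultimately show "valid_hvec N n (lift (\<lambda>\<sigma>. R \<sigma> w))"
    unfolding valid_hvec_def by blast
next
  fix i assume i: "i \<in> {1..<N}"
  show "(\<lambda>e. Kop i (Suc i) (Pop i (Suc i) (lift (\<lambda>\<sigma>. R \<sigma> w)) e)) = lift (\<lambda>\<sigma>. R \<sigma> w)"
    unfolding lift_invariant_iff[OF i]
    using R_equal[OF Wm_Pop[OF assms] _ i] R_step[OF _ i] by blast
qed

lemma Um_surj:
  assumes "h \<in> Bm N n \<alpha> m"
  shows "\<exists>w\<in>Wm N n m. Um N \<alpha> m w = h"
proof -
  have "\<forall>e. \<exists>c. h e = (\<lambda>k. \<Sum>\<sigma>\<in>S. c \<sigma> * \<Phi> \<sigma> k)"
    using assms by (simp add: Bm_def Em_def)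
  then obtain C where C: "\<And>e. h e = (\<lambda>k. \<Sum>\<sigma>\<in>S. C e \<sigma> * \<Phi> \<sigma> k)"
    by metis
  define V where "V = (\<lambda>\<sigma> e. C e \<sigma>)"
  have h: "h = lift V"
    unfolding lift_def V_def using C by blast
  note B = assms[unfolded h lift_in_Bm_iff]
  have inv: "\<forall>\<sigma>\<in>S. (m (\<sigma> i) = m (\<sigma> (Suc i)) \<longrightarrow> Pop i (Suc i) (V \<sigma>) = V \<sigma>) \<and>
      (m (\<sigma> i) > m (\<sigma> (Suc i)) \<longrightarrow> V (\<sigma> \<circ> transpose i (Suc i)) =
        Rchk i (- xi_sig \<alpha> m \<sigma> i + xi_sig \<alpha> m \<sigma> (Suc i)) (V \<sigma>))" if "i \<in> {1..<N}" for i
    using B that by (subst lift_invariant_iff[OF that, symmetric]) blast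
  have "V id \<in> Wm N n m"
    unfolding Wm_def mem_Collect_eq
  proof (intro conjI ballI impI)
    show "valid_tvec N n (V id)"
      unfolding valid_tvec_def
    proof (intro allI impI, rule ccontr)
      fix e assume e: "V id e \<noteq> 0" "\<not> valid_label N n e"
      \<comment> \<open>A label that is not valid has zero polynomial part; independence of the
        eigenbasis passes this on to each coefficient.\<close>
      then have z: "lift V e = 0"
        using B by (auto simp: valid_hvec_def)
      have "(\<Sum>\<sigma>\<in>S. V \<sigma> e * \<Phi> \<sigma> k) = lift V e k" for k
        by (simp only: lift_def)
      then have "(\<Sum>\<sigma>\<in>S. V \<sigma> e * \<Phi> \<sigma> k) = 0" for k
        unfolding z by simp
      then show False
        using Phi_independent[of "\<lambda>\<sigma>. V \<sigma> e", OF _ id_in_S] e(1) by blast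
    qed
  next
    fix i assume "i \<in> {1..<N}" "m i = m (Suc i)"
    then show "Pop i (Suc i) (V id) = V id"
      using inv[of i] id_in_S by simp
  qed
  moreover have "R \<sigma> (V id) = V \<sigma>" if "\<sigma> \<in> S" for \<sigma>
    using that
  proof (induction rule: R_induct)
    case id
    show ?case
      unfolding R_id ..
  next
    case (step \<sigma> i)
    then show ?case
      using inv[OF step(2)] R_step[OF step(1-3)] by (metis step.IH)
  qed
  then have "Um N \<alpha> m (V id) = h"
    unfolding h Um_lift by (rule lift_cong)
  ultimately show ?thesis
    by blast
qed

lemma Um_bij: "bij_betw (Um N \<alpha> m) (Wm N n m) (Bm N n \<alpha> m)"
proof (rule bij_betw_imageI)
  show "inj_on (Um N \<alpha> m) (Wm N n m)"
  proof (rule inj_onI)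
    fix v w assume "Um N \<alpha> m v = Um N \<alpha> m w"
    \<comment> \<open>The coefficient at \<open>\<Phi> id\<close> returns the original
      vector.\<close>
    then have "R id v = R id w"
      using lift_inj[of "\<lambda>\<sigma>. R \<sigma> v" "\<lambda>\<sigma>. R \<sigma> w", OF _ id_in_S] by (simp only: Um_lift)
    then show "v = w"
      by (simp only: R_id)
  qed
  show "Um N \<alpha> m ` Wm N n m = Bm N n \<alpha> m"
    using Um_in_Bm Um_surj by blast
qed

lemma Um_add: "Um N \<alpha> m (\<lambda>e. v e + w e) = (\<lambda>e k. Um N \<alpha> m v e k + Um N \<alpha> m w e k)"
  by (auto simp: Um_def R_add distrib_right sum.distrib fun_eq_iff)

lemma Um_scale: "Um N \<alpha> m (\<lambda>e. c * v e) = (\<lambda>e k. c * Um N \<alpha> m v e k)"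
  by (auto simp: Um_def R_scale sum_distrib_left mult.assoc fun_eq_iff)

end

theorem theorem2:
  fixes N n :: nat and \<alpha> :: real and m :: expo
  assumes "N \<ge> 1" and "n \<ge> 1" and "\<alpha> > 0" and "m \<in> MN N"
  shows "(\<forall>w\<in>Wm N n m. Um N \<alpha> m w \<in> Bm N n \<alpha> m)
       \<and> (\<forall>v w. Um N \<alpha> m (\<lambda>e. v e + w e) = (\<lambda>e m'. Um N \<alpha> m v e m' + Um N \<alpha> m w e m'))
       \<and> (\<forall>c v. Um N \<alpha> m (\<lambda>e. c * v e) = (\<lambda>e m'. c * Um N \<alpha> m v e m'))
       \<and> bij_betw (Um N \<alpha> m) (Wm N n m) (Bm N n \<alpha> m)
       \<and> (\<forall>w\<in>Wm N n m. \<forall>a\<in>{1..n}. \<forall>b\<in>{1..n}. \<forall>r.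
            Um N \<alpha> m (TW N \<alpha> m a b r w) = TH N \<alpha> a b r (Um N \<alpha> m w))"
proof -
  interpret dunkl_setting N \<alpha> m
    using assms by unfold_locales
  show ?thesis
    using Um_in_Bm Um_add Um_scale Um_bij Um_TW by blast
qed

end
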